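(* Let $1<\alpha<2$ and let $X_t$ be a stable Lévy process on $\mathbb{R}$ of index $\alpha$ with generator $$Lf(x)=-af'(x)+\int_{y\ne 0}\bigl[f(x-y)-f(x)+yf'(x)\bigr]\,\phi(dy),$$ where $a\in\mathbb{R}$ and $$\phi(dy)=\begin{cases} b\,\dfrac{\alpha(\alpha-1)}{\Gamma(2-\alpha)}\,y^{-\alpha-1}\,dy & \text{for } y>0,\\[8pt] c\,\dfrac{\alpha(\alpha-1)}{\Gamma(2-\alpha)}\,|y|^{-\alpha-1}\,dy & \text{for } y<0,\end{cases}$$ with $b,c\ge 0$ not both zero. Let $\Omega=(\ell,R)$ with real numbers $\ell<R$, and let $L_\Omega$ be the generator of the killed process on $C_0(\Omega)$. For $f\in C_0^2(\Omega)$ and $x\in\Omega$ let $$L^pf(x)=-a\,\partial_xf(x)+\int_{-\infty}^{\infty}\bigl[f(x-y)-f(x)+yf'(x)\bigr]\,\phi(dy),$$ where the integral is applied to the zero extension of $f$ (that is, $f(x)=0$ for $x\notin\Omega$). Then $$L^pf(x)=-a\,\partial_xf(x)+b\,\mathbb{D}^\alpha_{[\ell,x]}f(x)+c\,\mathbb{D}^\alpha_{[x,R]}f(x)\quad\text{for } f\in C_0^2(\Omega),\ x\in\Omega,$$ and for any $f\in C_0^2(\Omega)$ such that $L^pf\in C_0(\Omega)$, the killed generator is given by $L_\Omega f(x)=L^pf(x)$ for all $x\in\Omega$.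
   Context: $C_0(\Omega)$ is the Banach space (supremum norm) of continuous real functions on $\Omega$ that tend to zero as $x\in\Omega$ approaches the boundary. $C_0^2(\Omega)$ is the set of functions in $C_0(\Omega)$ whose first and second derivatives are continuous at every $x\in\Omega$ (no boundedness near the boundary is required). Killed process: $\tau_\Omega=\inf\{t>0:X_t\notin\Omega\}$, $X^\Omega_t=X_t$ for $t<\tau_\Omega$, and $X_t^\Omega=\partial$ (a cemetery point, where functions are taken to be $0$) for $t\ge\tau_\Omega$. The killed semigroup is $P_t^\Omega f(x)=\mathbb{E}^x[f(X_t^\Omega)]$, a Feller semigroup on $C_0(\Omega)$; its generator is $L_\Omega f=\lim_{t\searrow 0}(P_t^\Omega f-f)/t$ (limit in $C_0(\Omega)$), with domain $\mathcal{D}(L_\Omega)$ the set of $f\in C_0(\Omega)$ for which the limit exists. The assertion $L_\Omega f=L^pf$ includes $f\in\mathcal{D}(L_\Omega)$. Riemann–Liouville fractional derivatives, for $1<\alpha<2$: $$\mathbb{D}^\alpha_{[\ell,x]}f(x)=\frac{1}{\Gamma(2-\alpha)}\frac{d^2}{dx^2}\int_\ell^xf(y)(x-y)^{1-\alpha}\,dy,\qquad \mathbb{D}^\alpha_{[x,R]}f(x)=\frac{1}{\Gamma(2-\alpha)}\frac{d^2}{dx^2}\int_x^Rf(y)(y-x)^{1-\alpha}\,dy.$$ *)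

theory Defs
  imports "HOL-Probability.Probability"
begin

section \<open>Function spaces\<close>

text \<open>
  A function on an open set \<open>\<Omega> \<subseteq> \<real>\<close> is represented by any total function that agrees with it
  on \<open>\<Omega>\<close>; values outside \<open>\<Omega>\<close> are never relevant to membership in the spaces below or to
  the operators evaluated at points of \<open>\<Omega>\<close>.  The condition at infinity is void for bounded \<open>\<Omega>\<close>, and it is the only
  boundary condition for \<open>\<Omega> = UNIV\<close>.
\<close>

definition C0 :: "real set \<Rightarrow> (real \<Rightarrow> real) set" where
  "C0 \<Omega> = {f. continuous_on \<Omega> f \<and>
              (\<forall>z\<in>frontier \<Omega>. (f \<longlongrightarrow> 0) (at z within \<Omega>)) \<and>
              (f \<longlongrightarrow> 0) (inf at_infinity (principal \<Omega>))}"

definition C02 :: "real set \<Rightarrow> (real \<Rightarrow> real) set" where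
  "C02 \<Omega> = {f \<in> C0 \<Omega>. (\<forall>x\<in>\<Omega>. f differentiable (at x)) \<and> continuous_on \<Omega> (deriv f) \<and>
                       (\<forall>x\<in>\<Omega>. deriv f differentiable (at x)) \<and>
                       continuous_on \<Omega> (deriv (deriv f))}"

text \<open>
  The usual space of test functions for the generator of a Levy process on the whole line:
  here, unlike in \<open>C02\<close>, the derivatives also vanish at infinity.
\<close>

definition C02_line :: "(real \<Rightarrow> real) set" where
  "C02_line = {f \<in> C02 UNIV. deriv f \<in> C0 UNIV \<and> deriv (deriv f) \<in> C0 UNIV}"

definition zero_ext :: "real set \<Rightarrow> (real \<Rightarrow> real) \<Rightarrow> real \<Rightarrow> real" where
  "zero_ext \<Omega> f x = (if x \<in> \<Omega> then f x else 0)"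

section \<open>Generators\<close>

text \<open>
  The generator of a semigroup \<open>P\<close> on \<open>C0 \<Omega>\<close>, as a graph: \<open>(f, g)\<close> belongs to it iff \<open>f\<close> is in
  the domain and the generator maps \<open>f\<close> to the function represented by \<open>g\<close> on \<open>\<Omega>\<close>.
\<close>

definition feller_generator ::
    "real set \<Rightarrow> (real \<Rightarrow> (real \<Rightarrow> real) \<Rightarrow> real \<Rightarrow> real) \<Rightarrow> ((real \<Rightarrow> real) \<times> (real \<Rightarrow> real)) set" where
  "feller_generator \<Omega> P = {(f, g). f \<in> C0 \<Omega> \<and> g \<in> C0 \<Omega> \<and>
     uniform_limit \<Omega> (\<lambda>t x. (P t f x - f x) / t) g (at_right 0)}"

section \<open>Levy processes and killing\<close>

locale levy_process = prob_space M for M :: "'w measure" +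
  fixes X :: "real \<Rightarrow> 'w \<Rightarrow> real"
  assumes random_variable_X: "\<And>t. 0 \<le> t \<Longrightarrow> X t \<in> borel_measurable M"
    and start_zero: "AE w in M. X 0 w = 0"
    and indep_increments:
      "\<And>(ts :: nat \<Rightarrow> real) n. 0 \<le> ts 0 \<Longrightarrow> (\<And>i. i < n \<Longrightarrow> ts i \<le> ts (Suc i)) \<Longrightarrow>
         indep_vars (\<lambda>_. borel) (\<lambda>i w. X (ts (Suc i)) w - X (ts i) w) {..<n}"
    and stationary_increments:
      "\<And>s h. 0 \<le> s \<Longrightarrow> 0 \<le> h \<Longrightarrow>
         distr M borel (\<lambda>w. X (s + h) w - X s w) = distr M borel (X h)"
    and cadlag_paths:
      "AE w in M. (\<forall>t\<ge>0. continuous (at_right t) (\<lambda>s. X s w)) \<and>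
                  (\<forall>t>0. \<exists>y. ((\<lambda>s. X s w) \<longlongrightarrow> y) (at_left t))"

text \<open>Stable in the wide sense: a centring constant \<open>d\<close> is allowed.\<close>

locale stable_levy_process = levy_process M X
    for M :: "'w measure" and X :: "real \<Rightarrow> 'w \<Rightarrow> real" +
  fixes \<alpha> :: real
  assumes stable: "\<And>r. 0 < r \<Longrightarrow> \<exists>d. distr M borel (X r) =
                     distr M borel (\<lambda>w. r powr (1 / \<alpha>) * X 1 w + d)"

text \<open>
  The process \<open>X\<close> starts at \<open>0\<close>; under the law with starting point \<open>x\<close> the process is
  \<open>\<lambda>t. x + X t\<close>.
\<close>

definition transition_semigroup ::
    "'w measure \<Rightarrow> (real \<Rightarrow> 'w \<Rightarrow> real) \<Rightarrow> real \<Rightarrow> (real \<Rightarrow> real) \<Rightarrow> real \<Rightarrow> real" where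
  "transition_semigroup M X t f x = (LINT w|M. f (x + X t w))"

definition exit_time :: "(real \<Rightarrow> 'w \<Rightarrow> real) \<Rightarrow> real set \<Rightarrow> real \<Rightarrow> 'w \<Rightarrow> ereal" where
  "exit_time X \<Omega> x w = Inf {ereal t |t. 0 < t \<and> x + X t w \<notin> \<Omega>}"

text \<open>\<open>None\<close> is the cemetery point.\<close>

definition killed_process ::
    "(real \<Rightarrow> 'w \<Rightarrow> real) \<Rightarrow> real set \<Rightarrow> real \<Rightarrow> real \<Rightarrow> 'w \<Rightarrow> real option" where
  "killed_process X \<Omega> x t w = (if ereal t < exit_time X \<Omega> x w then Some (x + X t w) else None)"

text \<open>
  The exit time is an infimum over uncountably many times and in general measurable only up to
  null sets, so the expectation is taken with respect to the completion of \<open>M\<close>.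
\<close>

definition killed_semigroup ::
    "'w measure \<Rightarrow> (real \<Rightarrow> 'w \<Rightarrow> real) \<Rightarrow> real set \<Rightarrow> real \<Rightarrow> (real \<Rightarrow> real) \<Rightarrow> real \<Rightarrow> real" where
  "killed_semigroup M X \<Omega> t f x =
     (LINT w|completion M. (case killed_process X \<Omega> x t w of None \<Rightarrow> 0 | Some y \<Rightarrow> f y))"

section \<open>The stable operator\<close>

definition jump_measure :: "real \<Rightarrow> real \<Rightarrow> real \<Rightarrow> real measure" where
  "jump_measure \<alpha> b c = density lborel (\<lambda>y. ennreal
     (if y > 0 then b * (\<alpha> * (\<alpha> - 1) / Gamma (2 - \<alpha>)) * y powr (- \<alpha> - 1)
      else if y < 0 then c * (\<alpha> * (\<alpha> - 1) / Gamma (2 - \<alpha>)) * \<bar>y\<bar> powr (- \<alpha> - 1)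
      else 0))"

text \<open>
  With the argument \<open>x - y\<close>, the variable \<open>y\<close> is the negative of the jump of the process whose
  transition semigroup has generator \<open>stable_op\<close>.
\<close>

definition jump_integrand :: "(real \<Rightarrow> real) \<Rightarrow> real \<Rightarrow> real \<Rightarrow> real" where
  "jump_integrand f x y = f (x - y) - f x + y * deriv f x"

definition stable_op :: "real \<Rightarrow> real \<Rightarrow> real \<Rightarrow> real \<Rightarrow> (real \<Rightarrow> real) \<Rightarrow> real \<Rightarrow> real" where
  "stable_op \<alpha> a b c f x = - a * deriv f x + (LINT y|jump_measure \<alpha> b c. jump_integrand f x y)"

text \<open>To be evaluated at points of \<open>\<Omega>\<close> only.\<close>

definition stable_op_on ::
    "real set \<Rightarrow> real \<Rightarrow> real \<Rightarrow> real \<Rightarrow> real \<Rightarrow> (real \<Rightarrow> real) \<Rightarrow> real \<Rightarrow> real" where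
  "stable_op_on \<Omega> \<alpha> a b c f = stable_op \<alpha> a b c (zero_ext \<Omega> f)"

section \<open>Riemann--Liouville derivatives of order between 1 and 2\<close>

definition rl_integral_left :: "real \<Rightarrow> real \<Rightarrow> (real \<Rightarrow> real) \<Rightarrow> real \<Rightarrow> real" where
  "rl_integral_left \<alpha> l f x = (LINT y:{l..x}|lborel. f y * (x - y) powr (1 - \<alpha>))"

definition rl_integral_right :: "real \<Rightarrow> real \<Rightarrow> (real \<Rightarrow> real) \<Rightarrow> real \<Rightarrow> real" where
  "rl_integral_right \<alpha> R f x = (LINT y:{x..R}|lborel. f y * (y - x) powr (1 - \<alpha>))"

definition rl_deriv_left :: "real \<Rightarrow> real \<Rightarrow> (real \<Rightarrow> real) \<Rightarrow> real \<Rightarrow> real" where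
  "rl_deriv_left \<alpha> l f x = 1 / Gamma (2 - \<alpha>) * deriv (deriv (rl_integral_left \<alpha> l f)) x"

definition rl_deriv_right :: "real \<Rightarrow> real \<Rightarrow> (real \<Rightarrow> real) \<Rightarrow> real \<Rightarrow> real" where
  "rl_deriv_right \<alpha> R f x = 1 / Gamma (2 - \<alpha>) * deriv (deriv (rl_integral_right \<alpha> R f)) x"

text \<open>
  Since \<open>deriv\<close> and the Lebesgue integral are total, that \<open>stable_op_on\<close> and the fractional
  derivatives are actually defined at a point is expressed separately.
\<close>

definition twice_differentiable_at :: "(real \<Rightarrow> real) \<Rightarrow> real \<Rightarrow> bool" where
  "twice_differentiable_at g x \<longleftrightarrow>
     (\<forall>\<^sub>F y in nhds x. g differentiable (at y)) \<and> deriv g differentiable (at x)"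

definition rl_deriv_left_exists :: "real \<Rightarrow> real \<Rightarrow> (real \<Rightarrow> real) \<Rightarrow> real \<Rightarrow> bool" where
  "rl_deriv_left_exists \<alpha> l f x \<longleftrightarrow>
     (\<forall>\<^sub>F z in nhds x. set_integrable lborel {l..z} (\<lambda>y. f y * (z - y) powr (1 - \<alpha>))) \<and>
     twice_differentiable_at (rl_integral_left \<alpha> l f) x"

definition rl_deriv_right_exists :: "real \<Rightarrow> real \<Rightarrow> (real \<Rightarrow> real) \<Rightarrow> real \<Rightarrow> bool" where
  "rl_deriv_right_exists \<alpha> R f x \<longleftrightarrow>
     (\<forall>\<^sub>F z in nhds x. set_integrable lborel {z..R} (\<lambda>y. f y * (y - z) powr (1 - \<alpha>))) \<and>
     twice_differentiable_at (rl_integral_right \<alpha> R f) x"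

end

theory Submission
  imports Defs
begin

text \<open>
  \<^bold>\<open>The formula.\<close> The two jump directions contribute additively, and both are treated at once by means of a sign \<open>s\<close>.  Near a
  point \<open>x\<close> of the interval, split the zero extension of \<open>f\<close> by a cutoff into a \<open>C2\<close> function with compact support
  and a function vanishing near \<open>x\<close>.  For the first, the fractional integral is differentiated twice under
  the integral sign, and Taylor's formula together with Fubini's theorem identifies the jump integral with the
  fractional integral of the second derivative (\<open>taylor_fubini\<close>).  For the second, the derivatives fall on the kernel, and
  they produce the density of the jump measure.  This is \<open>one_sided_fractional\<close>.

  \<^bold>\<open>The killed generator.\<close> Write \<open>g\<close> for the operator applied to \<open>f\<close>.  The claim is that, uniformly in \<open>x\<close>, the expectation
  of \<open>f\<close> at time \<open>t\<close> before exit is \<open>f x + t g x + o(t)\<close>.  The function \<open>f\<close> need not be in the domain of the generator on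
  the line, so it is multiplied by a cutoff that is \<open>1\<close> on an inner interval \<open>K\<close>; on \<open>K\<close> the operator of the product
  is close to \<open>g\<close> (\<open>cutoff_approximation\<close>).  For the product a Dynkin formula holds up to the exit from \<open>K\<close> observed on a finite
  grid of times (\<open>dynkin_grid\<close>).  It rests on the Markov property at grid points and a telescoping sum:
  at the exit the process is off \<open>K\<close>, where \<open>f\<close> is small, and before the exit it is in \<open>K\<close>, where \<open>g\<close>
  is the right integrand.  Since \<open>g\<close> vanishes at the boundary, stopped averages of \<open>g\<close> stay close to \<open>g x\<close> uniformly in \<open>x\<close>
  (\<open>killed_time_average\<close>); this uses a maximal inequality, which is another instance of the discrete Dynkin formula.

  It remains to refine the grid and to let \<open>K\<close> grow.  The events of survival on the grids converge
  to the event that the path has, up to time \<open>t\<close>, a positive distance from the boundary.  This can differ from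
  survival only if the path touches the boundary as a left limit and jumps back inside at that moment.
  That no jump starts from a given level is shown by counting: on a grid of mesh \<open>h\<close> a large increment has
  probability of order \<open>h\<close>, there are of the order of \<open>1 / h\<close> steps, and independently of the increment
  the process is near the level with small probability, because its laws have no
  atoms (\<open>no_jump_from_level\<close>).  The absence of atoms is where stability enters (\<open>no_atoms\<close>).
\<close>

section \<open>Twice continuously differentiable cutoffs\<close>

definition C2 :: "(real \<Rightarrow> real) \<Rightarrow> bool" where
  "C2 u \<longleftrightarrow> (\<forall>x. u differentiable (at x)) \<and> (\<forall>x. deriv u differentiable (at x)) \<and>
     continuous_on UNIV (deriv (deriv u))"

lemma C2I:
  assumes "\<And>x. (u has_real_derivative u' x) (at x)"
    and "\<And>x. (u' has_real_derivative u'' x) (at x)" and "continuous_on UNIV u''"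
  shows "C2 u"
proof -
  have 1: "deriv u = u'" using assms(1) by (auto intro!: DERIV_imp_deriv)
  have 2: "deriv u' = u''" using assms(2) by (auto intro!: DERIV_imp_deriv)
  show ?thesis unfolding C2_def 1 2
    using assms by (meson real_differentiable_def)
qed

lemma C2D:
  assumes "C2 u"
  shows "(u has_real_derivative deriv u x) (at x)"
    and "(deriv u has_real_derivative deriv (deriv u) x) (at x)"
    and "continuous_on UNIV u" "continuous_on UNIV (deriv u)" "continuous_on UNIV (deriv (deriv u))"
proof -
  show 1: "(u has_real_derivative deriv u x) (at x)" for x
    using assms unfolding C2_def by (metis DERIV_imp_deriv real_differentiable_def)
  show 2: "(deriv u has_real_derivative deriv (deriv u) x) (at x)" for x
    using assms unfolding C2_def by (metis DERIV_imp_deriv real_differentiable_def)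
  show "continuous_on UNIV u" using 1 DERIV_isCont by (simp add: continuous_on_eq_continuous_at) blast
  show "continuous_on UNIV (deriv u)" using 2 DERIV_isCont by (simp add: continuous_on_eq_continuous_at) blast
  show "continuous_on UNIV (deriv (deriv u))" using assms by (simp add: C2_def)
qed

lemma C2_affine: "C2 (\<lambda>x. p * x + q)"
  by (rule C2I[where u' = "\<lambda>_. p" and u'' = "\<lambda>_. 0"]) (auto intro!: derivative_eq_intros)

lemma C2_mult:
  assumes "C2 u" "C2 v" shows "C2 (\<lambda>x. u x * v x)"
  by (rule C2I[where u' = "\<lambda>x. deriv u x * v x + u x * deriv v x"
        and u'' = "\<lambda>x. deriv (deriv u) x * v x + 2 * deriv u x * deriv v x + u x * deriv (deriv v) x"])
    (auto intro!: derivative_eq_intros C2D(1,2)[OF assms(1)] C2D(1,2)[OF assms(2)] continuous_intros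
        C2D(3-5)[OF assms(1)] C2D(3-5)[OF assms(2)])

lemma C2_compose:
  assumes "C2 u" "C2 v" shows "C2 (\<lambda>x. u (v x))"
proof (rule C2I)
  show "((\<lambda>x. u (v x)) has_real_derivative deriv u (v x) * deriv v x) (at x)" for x
    by (rule DERIV_chain2 C2D assms)+
  have "((\<lambda>x. deriv u (v x)) has_real_derivative deriv (deriv u) (v x) * deriv v x) (at x)" for x
    by (rule DERIV_chain2 C2D assms)+
  from DERIV_mult[OF this C2D(2)[OF assms(2)]]
  show "((\<lambda>x. deriv u (v x) * deriv v x) has_real_derivative
      (deriv (deriv u) (v x) * deriv v x * deriv v x + deriv (deriv v) x * deriv u (v x))) (at x)" for x
    by simp
  have *: "continuous_on UNIV (\<lambda>x. w (v x))" if "continuous_on UNIV w" for w :: "real \<Rightarrow> real"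
    using continuous_on_compose2[OF that C2D(3)[OF assms(2)]] by simp
  show "continuous_on UNIV (\<lambda>x. deriv (deriv u) (v x) * deriv v x * deriv v x + deriv (deriv v) x * deriv u (v x))"
    by (intro continuous_intros C2D assms *)
qed

text \<open>
  The positive part of a power is the elementary building block for cutoffs: only two continuous
  derivatives are required of them, so the cube of the positive part can replace the usual
  flat function built from the exponential.
\<close>

lemma DERIV_pos_part_power:
  "((\<lambda>x::real. max 0 x ^ (n + 2)) has_real_derivative real (n + 2) * max 0 x ^ (n + 1)) (at x)"
proof -
  consider "x > 0" | "x < 0" | "x = 0" by linarith
  then show ?thesis
  proof cases
    case 1
    have "((\<lambda>x::real. x ^ (n + 2)) has_real_derivative real (n + 2) * max 0 x ^ (n + 1)) (at x)"
      using 1 DERIV_pow[of "n + 2" x] by simp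
    then show ?thesis
      by (rule has_field_derivative_transform_within_open[where S="{0<..}"]) (use 1 in auto)
  next
    case 2
    have "((\<lambda>x::real. 0) has_real_derivative real (n + 2) * max 0 x ^ (n + 1)) (at x)"
      using 2 by (auto intro!: derivative_eq_intros)
    then show ?thesis
      by (rule has_field_derivative_transform_within_open[where S="{..<0}"]) (use 2 in auto)
  next
    case 3
    have "((\<lambda>h::real. max 0 h ^ (n + 2) / h) \<longlongrightarrow> 0) (at 0)"
    proof (rule Lim_null_comparison)
      have "norm (max 0 h ^ (n + 2) / h) \<le> \<bar>h\<bar> ^ (n + 1)" for h :: real
      proof (cases "h > 0")
        case True then show ?thesis by (simp add: max_def abs_mult)
      next
        case False
        then have m: "max 0 h = 0" by simp
        have "0 \<le> \<bar>h\<bar> ^ (n + 1)" by simp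
        then show ?thesis unfolding m by (simp only: power_add) simp
      qed
      then show "\<forall>\<^sub>F h in at 0. norm (max 0 h ^ (n + 2) / h) \<le> \<bar>h\<bar> ^ (n + 1)" by simp
      have "((\<lambda>h::real. \<bar>h\<bar> ^ (n + 1)) \<longlongrightarrow> \<bar>0\<bar> ^ (n + 1)) (at 0)" by (intro tendsto_intros)
      then show "((\<lambda>h::real. \<bar>h\<bar> ^ (n + 1)) \<longlongrightarrow> 0) (at 0)" by simp
    qed
    then show ?thesis using 3 by (simp add: DERIV_def)
  qed
qed

lemma C2_pos_part_cube: "C2 (\<lambda>x. max 0 x ^ 3)"
proof (rule C2I)
  show "((\<lambda>x. max 0 x ^ 3) has_real_derivative 3 * max 0 x ^ 2) (at x)" for x :: real
    using DERIV_pos_part_power[of 1 x] by (simp add: numeral_eq_Suc)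
  show "((\<lambda>x. 3 * max 0 x ^ 2) has_real_derivative 3 * (2 * max 0 x)) (at x)" for x :: real
    using DERIV_cmult[OF DERIV_pos_part_power[of 0 x], of 3] by (simp add: numeral_eq_Suc)
  show "continuous_on UNIV (\<lambda>x::real. 3 * (2 * max 0 x))" by (intro continuous_intros)
qed

text \<open>
  Writing \<open>q\<close> for the cube of the positive part, this is \<open>q (1 - q (1 - v))\<close>: the inner \<open>q\<close> vanishes
  for \<open>v \<ge> 1\<close>, and the outer one vanishes when the inner one exceeds \<open>1\<close>, that is, for \<open>v \<le> 0\<close>.
\<close>

definition smooth_step :: "real \<Rightarrow> real" where
  "smooth_step v = max 0 (1 - max 0 (1 - v) ^ 3) ^ 3"

lemma C2_smooth_step: "C2 smooth_step"
proof -
  have 1: "C2 (\<lambda>v. max 0 (1 - v) ^ 3)"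
    using C2_compose[OF C2_pos_part_cube C2_affine[of "-1" 1]] by simp
  have 2: "C2 (\<lambda>v. 1 - max 0 (1 - v) ^ 3)"
    using C2_compose[OF C2_affine[of "-1" 1] 1] by simp
  show ?thesis
    using C2_compose[OF C2_pos_part_cube 2] by (simp add: smooth_step_def[abs_def])
qed

lemma smooth_step: "v \<le> 0 \<Longrightarrow> smooth_step v = 0" "1 \<le> v \<Longrightarrow> smooth_step v = 1"
  "0 \<le> smooth_step v" "smooth_step v \<le> 1"
proof -
  show "smooth_step v = 0" if "v \<le> 0"
  proof -
    have "1 \<le> (1 - v) ^ 3" using that by (intro one_le_power) simp
    then show ?thesis using that by (simp add: smooth_step_def)
  qed
  show "smooth_step v = 1" if "1 \<le> v" using that by (simp add: smooth_step_def)
  show "0 \<le> smooth_step v" by (simp add: smooth_step_def)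
  have "0 \<le> max 0 (1 - v) ^ 3" by simp
  then show "smooth_step v \<le> 1" unfolding smooth_step_def by (intro power_le_one) auto
qed

lemma cutoff_exists:
  fixes p0 p q q0 :: real
  assumes "p0 < p" "q < q0"
  obtains \<psi> where "C2 \<psi>" "\<And>x. 0 \<le> \<psi> x" "\<And>x. \<psi> x \<le> 1" "\<And>x. x \<in> {p..q} \<Longrightarrow> \<psi> x = 1"
    "\<And>x. x \<notin> {p0..q0} \<Longrightarrow> \<psi> x = 0"
proof
  define \<psi> where "\<psi> x = smooth_step ((x - p0) / (p - p0)) * smooth_step ((q0 - x) / (q0 - q))" for x
  have 1: "C2 (\<lambda>x. smooth_step ((x - p0) / (p - p0)))"
    using C2_compose[OF C2_smooth_step C2_affine[of "1 / (p - p0)" "- p0 / (p - p0)"]]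
    by (simp add: diff_divide_distrib)
  have 2: "C2 (\<lambda>x. smooth_step ((q0 - x) / (q0 - q)))"
    using C2_compose[OF C2_smooth_step C2_affine[of "- 1 / (q0 - q)" "q0 / (q0 - q)"]]
    by (simp add: diff_divide_distrib)
  show "C2 \<psi>" using C2_mult[OF 1 2] by (simp add: \<psi>_def[abs_def])
  show "0 \<le> \<psi> x" for x by (simp add: \<psi>_def smooth_step)
  show "\<psi> x \<le> 1" for x by (simp add: \<psi>_def smooth_step mult_le_one)
  show "\<psi> x = 1" if "x \<in> {p..q}" for x using that assms by (simp add: \<psi>_def smooth_step field_simps)
  show "\<psi> x = 0" if "x \<notin> {p0..q0}" for x
  proof (cases "x < p0")
    case True then show ?thesis using assms by (simp add: \<psi>_def smooth_step(1) divide_le_0_iff)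
  next
    case False then have "x > q0" using that by simp
    then show ?thesis using assms by (simp add: \<psi>_def smooth_step(1) divide_le_0_iff)
  qed
qed

lemma bounded_of_compact_support:
  fixes u :: "real \<Rightarrow> real"
  assumes "continuous_on UNIV u" "\<And>x. x \<notin> {p..q} \<Longrightarrow> u x = 0"
  obtains B where "0 \<le> B" "\<And>x. \<bar>u x\<bar> \<le> B"
proof -
  have "compact (u ` {p..q})" by (intro compact_continuous_image continuous_on_subset[OF assms(1)]) auto
  then obtain B where B: "\<And>y. y \<in> u ` {p..q} \<Longrightarrow> norm y \<le> B"
    using compact_imp_bounded bounded_iff by metis
  show ?thesis
  proof (rule that[of "max 0 B"])
    show "\<bar>u x\<bar> \<le> max 0 B" for x
      using B[of "u x"] assms(2)[of x] by (cases "x \<in> {p..q}") (auto simp: le_max_iff_disj)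
  qed simp
qed

lemma deriv_zero_off_support:
  fixes u :: "real \<Rightarrow> real"
  assumes "\<And>x. x \<notin> {p..q} \<Longrightarrow> u x = 0" "x \<notin> {p..q}"
  shows "deriv u x = 0"
proof (rule DERIV_imp_deriv)
  have "((\<lambda>x. 0) has_real_derivative 0) (at x)" by simp
  then show "(u has_real_derivative 0) (at x)"
    by (rule has_field_derivative_transform_within_open[where S="- {p..q}"]) (use assms in auto)
qed

lemma C0_line_compact_support:
  assumes "continuous_on UNIV u" "\<And>x. x \<notin> {p..q} \<Longrightarrow> u x = 0"
  shows "u \<in> C0 UNIV"
proof -
  have "\<forall>\<^sub>F x in at_infinity. u x = 0"
    unfolding eventually_at_infinity
    by (rule exI[of _ "\<bar>p\<bar> + \<bar>q\<bar> + 1"]) (use assms(2) in \<open>fastforce simp: abs_real_def split: if_splits\<close>)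
  then have "(u \<longlongrightarrow> 0) at_infinity" by (rule tendsto_eventually)
  then show ?thesis using assms(1) by (simp add: C0_def)
qed

text \<open>
  The source of all test functions that are fed into the generator on the line.
\<close>

lemma C2_compact_support_in_C02_line:
  assumes "C2 u" "\<And>x. x \<notin> {p..q} \<Longrightarrow> u x = 0"
  shows "u \<in> C02_line"
proof -
  have 1: "deriv u x = 0" if "x \<notin> {p..q}" for x using deriv_zero_off_support[OF assms(2) that] .
  have 2: "deriv (deriv u) x = 0" if "x \<notin> {p..q}" for x using deriv_zero_off_support[OF 1 that] .
  have "u \<in> C0 UNIV" "deriv u \<in> C0 UNIV" "deriv (deriv u) \<in> C0 UNIV"
    using C0_line_compact_support[OF C2D(3)[OF assms(1)] assms(2)]
      C0_line_compact_support[OF C2D(4)[OF assms(1)] 1] C0_line_compact_support[OF C2D(5)[OF assms(1)] 2]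
    by auto
  then show ?thesis using assms(1) C2D(4,5)[OF assms(1)] by (simp add: C02_line_def C02_def C2_def)
qed

section \<open>Functions vanishing at the boundary of an interval\<close>

text \<open>
  The boundary condition in \<open>C0\<close> is exactly what makes the zero extension continuous at the two
  end points; being compactly supported, it is then bounded and uniformly continuous.
\<close>

lemma continuous_zero_ext:
  assumes "l < R" "f \<in> C0 {l<..<R}"
  shows "continuous_on UNIV (zero_ext {l<..<R} f)"
proof -
  let ?F = "zero_ext {l<..<R} f"
  have fr: "frontier {l<..<R} = {l, R}" using assms(1) by (auto simp: frontier_def)
  have "isCont ?F x" for x
  proof -
    consider "x \<in> {l<..<R}" | "x \<in> {l, R}" | "x \<notin> {l..R}" by fastforce
    then show ?thesis
    proof cases
      case 1
      have "isCont f x" using assms(2) 1 by (auto simp: C0_def continuous_on_eq_continuous_at)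
      moreover have "\<forall>\<^sub>F y in nhds x. y \<in> {l<..<R}" using 1 by (intro eventually_nhds_in_open) auto
      then have "\<forall>\<^sub>F y in nhds x. ?F y = f y"
        by eventually_elim (auto simp: zero_ext_def)
      ultimately show ?thesis using isCont_cong by blast
    next
      case 2
      have "(f \<longlongrightarrow> 0) (at x within {l<..<R})" using assms(2) 2 fr by (auto simp: C0_def)
      then have "(?F \<longlongrightarrow> 0) (at x within {l<..<R})"
        by (rule Lim_transform_within[where d=1]) (auto simp: zero_ext_def)
      moreover have "(?F \<longlongrightarrow> 0) (at x within - {l<..<R})"
      proof -
        have "((\<lambda>_. 0) \<longlongrightarrow> (0::real)) (at x within - {l<..<R})" by simp
        then show ?thesis by (rule Lim_transform_within[where d=1]) (auto simp: zero_ext_def)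
      qed
      ultimately have "(?F \<longlongrightarrow> 0) (at x within ({l<..<R} \<union> - {l<..<R}))" by (rule Lim_Un)
      then show ?thesis using 2 by (auto simp: isCont_def zero_ext_def)
    next
      case 3
      have "\<forall>\<^sub>F y in nhds x. y \<in> - {l..R}" using 3 by (intro eventually_nhds_in_open) auto
      then have "\<forall>\<^sub>F y in nhds x. ?F y = 0"
        by eventually_elim (auto simp: zero_ext_def)
      then show ?thesis using isCont_cong[of ?F "\<lambda>_. 0"] by simp
    qed
  qed
  then show ?thesis by (simp add: continuous_on_eq_continuous_at)
qed

lemma zero_ext_off: "x \<notin> {l..R} \<Longrightarrow> zero_ext {l<..<R} f x = 0"
  by (auto simp: zero_ext_def)

lemma C02_zero_extD:
  assumes "f \<in> C02 {l<..<R}" "x \<in> {l<..<R}"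
  shows "(zero_ext {l<..<R} f has_real_derivative deriv f x) (at x)"
    and "(deriv f has_real_derivative deriv (deriv f) x) (at x)"
    and "deriv (zero_ext {l<..<R} f) x = deriv f x"
proof -
  have "(f has_real_derivative deriv f x) (at x)"
    using assms unfolding C02_def by (auto simp: DERIV_deriv_iff_real_differentiable)
  then show 1: "(zero_ext {l<..<R} f has_real_derivative deriv f x) (at x)"
    by (rule has_field_derivative_transform_within_open[where S="{l<..<R}"])
      (use assms in \<open>auto simp: zero_ext_def\<close>)
  show "(deriv f has_real_derivative deriv (deriv f) x) (at x)"
    using assms unfolding C02_def by (auto simp: DERIV_deriv_iff_real_differentiable)
  show "deriv (zero_ext {l<..<R} f) x = deriv f x" using 1 by (rule DERIV_imp_deriv)
qed

text \<open>
  The derivatives of a function in \<open>C02\<close> may blow up at the end points.  Multiplication by a cutoff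
  supported strictly inside the interval removes the blow-up.
\<close>

lemma C2_cutoff_mult:
  assumes "f \<in> C02 {l<..<R}" "C2 \<psi>" "\<And>x. x \<notin> {p..q} \<Longrightarrow> \<psi> x = 0" "l < p" "q < R"
  shows "C2 (\<lambda>x. \<psi> x * zero_ext {l<..<R} f x)"
proof -
  let ?\<Omega> = "{l<..<R}" let ?F = "zero_ext ?\<Omega> f"
  define u' where "u' x = (if x \<in> ?\<Omega> then deriv \<psi> x * f x + \<psi> x * deriv f x else 0)" for x
  define u'' where "u'' x = (if x \<in> ?\<Omega> then deriv (deriv \<psi>) x * f x + 2 * deriv \<psi> x * deriv f x
      + \<psi> x * deriv (deriv f) x else 0)" for x
  have z1: "deriv \<psi> x = 0" if "x \<notin> {p..q}" for x using deriv_zero_off_support[OF assms(3) that] .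
  have z2: "deriv (deriv \<psi>) x = 0" if "x \<notin> {p..q}" for x using deriv_zero_off_support[OF z1 that] .
  have off: "x \<in> - {p..q}" if "x \<notin> ?\<Omega>" for x using that assms(4,5) by auto
  have f1: "(f has_real_derivative deriv f x) (at x)" if "x \<in> ?\<Omega>" for x
    using assms(1) that unfolding C02_def by (auto simp: DERIV_deriv_iff_real_differentiable)
  show ?thesis
  proof (rule C2I)
    show "((\<lambda>x. \<psi> x * ?F x) has_real_derivative u' x) (at x)" for x
    proof (cases "x \<in> ?\<Omega>")
      case True
      have "((\<lambda>x. \<psi> x * f x) has_real_derivative u' x) (at x)"
        using True by (auto intro!: derivative_eq_intros C2D(1)[OF assms(2)] f1 simp: u'_def)
      then show ?thesis
        by (rule has_field_derivative_transform_within_open[where S="?\<Omega>"]) (use True in \<open>auto simp: zero_ext_def\<close>)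
    next
      case False
      have "((\<lambda>x. 0) has_real_derivative u' x) (at x)" using False by (auto simp: u'_def)
      then show ?thesis
        by (rule has_field_derivative_transform_within_open[where S="- {p..q}"])
          (use off[OF False] assms(3) in auto)
    qed
    show "(u' has_real_derivative u'' x) (at x)" for x
    proof (cases "x \<in> ?\<Omega>")
      case True
      have "((\<lambda>x. deriv \<psi> x * f x + \<psi> x * deriv f x) has_real_derivative u'' x) (at x)"
        using True
        by (auto intro!: derivative_eq_intros C2D(1,2)[OF assms(2)] f1 C02_zero_extD(2)[OF assms(1)] simp: u''_def)
      then show ?thesis
        by (rule has_field_derivative_transform_within_open[where S="?\<Omega>"]) (use True in \<open>auto simp: u'_def\<close>)
    next
      case False
      have "((\<lambda>x. 0) has_real_derivative u'' x) (at x)" using False by (auto simp: u''_def)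
      then show ?thesis
        by (rule has_field_derivative_transform_within_open[where S="- {p..q}"])
          (use off[OF False] assms(3) z1 in \<open>auto simp: u'_def\<close>)
    qed
    have "isCont u'' x" for x
    proof (cases "x \<in> ?\<Omega>")
      case True
      have c: "isCont f x" "isCont (deriv f) x" "isCont (deriv (deriv f)) x"
        "isCont \<psi> x" "isCont (deriv \<psi>) x" "isCont (deriv (deriv \<psi>)) x"
        using assms(1) True C2D(3-5)[OF assms(2)]
        by (auto simp: C02_def C0_def continuous_on_eq_continuous_at)
      have "isCont (\<lambda>x. deriv (deriv \<psi>) x * f x + 2 * deriv \<psi> x * deriv f x + \<psi> x * deriv (deriv f) x) x"
        by (intro continuous_intros c)
      moreover have "\<forall>\<^sub>F y in nhds x. y \<in> ?\<Omega>" using True by (intro eventually_nhds_in_open) auto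
      then have "\<forall>\<^sub>F y in nhds x. u'' y = deriv (deriv \<psi>) y * f y + 2 * deriv \<psi> y * deriv f y + \<psi> y * deriv (deriv f) y"
        by eventually_elim (auto simp: u''_def)
      ultimately show ?thesis using isCont_cong by force
    next
      case False
      have "\<forall>\<^sub>F y in nhds x. y \<in> - {p..q}" using off[OF False] by (intro eventually_nhds_in_open) auto
      then have "\<forall>\<^sub>F y in nhds x. u'' y = 0"
        by eventually_elim (use assms(3) z1 z2 in \<open>auto simp: u''_def\<close>)
      then show ?thesis using isCont_cong[of u'' "\<lambda>_. 0"] by simp
    qed
    then show "continuous_on UNIV u''" by (simp add: continuous_on_eq_continuous_at)
  qed
qed

section \<open>One-sided fractional integrals\<close>

text \<open>
  The mean value theorem bounds the difference quotients by the majorant of the derivative, so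
  dominated convergence applies to them along every sequence tending to \<open>x0\<close>.
\<close>

lemma differentiate_under_integral:
  fixes F F' :: "real \<Rightarrow> 'a \<Rightarrow> real"
  assumes d: "0 < d"
    and F: "\<And>x. \<bar>x - x0\<bar> < d \<Longrightarrow> integrable M (F x)"
    and D: "\<And>x t. \<bar>x - x0\<bar> < d \<Longrightarrow> t \<in> space M \<Longrightarrow> ((\<lambda>x. F x t) has_real_derivative F' x t) (at x)"
    and m: "F' x0 \<in> borel_measurable M" and w: "integrable M w"
    and b: "\<And>x t. \<bar>x - x0\<bar> < d \<Longrightarrow> t \<in> space M \<Longrightarrow> \<bar>F' x t\<bar> \<le> w t"
  shows "((\<lambda>x. \<integral>t. F x t \<partial>M) has_real_derivative (\<integral>t. F' x0 t \<partial>M)) (at x0)"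
proof -
  have "(\<lambda>i. ((\<integral>t. F (X i) t \<partial>M) - (\<integral>t. F x0 t \<partial>M)) / (X i - x0)) \<longlonglongrightarrow> (\<integral>t. F' x0 t \<partial>M)"
    if X: "\<And>i. X i \<noteq> x0" "X \<longlonglongrightarrow> x0" for X
  proof -
    have "\<forall>\<^sub>F i in sequentially. dist (X i) x0 < d" using X(2) d by (rule tendstoD)
    then obtain N where N: "\<And>i. i \<ge> N \<Longrightarrow> \<bar>X i - x0\<bar> < d"
      by (auto simp: eventually_sequentially dist_real_def)
    define Y where "Y i = X (i + N)" for i
    have Y: "\<bar>Y i - x0\<bar> < d" "Y i \<noteq> x0" "Y \<longlonglongrightarrow> x0" for i
      using N X LIMSEQ_ignore_initial_segment[OF X(2), of N] by (auto simp: Y_def[abs_def])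
    have x0: "\<bar>x0 - x0\<bar> < d" using d by simp
    have "(\<lambda>i. \<integral>t. (F (Y i) t - F x0 t) / (Y i - x0) \<partial>M) \<longlonglongrightarrow> (\<integral>t. F' x0 t \<partial>M)"
    proof (rule integral_dominated_convergence[where w=w])
      show "(\<lambda>t. (F (Y i) t - F x0 t) / (Y i - x0)) \<in> borel_measurable M" for i
        using F[OF Y(1)[of i]] F[OF x0] by auto
      show "AE t in M. (\<lambda>i. (F (Y i) t - F x0 t) / (Y i - x0)) \<longlonglongrightarrow> F' x0 t"
      proof (rule AE_I2)
        fix t assume "t \<in> space M"
        from D[OF x0 this] have "((\<lambda>y. (F y t - F x0 t) / (y - x0)) \<longlongrightarrow> F' x0 t) (at x0)"
          by (simp add: has_field_derivative_iff)
        from this[unfolded tendsto_at_iff_sequentially, rule_format, of Y] Y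
        show "(\<lambda>i. (F (Y i) t - F x0 t) / (Y i - x0)) \<longlonglongrightarrow> F' x0 t" by (simp add: o_def)
      qed
      show "AE t in M. norm ((F (Y i) t - F x0 t) / (Y i - x0)) \<le> w t" for i
      proof (rule AE_I2)
        fix t assume t: "t \<in> space M"
        have "norm (F (Y i) t - F x0 t) \<le> w t * norm (Y i - x0)"
        proof (rule field_differentiable_bound[where S="{x. \<bar>x - x0\<bar> < d}" and f'="\<lambda>x. F' x t"])
          have "{x. \<bar>x - x0\<bar> < d} = {x0 - d<..<x0 + d}" by (auto simp: abs_less_iff)
          then show "convex {x. \<bar>x - x0\<bar> < d}" by simp
        qed (use D[OF _ t] b[OF _ t] Y x0 in \<open>auto intro: has_field_derivative_at_within\<close>)
        then show "norm ((F (Y i) t - F x0 t) / (Y i - x0)) \<le> w t"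
          using Y(2)[of i] by (simp add: norm_divide divide_le_eq)
      qed
    qed (use m w in auto)
    moreover have "(\<integral>t. (F (Y i) t - F x0 t) / (Y i - x0) \<partial>M) = ((\<integral>t. F (Y i) t \<partial>M) - (\<integral>t. F x0 t \<partial>M)) / (Y i - x0)" for i
      using Y(2)[of i] Bochner_Integration.integral_diff[OF F[OF Y(1)[of i]] F[OF x0]] by simp
    ultimately have "(\<lambda>i. ((\<integral>t. F (Y i) t \<partial>M) - (\<integral>t. F x0 t \<partial>M)) / (Y i - x0)) \<longlonglongrightarrow> (\<integral>t. F' x0 t \<partial>M)"
      by (simp only:)
    then show ?thesis unfolding Y_def by (rule LIMSEQ_offset)
  qed
  then show ?thesis
    unfolding has_field_derivative_iff tendsto_at_iff_sequentially by (auto simp: o_def)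
qed

text \<open>
  Cutting off at \<open>0\<close> here, once and for all, lets every one-sided integral be an integral over
  the whole line.
\<close>

definition pos_powr :: "real \<Rightarrow> real \<Rightarrow> real" where
  "pos_powr \<beta> u = (if 0 < u then u powr \<beta> else 0)"

lemma pos_powr_measurable [measurable]: "pos_powr \<beta> \<in> borel_measurable borel"
  unfolding pos_powr_def[abs_def] by measurable

lemma pos_powr_nonneg [simp]: "0 \<le> pos_powr \<beta> u"
  by (simp add: pos_powr_def)

lemma integrable_pos_powr_near_zero:
  assumes "-1 < \<beta>"
  shows "integrable lborel (\<lambda>u. indicator {0..A} u * pos_powr \<beta> u)"
proof (cases "0 \<le> A")
  case True
  have "(\<lambda>u. u powr \<beta>) absolutely_integrable_on {0..A}"
    using integrable_on_powr_from_0[OF assms True] by (intro nonnegative_absolutely_integrable_1) auto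
  then have "integrable lebesgue (\<lambda>u. indicator {0..A} u * u powr \<beta>)"
    by (simp add: set_integrable_def)
  moreover have "(\<lambda>u. indicator {0..A} u * pos_powr \<beta> u) = (\<lambda>u::real. indicator {0..A} u * u powr \<beta>)"
    by (auto simp: pos_powr_def fun_eq_iff indicator_def)
  ultimately have "integrable lebesgue (\<lambda>u. indicator {0..A} u * pos_powr \<beta> u)" by simp
  then show ?thesis by (subst (asm) integrable_completion) auto
qed simp

lemma powr_tail:
  fixes \<beta> a :: real
  assumes "\<beta> < -1" "0 < a"
  shows "integrable lborel (\<lambda>u. indicator {a..} u * u powr \<beta>)"
    and "(\<integral>u. indicator {a..} u * u powr \<beta> \<partial>lborel) = - (a powr (\<beta> + 1)) / (\<beta> + 1)"
proof -
  have h: "((\<lambda>u. u powr \<beta>) has_integral - (a powr (\<beta> + 1)) / (\<beta> + 1)) {a..}"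
    using has_integral_powr_to_inf[of \<beta> a] assms by simp
  have "(\<lambda>u. u powr \<beta>) absolutely_integrable_on {a..}"
    using h by (intro nonnegative_absolutely_integrable_1) (auto simp: has_integral_iff)
  then have "integrable lebesgue (\<lambda>u. indicator {a..} u * u powr \<beta>)"
    by (simp add: set_integrable_def)
  then show 1: "integrable lborel (\<lambda>u. indicator {a..} u * u powr \<beta>)"
    by (subst (asm) integrable_completion) auto
  then have "set_integrable lborel {a..} (\<lambda>u. u powr \<beta>)" by (simp add: set_integrable_def)
  from set_borel_integral_eq_integral(2)[OF this] h
  show "(\<integral>u. indicator {a..} u * u powr \<beta> \<partial>lborel) = - (a powr (\<beta> + 1)) / (\<beta> + 1)"
    by (simp add: set_lebesgue_integral_def has_integral_iff)
qed

text \<open>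
  With \<open>s = 1\<close> the integral looks to the left of \<open>x\<close>, with \<open>s = - 1\<close> to the right; carrying the sign as
  a parameter treats both Riemann--Liouville derivatives at once.
\<close>

definition frac_int :: "real \<Rightarrow> real \<Rightarrow> (real \<Rightarrow> real) \<Rightarrow> real \<Rightarrow> real" where
  "frac_int s \<beta> f x = (\<integral>u. f (x - s * u) * pos_powr \<beta> u \<partial>lborel)"

lemma frac_integrand_bound:
  assumes s: "s = 1 \<or> s = (-1::real)" and v: "\<And>x. x \<notin> {p..q} \<Longrightarrow> v x = 0" "\<And>x. \<bar>v x\<bar> \<le> B"
    and x: "\<bar>x - x0\<bar> < 1"
  shows "\<bar>v (x - s * u) * pos_powr \<beta> u\<bar> \<le> B * (indicator {0..\<bar>x0\<bar> + 1 + \<bar>p\<bar> + \<bar>q\<bar>} u * pos_powr \<beta> u)"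
proof (cases "0 < u \<and> v (x - s * u) \<noteq> 0")
  case True
  then have "x - s * u \<in> {p..q}" using v(1) by blast
  then have "u \<le> \<bar>x0\<bar> + 1 + \<bar>p\<bar> + \<bar>q\<bar>" using s x by auto
  then show ?thesis using True v(2)[of "x - s * u"] by (simp add: abs_mult mult_right_mono)
next
  case False
  have "0 \<le> B" using v(2)[of 0] by linarith
  then show ?thesis using False by (auto simp: pos_powr_def)
qed

lemma frac_integrable:
  assumes s: "s = 1 \<or> s = (-1::real)" and \<beta>: "-1 < \<beta>" and m [measurable]: "v \<in> borel_measurable borel"
    and v: "\<And>x. x \<notin> {p..q} \<Longrightarrow> v x = 0" "\<And>x. \<bar>v x\<bar> \<le> B"
  shows "integrable lborel (\<lambda>u. v (x - s * u) * pos_powr \<beta> u)"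
proof (rule Bochner_Integration.integrable_bound)
  show "integrable lborel (\<lambda>u. B * (indicator {0..\<bar>x\<bar> + 1 + \<bar>p\<bar> + \<bar>q\<bar>} u * pos_powr \<beta> u))"
    by (intro integrable_mult_right integrable_pos_powr_near_zero \<beta>)
  have x: "\<bar>x - x\<bar> < 1" by simp
  show "AE u in lborel. norm (v (x - s * u) * pos_powr \<beta> u)
      \<le> norm (B * (indicator {0..\<bar>x\<bar> + 1 + \<bar>p\<bar> + \<bar>q\<bar>} u * pos_powr \<beta> u))"
    unfolding real_norm_def
    by (intro AE_I2 order_trans[OF frac_integrand_bound[OF s v x] abs_ge_self])
qed measurable

text \<open>
  In the form of a convolution the singular kernel is not touched by differentiation in \<open>x\<close>; the
  derivative falls on the smooth function.
\<close>

lemma DERIV_frac_int_smooth: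
  assumes s: "s = 1 \<or> s = (-1::real)" and \<beta>: "-1 < \<beta>"
    and D: "\<And>x. (v has_real_derivative v' x) (at x)" and c: "continuous_on UNIV v'"
    and v: "\<And>x. x \<notin> {p..q} \<Longrightarrow> v x = 0"
  shows "(frac_int s \<beta> v has_real_derivative frac_int s \<beta> v' x0) (at x0)"
proof -
  have cv: "continuous_on UNIV v" using D DERIV_isCont by (simp add: continuous_on_eq_continuous_at) blast
  have [measurable]: "v \<in> borel_measurable borel" "v' \<in> borel_measurable borel"
    using cv c by (auto intro: borel_measurable_continuous_onI)
  have dv: "deriv v = v'" using D by (auto intro!: DERIV_imp_deriv)
  have v': "v' x = 0" if "x \<notin> {p..q}" for x using deriv_zero_off_support[of p q v x] v that dv by auto
  obtain B where B: "0 \<le> B" "\<And>x. \<bar>v x\<bar> \<le> B" using bounded_of_compact_support[OF cv v] by blast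
  obtain B' where B': "0 \<le> B'" "\<And>x. \<bar>v' x\<bar> \<le> B'" using bounded_of_compact_support[OF c v'] by blast
  show ?thesis unfolding frac_int_def[abs_def]
  proof (rule differentiate_under_integral[where d=1
        and w = "\<lambda>u. B' * (indicator {0..\<bar>x0\<bar> + 1 + \<bar>p\<bar> + \<bar>q\<bar>} u * pos_powr \<beta> u)"])
    show "((\<lambda>x. v (x - s * u) * pos_powr \<beta> u) has_real_derivative v' (x - s * u) * pos_powr \<beta> u) (at x)" for x u
      by (rule DERIV_cmult_right DERIV_chain2[OF D, THEN DERIV_cong] derivative_eq_intros refl | simp)+
    show "integrable lborel (\<lambda>u. B' * (indicator {0..\<bar>x0\<bar> + 1 + \<bar>p\<bar> + \<bar>q\<bar>} u * pos_powr \<beta> u))"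
      by (intro integrable_mult_right integrable_pos_powr_near_zero \<beta>)
    show "integrable lborel (\<lambda>u. v (x - s * u) * pos_powr \<beta> u)" for x
      by (rule frac_integrable[OF s \<beta> _ v B(2)]) auto
    show "\<bar>v' (x - s * t) * pos_powr \<beta> t\<bar> \<le> B' * (indicator {0..\<bar>x0\<bar> + 1 + \<bar>p\<bar> + \<bar>q\<bar>} t * pos_powr \<beta> t)"
      if "\<bar>x - x0\<bar> < 1" for x t by (rule frac_integrand_bound[OF s v' B'(2) that])
  qed auto
qed

text \<open>
  Substituting \<open>y = x - s u\<close> moves the dependence on \<open>x\<close> from the function to the kernel.
\<close>

lemma frac_int_shift:
  assumes s: "s = 1 \<or> s = (-1::real)"
  shows "frac_int s \<beta> f x = (\<integral>y. f y * pos_powr \<beta> (s * (x - y)) \<partial>lborel)"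
    and "integrable lborel (\<lambda>u. f (x - s * u) * pos_powr \<beta> u) \<longleftrightarrow> integrable lborel (\<lambda>y. f y * pos_powr \<beta> (s * (x - y)))"
proof -
  have e: "s * (x - (x + (- s) * u)) = u" for u using s by auto
  show "frac_int s \<beta> f x = (\<integral>y. f y * pos_powr \<beta> (s * (x - y)) \<partial>lborel)"
    using lborel_integral_real_affine[of "- s" "\<lambda>y. f y * pos_powr \<beta> (s * (x - y))" x] s
    unfolding e by (auto simp: frac_int_def)
  show "integrable lborel (\<lambda>u. f (x - s * u) * pos_powr \<beta> u) \<longleftrightarrow> integrable lborel (\<lambda>y. f y * pos_powr \<beta> (s * (x - y)))"
    using lborel_integrable_real_affine_iff[of "- s" "\<lambda>y. f y * pos_powr \<beta> (s * (x - y))" x] s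
    unfolding e by auto
qed

text \<open>
  The complement of the previous case: \<open>v\<close> need not be differentiable, but it vanishes near the
  singularity of the kernel, so that the kernel can be differentiated instead.
\<close>

lemma DERIV_frac_int_far:
  assumes s: "s = 1 \<or> s = (-1::real)" and \<beta>: "\<beta> \<le> 0" and m [measurable]: "v \<in> borel_measurable borel"
    and v: "\<And>x. x \<notin> {p..q} \<Longrightarrow> v x = 0" "\<And>x. \<bar>v x\<bar> \<le> B"
    and far: "\<And>y. \<bar>y - x0\<bar> < 2 * \<eta> \<Longrightarrow> v y = 0" and \<eta>: "0 < \<eta>" and x1: "\<bar>x1 - x0\<bar> < \<eta>"
  shows "(frac_int s \<beta> v has_real_derivative s * \<beta> * frac_int s (\<beta> - 1) v x1) (at x1)"
    and "integrable lborel (\<lambda>u. v (x1 - s * u) * pos_powr \<beta> u)"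
proof -
  have B: "0 \<le> B" using v(2)[of 0] by linarith
  have bnd: "\<bar>v y * pos_powr \<gamma> (s * (x - y))\<bar> \<le> B * \<eta> powr \<gamma> * indicator {p..q} y"
    if "\<gamma> \<le> 0" "\<bar>x - x0\<bar> < \<eta>" for \<gamma> x y
  proof (cases "v y \<noteq> 0 \<and> 0 < s * (x - y)")
    case True
    then have "\<not> \<bar>y - x0\<bar> < 2 * \<eta>" "y \<in> {p..q}" using far v(1) by blast+
    then have "\<eta> \<le> s * (x - y)" using that True s by auto
    then have "(s * (x - y)) powr \<gamma> \<le> \<eta> powr \<gamma>" using that \<eta> by (intro powr_mono2') auto
    then show ?thesis using True \<open>y \<in> _\<close> v(2)[of y] B by (auto simp: abs_mult pos_powr_def intro!: mult_mono)
  qed (use B in \<open>auto simp: pos_powr_def\<close>)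
  have int: "integrable lborel (\<lambda>y. v y * pos_powr \<gamma> (s * (x - y)))" if "\<gamma> \<le> 0" "\<bar>x - x0\<bar> < \<eta>" for \<gamma> x
  proof (rule Bochner_Integration.integrable_bound)
    show "integrable lborel (\<lambda>y. B * \<eta> powr \<gamma> * indicator {p..q} y)"
      by (intro integrable_mult_right integrable_real_indicator) (auto simp: emeasure_lborel_Icc_eq)
    show "AE y in lborel. norm (v y * pos_powr \<gamma> (s * (x - y))) \<le> norm (B * \<eta> powr \<gamma> * indicator {p..q} y)"
      unfolding real_norm_def by (intro AE_I2 order_trans[OF bnd[OF that] abs_ge_self])
  qed measurable
  show "integrable lborel (\<lambda>u. v (x1 - s * u) * pos_powr \<beta> u)"
    using int[OF \<beta> x1] frac_int_shift(2)[OF s] by blast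
  have "((\<lambda>x. \<integral>y. v y * pos_powr \<beta> (s * (x - y)) \<partial>lborel) has_real_derivative
      (\<integral>y. s * \<beta> * (v y * pos_powr (\<beta> - 1) (s * (x1 - y))) \<partial>lborel)) (at x1)"
  proof (rule differentiate_under_integral[where d="\<eta> - \<bar>x1 - x0\<bar>"
        and w = "\<lambda>y. \<bar>s * \<beta>\<bar> * (B * \<eta> powr (\<beta> - 1) * indicator {p..q} y)"])
    show "0 < \<eta> - \<bar>x1 - x0\<bar>" using x1 by simp
    have near: "\<bar>x - x0\<bar> < \<eta>" if "\<bar>x - x1\<bar> < \<eta> - \<bar>x1 - x0\<bar>" for x using that by linarith
    show "integrable lborel (\<lambda>y. v y * pos_powr \<beta> (s * (x - y)))" if "\<bar>x - x1\<bar> < \<eta> - \<bar>x1 - x0\<bar>" for x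
      by (rule int[OF \<beta> near[OF that]])
    show "((\<lambda>x. v y * pos_powr \<beta> (s * (x - y))) has_real_derivative
        s * \<beta> * (v y * pos_powr (\<beta> - 1) (s * (x - y)))) (at x)" if "\<bar>x - x1\<bar> < \<eta> - \<bar>x1 - x0\<bar>" for x y
    proof (cases "v y = 0")
      case False
      then have "\<not> \<bar>y - x0\<bar> < 2 * \<eta>" using far by blast
      then have ne: "s * (x - y) \<noteq> 0" using near[OF that] s by auto
      show ?thesis
      proof (cases "0 < s * (x - y)")
        case True
        have "((\<lambda>x. v y * (s * (x - y)) powr \<beta>) has_real_derivative
          s * \<beta> * (v y * (s * (x - y)) powr (\<beta> - 1))) (at x)"
          using True by (auto intro!: derivative_eq_intros simp: powr_diff)
        then have "((\<lambda>x. v y * pos_powr \<beta> (s * (x - y))) has_real_derivative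
          s * \<beta> * (v y * (s * (x - y)) powr (\<beta> - 1))) (at x)"
          by (rule has_field_derivative_transform_within_open[where S="{x. 0 < s * (x - y)}"])
            (use True in \<open>auto simp: pos_powr_def intro!: open_Collect_less continuous_intros\<close>)
        then show ?thesis using True by (simp add: pos_powr_def)
      next
        case neg: False
        have neg': "s * (x - y) < 0" using neg ne by (simp only: not_less less_le) simp
        have "((\<lambda>x. 0) has_real_derivative 0) (at x)" by simp
        then have "((\<lambda>x. v y * pos_powr \<beta> (s * (x - y))) has_real_derivative 0) (at x)"
          by (rule has_field_derivative_transform_within_open[where S="{x. s * (x - y) < 0}"])
            (use neg' in \<open>auto simp: pos_powr_def intro!: open_Collect_less continuous_intros\<close>)
        then show ?thesis using neg by (simp add: pos_powr_def)
      qed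
    qed simp
    show "integrable lborel (\<lambda>y. \<bar>s * \<beta>\<bar> * (B * \<eta> powr (\<beta> - 1) * indicator {p..q} y))"
      by (intro integrable_mult_right integrable_real_indicator) (auto simp: emeasure_lborel_Icc_eq)
    show "\<bar>s * \<beta> * (v y * pos_powr (\<beta> - 1) (s * (x - y)))\<bar> \<le> \<bar>s * \<beta>\<bar> * (B * \<eta> powr (\<beta> - 1) * indicator {p..q} y)"
      if "\<bar>x - x1\<bar> < \<eta> - \<bar>x1 - x0\<bar>" for x y
      unfolding abs_mult[of "s * \<beta>"] by (intro mult_left_mono bnd near that) (use \<beta> in auto)
  qed measurable
  then show "(frac_int s \<beta> v has_real_derivative s * \<beta> * frac_int s (\<beta> - 1) v x1) (at x1)"
    by (simp add: frac_int_shift(1)[OF s, abs_def])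
qed

text \<open>
  Taylor's formula with integral remainder, along the direction \<open>- s\<close>.  The function \<open>G\<close> in the proof is
  the first-order Taylor expansion of \<open>f\<close> about \<open>x - s v\<close>, evaluated at \<open>x - s r\<close>.
\<close>

lemma taylor_integral:
  assumes s: "s = 1 \<or> s = (-1::real)" and u: "C2 f" and "0 \<le> r"
  shows "(\<integral>v. indicator {0..r} v * ((r - v) * deriv (deriv f) (x - s * v)) \<partial>lborel) =
    f (x - s * r) - f x + s * r * deriv f x"
proof -
  define G where "G v = f (x - s * v) - (r - v) * s * deriv f (x - s * v)" for v
  have ss: "s * s = 1" using s by auto
  have 1: "((\<lambda>v. f (x - s * v)) has_real_derivative deriv f (x - s * v) * (- s)) (at v)" for v
    by (rule DERIV_chain2[OF C2D(1)[OF u]]) (auto intro!: derivative_eq_intros)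
  have 2: "((\<lambda>v. deriv f (x - s * v)) has_real_derivative deriv (deriv f) (x - s * v) * (- s)) (at v)" for v
    by (rule DERIV_chain2[OF C2D(2)[OF u]]) (auto intro!: derivative_eq_intros)
  have 3: "(G has_real_derivative (r - v) * deriv (deriv f) (x - s * v)) (at v)" for v
  proof -
    have "(G has_real_derivative deriv f (x - s * v) * (- s) - (- (s * deriv f (x - s * v)) +
        (r - v) * s * (deriv (deriv f) (x - s * v) * (- s)))) (at v)"
      unfolding G_def[abs_def] by (auto intro!: derivative_eq_intros 1 2)
    moreover have "(r - v) * s * (deriv (deriv f) (x - s * v) * (- s)) = - ((s * s) * ((r - v) * deriv (deriv f) (x - s * v)))"
      by algebra
    ultimately have "(G has_real_derivative (s * s) * ((r - v) * deriv (deriv f) (x - s * v))) (at v)"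
      by (simp add: mult_ac)
    then show ?thesis unfolding ss by simp
  qed
  have "(\<integral>v. indicator {0..r} v *\<^sub>R ((r - v) * deriv (deriv f) (x - s * v)) \<partial>lborel) = G r - G 0"
  proof (rule integral_FTC_atLeastAtMost[OF \<open>0 \<le> r\<close>])
    show "(G has_vector_derivative (r - v) * deriv (deriv f) (x - s * v)) (at v within {0..r})" for v
      using 3 has_field_derivative_at_within has_real_derivative_iff_has_vector_derivative by blast
    show "continuous_on {0..r} (\<lambda>v. (r - v) * deriv (deriv f) (x - s * v))"
      by (intro continuous_intros continuous_on_compose2[OF C2D(5)[OF u]]) auto
  qed
  then show ?thesis by (simp add: G_def)
qed

lemma taylor_kernel_integral:
  fixes \<alpha> v :: real
  assumes a: "1 < \<alpha>" and v: "0 < v"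
  shows "integrable lborel (\<lambda>u. indicator {v..} u * ((u - v) * u powr (- \<alpha> - 1)))"
    and "(\<integral>u. indicator {v..} u * ((u - v) * u powr (- \<alpha> - 1)) \<partial>lborel) = v powr (1 - \<alpha>) / (\<alpha> * (\<alpha> - 1))"
proof -
  have e: "indicat_real {v..} u * ((u - v) * u powr (- \<alpha> - 1)) =
      indicat_real {v..} u * u powr (- \<alpha>) - v * (indicat_real {v..} u * u powr (- \<alpha> - 1))" for u :: real
    using v powr_mult_base[of u "- \<alpha> - 1"] by (auto simp: indicator_def left_diff_distrib)
  have i: "integrable lborel (\<lambda>u. indicator {v..} u * u powr (- \<alpha>))"
    "integrable lborel (\<lambda>u. indicator {v..} u * u powr (- \<alpha> - 1))"
    using powr_tail(1)[OF _ v] a by auto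
  show "integrable lborel (\<lambda>u. indicator {v..} u * ((u - v) * u powr (- \<alpha> - 1)))"
    unfolding e by (intro Bochner_Integration.integrable_diff integrable_mult_right i)
  have "(\<integral>u. indicator {v..} u * ((u - v) * u powr (- \<alpha> - 1)) \<partial>lborel)
      = (\<integral>u. indicator {v..} u * u powr (- \<alpha>) \<partial>lborel) - v * (\<integral>u. indicator {v..} u * u powr (- \<alpha> - 1) \<partial>lborel)"
    unfolding e using i by simp
  also have "\<dots> = - (v powr (- \<alpha> + 1)) / (- \<alpha> + 1) - v * (- (v powr (- \<alpha> - 1 + 1)) / (- \<alpha> - 1 + 1))"
    using powr_tail(2)[OF _ v] a by simp
  also have "\<dots> = v powr (1 - \<alpha>) / (\<alpha> - 1) - v powr (1 - \<alpha>) / \<alpha>"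
  proof -
    have "v * v powr (- \<alpha>) = v powr (1 - \<alpha>)" using v powr_add[of v 1 "- \<alpha>"] by simp
    moreover have "- (v powr (1 - \<alpha>)) / (1 - \<alpha>) = v powr (1 - \<alpha>) / (\<alpha> - 1)" using a by (simp add: field_simps)
    ultimately show ?thesis by simp
  qed
  also have "\<dots> = v powr (1 - \<alpha>) / (\<alpha> * (\<alpha> - 1))" using a by (simp add: field_simps)
  finally show "(\<integral>u. indicator {v..} u * ((u - v) * u powr (- \<alpha> - 1)) \<partial>lborel) = v powr (1 - \<alpha>) / (\<alpha> * (\<alpha> - 1))" .
qed

text \<open>
  Two integrations by parts are replaced by an exchange of integrals: insert Taylor's remainder
  \<open>\<integral>\<^sub>0\<^sup>u (u - v) f''(x - s v) dv\<close> and integrate over \<open>u > v\<close> first, which by the preceding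
  lemma turns the kernel of order \<open>- \<alpha> - 1\<close> into one of order \<open>1 - \<alpha>\<close>.  The integral after the exchange
  converges absolutely because \<open>1 - \<alpha> > - 1\<close>.
\<close>

lemma taylor_fubini:
  assumes s: "s = 1 \<or> s = (-1::real)" and a: "1 < \<alpha>" "\<alpha> < 2"
    and u: "C2 f" and supp: "\<And>x. x \<notin> {p..q} \<Longrightarrow> f x = 0"
  shows "integrable lborel (\<lambda>u. (f (x - s * u) - f x + s * u * deriv f x) * pos_powr (- \<alpha> - 1) u)"
    and "\<alpha> * (\<alpha> - 1) * (\<integral>u. (f (x - s * u) - f x + s * u * deriv f x) * pos_powr (- \<alpha> - 1) u \<partial>lborel) =
      frac_int s (1 - \<alpha>) (deriv (deriv f)) x"
proof -
  let ?g = "\<lambda>v. deriv (deriv f) (x - s * v)"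
  let ?T = "\<lambda>u. (f (x - s * u) - f x + s * u * deriv f x) * pos_powr (- \<alpha> - 1) u"
  define K where "K v u = (if 0 < v \<and> v \<le> u then (u - v) * ?g v * u powr (- \<alpha> - 1) else 0)" for v u
  have c: "continuous_on UNIV (deriv (deriv f))" using C2D(5)[OF u] .
  have [measurable]: "deriv (deriv f) \<in> borel_measurable borel"
    using c by (rule borel_measurable_continuous_onI)
  have Km [measurable]: "(\<lambda>(v, u). K v u) \<in> borel_measurable (lborel \<Otimes>\<^sub>M lborel)"
    unfolding K_def by measurable
  have z: "deriv (deriv f) y = 0" if "y \<notin> {p..q}" for y
    by (rule deriv_zero_off_support[OF deriv_zero_off_support[OF supp] that])
  obtain B where B: "0 \<le> B" "\<And>y. \<bar>deriv (deriv f) y\<bar> \<le> B" using bounded_of_compact_support[OF c z] by blast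
  have e1: "K v u = (if 0 < v then ?g v else 0) * (indicator {v..} u * ((u - v) * u powr (- \<alpha> - 1)))" for v u
    by (auto simp: K_def indicator_def)
  have i1: "integrable lborel (K v)" for v
    unfolding e1 using taylor_kernel_integral(1)[OF a(1), of v] by (cases "0 < v") auto
  have v1: "(\<integral>u. K v u \<partial>lborel) = ?g v * pos_powr (1 - \<alpha>) v / (\<alpha> * (\<alpha> - 1))" for v
    unfolding e1 using taylor_kernel_integral(2)[OF a(1), of v] by (cases "0 < v") (auto simp: pos_powr_def)
  have e2: "norm (K v u) = (if 0 < v then \<bar>?g v\<bar> else 0) * (indicator {v..} u * ((u - v) * u powr (- \<alpha> - 1)))" for v u
    by (auto simp: K_def indicator_def abs_mult)
  have v2: "(\<integral>u. norm (K v u) \<partial>lborel) = \<bar>?g v * pos_powr (1 - \<alpha>) v\<bar> / (\<alpha> * (\<alpha> - 1))" for v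
    unfolding e2 using taylor_kernel_integral(2)[OF a(1), of v]
    by (cases "0 < v") (auto simp: pos_powr_def abs_mult)
  have i2: "integrable lborel (\<lambda>v. ?g v * pos_powr (1 - \<alpha>) v)"
    by (rule frac_integrable[OF s _ _ z B(2)]) (use a in auto)
  have int: "integrable (lborel \<Otimes>\<^sub>M lborel) (\<lambda>(v, u). K v u)"
  proof (rule lborel_pair.Fubini_integrable)
    show "integrable lborel (\<lambda>v. \<integral>u. norm (case (v, u) of (v, u) \<Rightarrow> K v u) \<partial>lborel)"
      unfolding prod.case v2 using i2 by (intro integrable_divide integrable_abs)
  qed (use i1 in auto)
  have "(\<integral>v. K v u \<partial>lborel) = ?T u" for u
  proof (cases "0 < u")
    case True
    have "(\<integral>v. K v u \<partial>lborel) = (\<integral>v. u powr (- \<alpha> - 1) * (indicator {0..u} v * ((u - v) * ?g v)) \<partial>lborel)"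
    proof (rule integral_cong_AE)
      have "AE v in lborel. v \<noteq> (0::real)" by (rule AE_lborel_singleton)
      then show "AE v in lborel. K v u = u powr (- \<alpha> - 1) * (indicator {0..u} v * ((u - v) * ?g v))"
        by eventually_elim (auto simp: K_def indicator_def)
    qed (unfold K_def, measurable)
    then show ?thesis using taylor_integral[OF s u, of u x] True by (simp add: pos_powr_def)
  next
    case False
    then have "K v u = 0" for v by (auto simp: K_def)
    then show ?thesis using False by (simp add: pos_powr_def)
  qed
  then show "integrable lborel (\<lambda>u. ?T u)"
    and "\<alpha> * (\<alpha> - 1) * (\<integral>u. ?T u \<partial>lborel) =
      frac_int s (1 - \<alpha>) (deriv (deriv f)) x"
    using lborel_pair.integrable_snd[OF int] lborel_pair.Fubini_integral[OF int] a
    by (simp_all add: v1 frac_int_def)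
qed

text \<open>
  The function is split by a cutoff that equals \<open>1\<close> near \<open>x0\<close>.  One part is globally smooth, and its
  fractional integral is differentiated twice under the integral sign; the Taylor identity
  matches the result with the jump integral.  The other part vanishes near \<open>x0\<close>, so the kernel
  \<open>u powr (1 - \<alpha>)\<close> is differentiated twice; its second derivative is \<open>\<alpha> (\<alpha> - 1) u powr (- \<alpha> - 1)\<close>, and
  in the jump integral neither the value nor the derivative at \<open>x0\<close> contributes.
\<close>

lemma one_sided_fractional:
  assumes s: "s = 1 \<or> s = (-1::real)" and a: "1 < \<alpha>" "\<alpha> < 2"
    and lR: "l < R" and f: "f \<in> C02 {l<..<R}" and x0: "x0 \<in> {l<..<R}"
  defines "F \<equiv> zero_ext {l<..<R} f"
  shows "integrable lborel (\<lambda>u. (F (x0 - s * u) - F x0 + s * u * deriv F x0) * pos_powr (- \<alpha> - 1) u)"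
    and "\<forall>\<^sub>F z in nhds x0. frac_int s (1 - \<alpha>) F differentiable (at z)"
    and "(deriv (frac_int s (1 - \<alpha>) F) has_real_derivative
      \<alpha> * (\<alpha> - 1) * (\<integral>u. (F (x0 - s * u) - F x0 + s * u * deriv F x0) * pos_powr (- \<alpha> - 1) u \<partial>lborel)) (at x0)"
proof -
  let ?T = "\<lambda>f u. (f (x0 - s * u) - f x0 + s * u * deriv f x0) * pos_powr (- \<alpha> - 1) u"
  define \<eta> where "\<eta> = min (x0 - l) (R - x0) / 4"
  have \<eta>: "0 < \<eta>" "l < x0 - 3 * \<eta>" "x0 + 3 * \<eta> < R"
    using x0 by (auto simp: \<eta>_def min_def field_simps split: if_splits)
  obtain \<psi> where \<psi>: "C2 \<psi>" "\<And>x. 0 \<le> \<psi> x" "\<And>x. \<psi> x \<le> 1" "\<And>x. x \<in> {x0 - 2 * \<eta>..x0 + 2 * \<eta>} \<Longrightarrow> \<psi> x = 1"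
    "\<And>x. x \<notin> {x0 - 3 * \<eta>..x0 + 3 * \<eta>} \<Longrightarrow> \<psi> x = 0"
    using cutoff_exists[of "x0 - 3 * \<eta>" "x0 - 2 * \<eta>" "x0 + 2 * \<eta>" "x0 + 3 * \<eta>"] \<eta>(1) by auto
  define f1 where "f1 x = \<psi> x * F x" for x
  define f2 where "f2 x = (1 - \<psi> x) * F x" for x
  have sum: "F x = f1 x + f2 x" for x by (simp add: f1_def f2_def algebra_simps)
  have C2f1: "C2 f1" unfolding f1_def[abs_def] F_def by (rule C2_cutoff_mult[OF f \<psi>(1) \<psi>(5)]) (use \<eta> in auto)
  have cF: "continuous_on UNIV F" unfolding F_def using continuous_zero_ext[OF lR] f by (simp add: C02_def)
  have offF: "F x = 0" if "x \<notin> {l..R}" for x unfolding F_def using zero_ext_off[OF that] .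
  have c2: "continuous_on UNIV f2" unfolding f2_def[abs_def] by (intro continuous_intros cF C2D(3)[OF \<psi>(1)])
  have off1: "f1 x = 0" if "x \<notin> {x0 - 3 * \<eta>..x0 + 3 * \<eta>}" for x using \<psi>(5)[OF that] by (simp add: f1_def)
  have off2: "f2 x = 0" if "x \<notin> {l..R}" for x using offF[OF that] by (simp add: f2_def)
  have far: "f2 y = 0" if "\<bar>y - x0\<bar> < 2 * \<eta>" for y using \<psi>(4)[of y] that by (auto simp: f2_def abs_less_iff)
  obtain B2 where B2: "0 \<le> B2" "\<And>x. \<bar>f2 x\<bar> \<le> B2" using bounded_of_compact_support[OF c2 off2] by blast
  have m2: "f2 \<in> borel_measurable borel" using c2 by (rule borel_measurable_continuous_onI)
  have Jn: "\<forall>\<^sub>F z in nhds x0. \<bar>z - x0\<bar> < \<eta>"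
    using eventually_nhds_in_open[of "ball x0 \<eta>" x0] \<eta>(1) by (simp add: dist_real_def abs_minus_commute)
  have b: "-1 < 1 - \<alpha>" "1 - \<alpha> \<le> 0" "1 - \<alpha> - 1 \<le> 0" using a by auto
  have off1': "deriv f1 x = 0" if "x \<notin> {x0 - 3 * \<eta>..x0 + 3 * \<eta>}" for x
    by (rule deriv_zero_off_support[OF off1 that])
  obtain B1 where B1: "0 \<le> B1" "\<And>x. \<bar>f1 x\<bar> \<le> B1" using bounded_of_compact_support[OF C2D(3)[OF C2f1] off1] by blast
  have i1: "integrable lborel (\<lambda>u. f1 (x - s * u) * pos_powr (1 - \<alpha>) u)" for x
    by (rule frac_integrable[OF s b(1) _ off1 B1(2)]) (auto intro: borel_measurable_continuous_onI C2D(3)[OF C2f1])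
  have D1: "(frac_int s (1 - \<alpha>) f1 has_real_derivative frac_int s (1 - \<alpha>) (deriv f1) x) (at x)" for x
    by (rule DERIV_frac_int_smooth[OF s b(1) C2D(1)[OF C2f1] C2D(4)[OF C2f1] off1])
  have D1': "(frac_int s (1 - \<alpha>) (deriv f1) has_real_derivative frac_int s (1 - \<alpha>) (deriv (deriv f1)) x) (at x)" for x
    by (rule DERIV_frac_int_smooth[OF s b(1) C2D(2)[OF C2f1] C2D(5)[OF C2f1] off1'])
  have D2: "(frac_int s (1 - \<alpha>) f2 has_real_derivative s * (1 - \<alpha>) * frac_int s (1 - \<alpha> - 1) f2 z) (at z)"
    and D2': "(frac_int s (1 - \<alpha> - 1) f2 has_real_derivative
      s * (1 - \<alpha> - 1) * frac_int s (1 - \<alpha> - 1 - 1) f2 z) (at z)"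
    and i2: "integrable lborel (\<lambda>u. f2 (z - s * u) * pos_powr (1 - \<alpha>) u)" if "\<bar>z - x0\<bar> < \<eta>" for z
    by (rule DERIV_frac_int_far[OF s b(2) m2 off2 B2(2) far \<eta>(1) that]
        DERIV_frac_int_far[OF s b(3) m2 off2 B2(2) far \<eta>(1) that], assumption+)+
  have Fsum: "frac_int s (1 - \<alpha>) F z = frac_int s (1 - \<alpha>) f1 z + frac_int s (1 - \<alpha>) f2 z" if "\<bar>z - x0\<bar> < \<eta>" for z
    unfolding frac_int_def sum distrib_right using i1 i2[OF that] by simp
  have op: "open {z. \<bar>z - x0\<bar> < \<eta>}" by (intro open_Collect_less continuous_intros)
  have DF: "(frac_int s (1 - \<alpha>) F has_real_derivative
      frac_int s (1 - \<alpha>) (deriv f1) z + s * (1 - \<alpha>) * frac_int s (1 - \<alpha> - 1) f2 z) (at z)" if "\<bar>z - x0\<bar> < \<eta>" for z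
    by (rule has_field_derivative_transform_within_open[OF DERIV_add[OF D1 D2[OF that]] op]) (use that Fsum in auto)
  show "\<forall>\<^sub>F z in nhds x0. frac_int s (1 - \<alpha>) F differentiable (at z)"
    using Jn by eventually_elim (use DF real_differentiable_def in blast)
  have near: "\<bar>x0 - x0\<bar> < \<eta>" using \<eta> by simp
  have "((\<lambda>z. frac_int s (1 - \<alpha>) (deriv f1) z + s * (1 - \<alpha>) * frac_int s (1 - \<alpha> - 1) f2 z) has_real_derivative
      frac_int s (1 - \<alpha>) (deriv (deriv f1)) x0 + s * (1 - \<alpha>) * (s * (1 - \<alpha> - 1) * frac_int s (1 - \<alpha> - 1 - 1) f2 x0)) (at x0)"
    by (rule DERIV_add[OF D1' DERIV_cmult[OF D2'[OF near]]])
  then have DD: "(deriv (frac_int s (1 - \<alpha>) F) has_real_derivative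
      frac_int s (1 - \<alpha>) (deriv (deriv f1)) x0 + s * (1 - \<alpha>) * (s * (1 - \<alpha> - 1) * frac_int s (1 - \<alpha> - 1 - 1) f2 x0)) (at x0)"
  proof (rule has_field_derivative_transform_within_open[OF _ op])
    show "x0 \<in> {z. \<bar>z - x0\<bar> < \<eta>}" using near by simp
    show "frac_int s (1 - \<alpha>) (deriv f1) z + s * (1 - \<alpha>) * frac_int s (1 - \<alpha> - 1) f2 z =
      deriv (frac_int s (1 - \<alpha>) F) z" if "z \<in> {z. \<bar>z - x0\<bar> < \<eta>}" for z
      using DERIV_imp_deriv[OF DF, of z] that by simp
  qed
  have ss: "s * s = 1" using s by auto
  have co: "s * (1 - \<alpha>) * (s * (1 - \<alpha> - 1) * y) = \<alpha> * (\<alpha> - 1) * y" for y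
  proof -
    have "s * (1 - \<alpha>) * (s * (1 - \<alpha> - 1) * y) = (s * s) * (\<alpha> * (\<alpha> - 1) * y)" by algebra
    then show ?thesis unfolding ss by simp
  qed
  have f2x: "f2 x0 = 0" using far \<eta>(1) by simp
  have dF: "deriv F x0 = deriv f1 x0"
  proof (rule DERIV_imp_deriv)
    show "(F has_real_derivative deriv f1 x0) (at x0)"
      by (rule has_field_derivative_transform_within_open[OF C2D(1)[OF C2f1] op])
        (use \<eta> far sum in auto)
  qed
  have split: "?T F u =
    ?T f1 u + f2 (x0 - s * u) * pos_powr (- \<alpha> - 1) u" for u
    unfolding dF sum f2x by (simp add: algebra_simps)
  have T: "integrable lborel (\<lambda>u. ?T f1 u)"
    "\<alpha> * (\<alpha> - 1) * (\<integral>u. ?T f1 u \<partial>lborel) =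
      frac_int s (1 - \<alpha>) (deriv (deriv f1)) x0"
    by (rule taylor_fubini[OF s a C2f1 off1], assumption)+
  have b3: "- \<alpha> - 1 \<le> 0" using a by simp
  have i3: "integrable lborel (\<lambda>u. f2 (x0 - s * u) * pos_powr (- \<alpha> - 1) u)"
    by (rule DERIV_frac_int_far(2)[OF s b3 m2 off2 B2(2) far \<eta>(1) near])
  show "integrable lborel (\<lambda>u. ?T F u)"
    unfolding split by (rule Bochner_Integration.integrable_add[OF T(1) i3])
  have "\<alpha> * (\<alpha> - 1) * (\<integral>u. ?T F u \<partial>lborel)
    = frac_int s (1 - \<alpha>) (deriv (deriv f1)) x0 + \<alpha> * (\<alpha> - 1) * frac_int s (- \<alpha> - 1) f2 x0"
    unfolding split Bochner_Integration.integral_add[OF T(1) i3] distrib_left T(2) frac_int_def[of s "- \<alpha> - 1"] ..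
  moreover have "1 - \<alpha> - 1 - 1 = - \<alpha> - 1" by simp
  ultimately show "(deriv (frac_int s (1 - \<alpha>) F) has_real_derivative
      \<alpha> * (\<alpha> - 1) * (\<integral>u. ?T F u \<partial>lborel)) (at x0)"
    using DD unfolding co by simp
qed

section \<open>The jump measure\<close>

definition jump_density :: "real \<Rightarrow> real \<Rightarrow> real \<Rightarrow> real \<Rightarrow> real" where
  "jump_density \<alpha> b c y = \<alpha> * (\<alpha> - 1) / Gamma (2 - \<alpha>) * (b * pos_powr (- \<alpha> - 1) y + c * pos_powr (- \<alpha> - 1) (- y))"

lemma jump_density_measurable [measurable]: "jump_density \<alpha> b c \<in> borel_measurable borel"
  unfolding jump_density_def[abs_def] by measurable

lemma Gamma_pos: "\<alpha> < 2 \<Longrightarrow> 0 < Gamma (2 - \<alpha> :: real)"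
  by (rule Gamma_real_pos) simp

lemma jump_density_nonneg:
  assumes "1 < \<alpha>" "\<alpha> < 2" "0 \<le> b" "0 \<le> c" shows "0 \<le> jump_density \<alpha> b c y"
  using assms Gamma_pos[of \<alpha>] by (simp add: jump_density_def)

lemma jump_measure_eq: "jump_measure \<alpha> b c = density lborel (\<lambda>y. ennreal (jump_density \<alpha> b c y))"
proof -
  have "(if y > 0 then b * (\<alpha> * (\<alpha> - 1) / Gamma (2 - \<alpha>)) * y powr (- \<alpha> - 1)
      else if y < 0 then c * (\<alpha> * (\<alpha> - 1) / Gamma (2 - \<alpha>)) * \<bar>y\<bar> powr (- \<alpha> - 1)
      else 0) = jump_density \<alpha> b c y" for y
    by (simp add: jump_density_def pos_powr_def)
  then show ?thesis by (simp add: jump_measure_def)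
qed

lemma jump_measure_integral:
  assumes p: "1 < \<alpha>" "\<alpha> < 2" "0 \<le> b" "0 \<le> c" and g [measurable]: "g \<in> borel_measurable borel"
  shows "integrable (jump_measure \<alpha> b c) g \<longleftrightarrow> integrable lborel (\<lambda>y. jump_density \<alpha> b c y * g y)"
    and "(\<integral>y. g y \<partial>jump_measure \<alpha> b c) = (\<integral>y. jump_density \<alpha> b c y * g y \<partial>lborel)"
  unfolding jump_measure_eq using jump_density_nonneg[OF p]
  by (simp_all add: integrable_density integral_density)

lemma jump_measure_integral_sides:
  assumes p: "1 < \<alpha>" "\<alpha> < 2" "0 \<le> b" "0 \<le> c" and g [measurable]: "g \<in> borel_measurable borel"
    and i: "integrable lborel (\<lambda>u. g u * pos_powr (- \<alpha> - 1) u)" "integrable lborel (\<lambda>u. g (- u) * pos_powr (- \<alpha> - 1) u)"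
  shows "integrable (jump_measure \<alpha> b c) g"
    and "(\<integral>y. g y \<partial>jump_measure \<alpha> b c) = \<alpha> * (\<alpha> - 1) / Gamma (2 - \<alpha>) *
      (b * (\<integral>u. g u * pos_powr (- \<alpha> - 1) u \<partial>lborel) + c * (\<integral>u. g (- u) * pos_powr (- \<alpha> - 1) u \<partial>lborel))"
proof -
  have e: "jump_density \<alpha> b c y * g y = \<alpha> * (\<alpha> - 1) / Gamma (2 - \<alpha>) *
      (b * (g y * pos_powr (- \<alpha> - 1) y) + c * (g y * pos_powr (- \<alpha> - 1) (- y)))" for y
    by (simp add: jump_density_def algebra_simps)
  have i2: "integrable lborel (\<lambda>y. g y * pos_powr (- \<alpha> - 1) (- y))"
    using lborel_integrable_real_affine_iff[of "-1" "\<lambda>y. g y * pos_powr (- \<alpha> - 1) (- y)" 0] i(2) by simp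
  have v2: "(\<integral>u. g (- u) * pos_powr (- \<alpha> - 1) u \<partial>lborel) = (\<integral>y. g y * pos_powr (- \<alpha> - 1) (- y) \<partial>lborel)"
    using lborel_integral_real_affine[of "-1" "\<lambda>y. g y * pos_powr (- \<alpha> - 1) (- y)" 0] by simp
  show "integrable (jump_measure \<alpha> b c) g"
    unfolding jump_measure_integral(1)[OF p g] e
    by (intro integrable_mult_right Bochner_Integration.integrable_add i(1) i2)
  show "(\<integral>y. g y \<partial>jump_measure \<alpha> b c) = \<alpha> * (\<alpha> - 1) / Gamma (2 - \<alpha>) *
      (b * (\<integral>u. g u * pos_powr (- \<alpha> - 1) u \<partial>lborel) + c * (\<integral>u. g (- u) * pos_powr (- \<alpha> - 1) u \<partial>lborel))"
    unfolding jump_measure_integral(2)[OF p g] e v2 using i(1) i2 by simp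
qed

text \<open>
  Away from \<open>0\<close> the jump measure is finite, so a bounded change of a function away from a point
  changes the operator at that point by a controlled amount.
\<close>

lemma jump_measure_tail_finite:
  assumes p: "1 < \<alpha>" "\<alpha> < 2" "0 \<le> b" "0 \<le> c" and d: "0 < d"
  shows "integrable (jump_measure \<alpha> b c) (indicat_real {y. d \<le> \<bar>y\<bar>})"
proof (rule jump_measure_integral_sides(1)[OF p])
  have e: "indicat_real {y. d \<le> \<bar>y\<bar>} u * pos_powr (- \<alpha> - 1) u = indicator {d..} u * u powr (- \<alpha> - 1)" for u
    using d by (auto simp: indicator_def pos_powr_def)
  have e': "indicat_real {y. d \<le> \<bar>y\<bar>} (- u) * pos_powr (- \<alpha> - 1) u = indicator {d..} u * u powr (- \<alpha> - 1)" for u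
    using d by (auto simp: indicator_def pos_powr_def)
  have "integrable lborel (\<lambda>u. indicator {d..} u * u powr (- \<alpha> - 1))" by (rule powr_tail(1)) (use p d in auto)
  then show "integrable lborel (\<lambda>u. indicat_real {y. d \<le> \<bar>y\<bar>} u * pos_powr (- \<alpha> - 1) u)"
    "integrable lborel (\<lambda>u. indicat_real {y. d \<le> \<bar>y\<bar>} (- u) * pos_powr (- \<alpha> - 1) u)"
    unfolding e e' by auto
qed measurable

section \<open>The operator in terms of Riemann--Liouville derivatives\<close>

text \<open>
  The integrands differ at a single end point of the interval, where \<open>f\<close> may take any value.
\<close>

lemma rl_integral_eq_frac_int:
  assumes x: "x \<in> {l<..<R}"
  shows "rl_integral_left \<alpha> l f x = frac_int 1 (1 - \<alpha>) (zero_ext {l<..<R} f) x"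
    and "rl_integral_right \<alpha> R f x = frac_int (-1) (1 - \<alpha>) (zero_ext {l<..<R} f) x"
    and "set_integrable lborel {l..x} (\<lambda>y. f y * (x - y) powr (1 - \<alpha>)) \<longleftrightarrow>
      integrable lborel (\<lambda>u. zero_ext {l<..<R} f (x - 1 * u) * pos_powr (1 - \<alpha>) u)"
    and "set_integrable lborel {x..R} (\<lambda>y. f y * (y - x) powr (1 - \<alpha>)) \<longleftrightarrow>
      integrable lborel (\<lambda>u. zero_ext {l<..<R} f (x - (-1) * u) * pos_powr (1 - \<alpha>) u)"
proof -
  let ?F = "zero_ext {l<..<R} f"
  have eL: "indicat_real {l..x} y * (f y * (x - y) powr (1 - \<alpha>)) =
    f l * (x - l) powr (1 - \<alpha>) * indicator {l} y + ?F y * pos_powr (1 - \<alpha>) (1 * (x - y))" for y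
    using x by (auto simp: indicator_def zero_ext_def pos_powr_def)
  have eR: "indicat_real {x..R} y * (f y * (y - x) powr (1 - \<alpha>)) =
    f R * (R - x) powr (1 - \<alpha>) * indicator {R} y + ?F y * pos_powr (1 - \<alpha>) (-1 * (x - y))" for y
    using x by (auto simp: indicator_def zero_ext_def pos_powr_def)
  have i: "integrable lborel (\<lambda>y. k * indicat_real {z} y)" for k z
    by (intro integrable_mult_right integrable_real_indicator) auto
  have iff: "integrable lborel (\<lambda>y. k * indicat_real {z} y + h y) \<longleftrightarrow> integrable lborel h" for k z h
  proof
    assume "integrable lborel (\<lambda>y. k * indicat_real {z} y + h y)"
    from Bochner_Integration.integrable_diff[OF this i[of k z]] show "integrable lborel h" by simp
  next
    assume "integrable lborel h"
    from Bochner_Integration.integrable_add[OF i this] show "integrable lborel (\<lambda>y. k * indicat_real {z} y + h y)" .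
  qed
  have v: "(\<integral>y. k * indicat_real {z} y + h y \<partial>lborel) = (\<integral>y. h y \<partial>lborel)" for k z h
  proof (cases "integrable lborel h")
    case True
    then show ?thesis using Bochner_Integration.integral_add[OF i[of k z] True] by simp
  next
    case False
    then have "\<not> integrable lborel (\<lambda>y. k * indicat_real {z} y + h y)" using iff by blast
    with False show ?thesis by (simp add: not_integrable_integral_eq)
  qed
  show "rl_integral_left \<alpha> l f x = frac_int 1 (1 - \<alpha>) ?F x"
    unfolding rl_integral_left_def set_lebesgue_integral_def real_scaleR_def eL v frac_int_shift(1)[of 1, simplified]
    by simp
  show "rl_integral_right \<alpha> R f x = frac_int (-1) (1 - \<alpha>) ?F x"
    unfolding rl_integral_right_def set_lebesgue_integral_def real_scaleR_def eR v
    by (simp add: frac_int_shift(1)[of "-1"])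
  show "set_integrable lborel {l..x} (\<lambda>y. f y * (x - y) powr (1 - \<alpha>)) \<longleftrightarrow>
      integrable lborel (\<lambda>u. ?F (x - 1 * u) * pos_powr (1 - \<alpha>) u)"
    unfolding set_integrable_def real_scaleR_def eL iff
    by (rule frac_int_shift(2)[symmetric]) simp
  show "set_integrable lborel {x..R} (\<lambda>y. f y * (y - x) powr (1 - \<alpha>)) \<longleftrightarrow>
      integrable lborel (\<lambda>u. ?F (x - (-1) * u) * pos_powr (1 - \<alpha>) u)"
    unfolding set_integrable_def real_scaleR_def eR iff
    by (rule frac_int_shift(2)[symmetric]) simp
qed

lemma twice_differentiable_cong:
  assumes S: "open S" "x \<in> S" and eq: "\<And>z. z \<in> S \<Longrightarrow> f z = g z"
    and d: "\<forall>\<^sub>F z in nhds x. g differentiable (at z)" and D: "(deriv g has_real_derivative d) (at x)"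
  shows "twice_differentiable_at f x" "deriv (deriv f) x = d"
proof -
  have ev: "\<forall>\<^sub>F z in nhds x. z \<in> S" using S by (rule eventually_nhds_in_open)
  have "\<forall>\<^sub>F z in nhds x. (f has_real_derivative deriv g z) (at z)"
    using ev d
  proof eventually_elim
    case (elim z)
    then have "(g has_real_derivative deriv g z) (at z)" by (simp add: DERIV_deriv_iff_real_differentiable)
    then show ?case
      by (rule has_field_derivative_transform_within_open[OF _ S(1) elim(1)]) (simp add: eq)
  qed
  then obtain T where T: "open T" "x \<in> T" "\<And>z. z \<in> T \<Longrightarrow> (f has_real_derivative deriv g z) (at z)"
    by (auto simp: eventually_nhds)
  have D': "(deriv f has_real_derivative d) (at x)"
    by (rule has_field_derivative_transform_within_open[OF D T(1,2)]) (simp add: DERIV_imp_deriv[OF T(3)])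
  show "deriv (deriv f) x = d" using D' by (rule DERIV_imp_deriv)
  show "twice_differentiable_at f x"
    unfolding twice_differentiable_at_def eventually_nhds using T D' real_differentiable_def by blast
qed

lemma stable_op_on_fractional:
  assumes p: "1 < \<alpha>" "\<alpha> < 2" "0 \<le> b" "0 \<le> c"
    and lR: "l < R" and f: "f \<in> C02 {l<..<R}" and x: "x \<in> {l<..<R}"
  shows "integrable (jump_measure \<alpha> b c) (jump_integrand (zero_ext {l<..<R} f) x)"
    and "rl_deriv_left_exists \<alpha> l f x" and "rl_deriv_right_exists \<alpha> R f x"
    and "stable_op_on {l<..<R} \<alpha> a b c f x =
      - a * deriv f x + b * rl_deriv_left \<alpha> l f x + c * rl_deriv_right \<alpha> R f x"
proof -
  let ?\<Omega> = "{l<..<R}" let ?F = "zero_ext ?\<Omega> f"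
  have cF: "continuous_on UNIV ?F" using continuous_zero_ext[OF lR] f by (simp add: C02_def)
  have [measurable]: "?F \<in> borel_measurable borel" using cF by (rule borel_measurable_continuous_onI)
  have offF: "?F y = 0" if "y \<notin> {l..R}" for y using zero_ext_off[OF that] .
  obtain B where B: "0 \<le> B" "\<And>x. \<bar>?F x\<bar> \<le> B" using bounded_of_compact_support[OF cF offF] by blast
  have s: "1 = 1 \<or> 1 = (-1::real)" "-1 = 1 \<or> -1 = (-1::real)" by auto
  note O1 = one_sided_fractional[OF s(1) p(1,2) lR f x]
  note O2 = one_sided_fractional[OF s(2) p(1,2) lR f x]
  have int: "integrable lborel (\<lambda>u. ?F (z - s * u) * pos_powr (1 - \<alpha>) u)" if "s = 1 \<or> s = -1" for z s
    by (rule frac_integrable[OF that _ _ offF B(2)]) (use p in auto)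
  have op: "open ?\<Omega>" by simp
  have eqL: "rl_integral_left \<alpha> l f z = frac_int 1 (1 - \<alpha>) ?F z" if "z \<in> ?\<Omega>" for z
    using rl_integral_eq_frac_int(1)[OF that] .
  have L: "twice_differentiable_at (rl_integral_left \<alpha> l f) x"
    "deriv (deriv (rl_integral_left \<alpha> l f)) x =
      \<alpha> * (\<alpha> - 1) * (\<integral>u. (?F (x - 1 * u) - ?F x + 1 * u * deriv ?F x) * pos_powr (- \<alpha> - 1) u \<partial>lborel)"
    by (rule twice_differentiable_cong(1)[OF op x eqL O1(2,3)], assumption) (rule twice_differentiable_cong(2)[OF op x eqL O1(2,3)], assumption)
  have eqR: "rl_integral_right \<alpha> R f z = frac_int (-1) (1 - \<alpha>) ?F z" if "z \<in> ?\<Omega>" for z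
    using rl_integral_eq_frac_int(2)[OF that] .
  have R: "twice_differentiable_at (rl_integral_right \<alpha> R f) x"
    "deriv (deriv (rl_integral_right \<alpha> R f)) x =
      \<alpha> * (\<alpha> - 1) * (\<integral>u. (?F (x - (-1) * u) - ?F x + (-1) * u * deriv ?F x) * pos_powr (- \<alpha> - 1) u \<partial>lborel)"
    by (rule twice_differentiable_cong(1)[OF op x eqR O2(2,3)], assumption) (rule twice_differentiable_cong(2)[OF op x eqR O2(2,3)], assumption)
  have ev: "\<forall>\<^sub>F z in nhds x. z \<in> ?\<Omega>" using op x by (rule eventually_nhds_in_open)
  show "rl_deriv_left_exists \<alpha> l f x"
    unfolding rl_deriv_left_exists_def
  proof (intro conjI L(1))
    show "\<forall>\<^sub>F z in nhds x. set_integrable lborel {l..z} (\<lambda>y. f y * (z - y) powr (1 - \<alpha>))"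
      using ev by eventually_elim (use int[OF s(1)] rl_integral_eq_frac_int(3) in blast)
  qed
  show "rl_deriv_right_exists \<alpha> R f x"
    unfolding rl_deriv_right_exists_def
  proof (intro conjI R(1))
    show "\<forall>\<^sub>F z in nhds x. set_integrable lborel {z..R} (\<lambda>y. f y * (y - z) powr (1 - \<alpha>))"
      using ev by eventually_elim (use int[OF s(2)] rl_integral_eq_frac_int(4) in blast)
  qed
  have m: "jump_integrand ?F x \<in> borel_measurable borel" unfolding jump_integrand_def[abs_def] by measurable
  have i1: "integrable lborel (\<lambda>u. jump_integrand ?F x u * pos_powr (- \<alpha> - 1) u)"
    using O1(1) by (simp add: jump_integrand_def)
  have i2: "integrable lborel (\<lambda>u. jump_integrand ?F x (- u) * pos_powr (- \<alpha> - 1) u)"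
    using O2(1) by (simp add: jump_integrand_def)
  note J = jump_measure_integral_sides[OF p m i1 i2]
  show "integrable (jump_measure \<alpha> b c) (jump_integrand ?F x)" by (rule J(1))
  have dF: "deriv ?F x = deriv f x" by (rule C02_zero_extD(3)[OF f x])
  show "stable_op_on ?\<Omega> \<alpha> a b c f x =
      - a * deriv f x + b * rl_deriv_left \<alpha> l f x + c * rl_deriv_right \<alpha> R f x"
  proof -
    have K: "K / G * (b * I1 + c * I2) = b * (1 / G * (K * I1)) + c * (1 / G * (K * I2))" for K G I1 I2 :: real
      by (cases "G = 0") (auto simp: field_simps)
    show ?thesis
      unfolding stable_op_on_def stable_op_def J(2) rl_deriv_left_def rl_deriv_right_def L(2) R(2) K
      by (simp add: jump_integrand_def dF)
  qed
qed

section \<open>The process on a grid\<close>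

text \<open>
  If the sequence stays in \<open>K\<close>, the sum telescopes to \<open>u (y n) - u (y 0)\<close>.  Otherwise it stops at the
  first exit \<open>y j\<close>, where \<open>u\<close> is at most \<open>\<kappa>\<close>.  This is optional stopping without a stopping time.
\<close>

lemma exit_telescope:
  fixes u :: "real \<Rightarrow> real"
  assumes "y 0 \<in> K" "\<And>z. z \<notin> K \<Longrightarrow> \<bar>u z\<bar> \<le> \<kappa>" "0 \<le> \<kappa>"
  shows "\<bar>(if \<forall>i\<le>n. y i \<in> K then u (y n) else 0) - u (y 0) -
    (\<Sum>k<n. if \<forall>i\<le>k. y i \<in> K then u (y (Suc k)) - u (y k) else 0)\<bar> \<le> \<kappa>"
proof -
  let ?S = "\<lambda>n. \<Sum>k<n. if \<forall>i\<le>k. y i \<in> K then u (y (Suc k)) - u (y k) else 0"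
  have "if \<forall>i\<le>n. y i \<in> K then u (y 0) + ?S n = u (y n) else (\<exists>j. y j \<notin> K \<and> u (y 0) + ?S n = u (y j))"
  proof (induction n)
    case (Suc n)
    show ?case
    proof (cases "\<forall>i\<le>n. y i \<in> K")
      case True
      then have "u (y 0) + ?S (Suc n) = u (y (Suc n))" using Suc by simp
      then show ?thesis using True by (auto simp: le_Suc_eq)
    next
      case False
      then have "u (y 0) + ?S (Suc n) = u (y 0) + ?S n" by (simp only: sum.lessThan_Suc if_False add_0_right)
      moreover have "\<not> (\<forall>i\<le>Suc n. y i \<in> K)" using False by (auto simp: le_Suc_eq)
      moreover have "\<exists>j. y j \<notin> K \<and> u (y 0) + ?S n = u (y j)" using Suc False by (simp only: if_False)
      ultimately show ?thesis by (simp only: if_False)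
    qed
  qed (use assms in auto)
  then show ?thesis using assms(2,3) by (fastforce split: if_splits)
qed

lemma C0_line_bounded:
  assumes "g \<in> C0 UNIV"
  obtains B where "0 \<le> B" "\<And>x. \<bar>g x\<bar> \<le> B"
proof -
  have c: "continuous_on UNIV g" and lim: "(g \<longlongrightarrow> 0) at_infinity" using assms by (auto simp: C0_def)
  have "\<forall>\<^sub>F x in at_infinity. dist (g x) 0 < 1" using lim by (rule tendstoD) simp
  then obtain r where r: "\<And>x. r \<le> norm x \<Longrightarrow> \<bar>g x\<bar> < 1" by (auto simp: eventually_at_infinity)
  have "compact (g ` cball 0 r)" by (intro compact_continuous_image continuous_on_subset[OF c]) auto
  then obtain B where B: "\<And>y. y \<in> g ` cball 0 r \<Longrightarrow> norm y \<le> B"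
    using compact_imp_bounded bounded_iff by metis
  show ?thesis
  proof (rule that[of "max 1 B"])
    show "\<bar>g x\<bar> \<le> max 1 B" for x
      using r[of x] B[of "g x"] by (cases "norm x \<le> r") (auto simp: le_max_iff_disj dist_real_def)
  qed simp
qed

lemma feller_generatorD:
  assumes "(u, g) \<in> feller_generator \<Omega> P" "0 < e"
  obtains t0 where "0 < t0" "\<And>t x. 0 < t \<Longrightarrow> t < t0 \<Longrightarrow> x \<in> \<Omega> \<Longrightarrow> \<bar>(P t u x - u x) / t - g x\<bar> < e"
proof -
  have "\<forall>\<^sub>F t in at_right 0. \<forall>x\<in>\<Omega>. dist ((P t u x - u x) / t) (g x) < e"
    using assms by (auto simp: feller_generator_def uniform_limit_iff)
  then obtain t0 where "t0 > 0" "\<And>t. 0 < t \<Longrightarrow> t < t0 \<Longrightarrow> \<forall>x\<in>\<Omega>. dist ((P t u x - u x) / t) (g x) < e"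
    by (auto simp: eventually_at_right_field)
  then show ?thesis using that by (auto simp: dist_real_def)
qed

context levy_process
begin

lemma X_measurable [measurable]: "0 \<le> t \<Longrightarrow> X t \<in> borel_measurable M"
  by (rule random_variable_X)

definition grid_inc :: "real \<Rightarrow> nat \<Rightarrow> 'w \<Rightarrow> real" where
  "grid_inc h i w = X (real (Suc i) * h) w - X (real i * h) w"

lemma grid_inc_measurable [measurable]: "0 \<le> h \<Longrightarrow> grid_inc h i \<in> borel_measurable M"
  unfolding grid_inc_def[abs_def] by measurable

lemma indep_grid_inc: "0 \<le> h \<Longrightarrow> indep_vars (\<lambda>_. borel) (grid_inc h) {..<n}"
  using indep_increments[of "\<lambda>i. real i * h" n] by (simp add: grid_inc_def[abs_def] mult_right_mono)

lemma distr_grid_inc: "0 \<le> h \<Longrightarrow> distr M borel (grid_inc h i) = distr M borel (X h)"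
  using stationary_increments[of "real i * h" h] by (simp add: grid_inc_def[abs_def] algebra_simps)

lemma sum_grid_inc: "(\<Sum>j<i. grid_inc h j w) = X (real i * h) w - X 0 w"
  by (induction i) (auto simp: grid_inc_def)

lemma transition_semigroup_distr:
  assumes [measurable]: "u \<in> borel_measurable borel" and "0 \<le> h"
  shows "transition_semigroup M X h u y = (\<integral>d. u (y + d) \<partial>distr M borel (X h))"
  unfolding transition_semigroup_def by (subst integral_distr) (use assms in auto)

lemma transition_semigroup_measurable:
  assumes [measurable]: "u \<in> borel_measurable borel" and h: "0 \<le> h"
  shows "transition_semigroup M X h u \<in> borel_measurable borel"
proof -
  interpret Ph: prob_space "distr M borel (X h)" by (rule prob_space_distr) (use h in auto)
  have "(\<lambda>y. \<integral>d. u (y + d) \<partial>distr M borel (X h)) \<in> borel_measurable borel" by measurable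
  moreover have "transition_semigroup M X h u = (\<lambda>y. \<integral>d. u (y + d) \<partial>distr M borel (X h))"
    by (rule ext) (rule transition_semigroup_distr[OF assms])
  ultimately show ?thesis by (simp only:)
qed

text \<open>
  Survival up to the \<open>n\<close>-th point of the grid with mesh \<open>h\<close>, for the process started at \<open>x\<close>.
\<close>

definition grid_inside :: "real set \<Rightarrow> real \<Rightarrow> real \<Rightarrow> nat \<Rightarrow> 'w \<Rightarrow> bool" where
  "grid_inside K x h n w \<longleftrightarrow> (\<forall>i\<le>n. x + X (real i * h) w \<in> K)"

lemma grid_inside_measurable [measurable]:
  "K \<in> sets borel \<Longrightarrow> 0 \<le> h \<Longrightarrow> Measurable.pred M (grid_inside K x h n)"
  unfolding grid_inside_def[abs_def] by measurable auto

text \<open>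
  The Markov property at a grid point.  Survival up to time \<open>k h\<close> and the position at that time are functions
  of the first \<open>k\<close> increments, which are jointly independent of the next one; Fubini's theorem then integrates
  the next increment out.
\<close>

lemma markov_grid_step:
  assumes h: "0 \<le> h" and K [measurable]: "K \<in> sets borel"
    and u [measurable]: "u \<in> borel_measurable borel" and B: "\<And>y. \<bar>u y\<bar> \<le> B"
  shows "(\<integral>w. (if grid_inside K x h k w then u (x + X (real (Suc k) * h) w) - u (x + X (real k * h) w) else 0) \<partial>M) =
    (\<integral>w. (if grid_inside K x h k w
        then transition_semigroup M X h u (x + X (real k * h) w) - u (x + X (real k * h) w) else 0) \<partial>M)"
proof -
  let ?P = "PiM {..<k} (\<lambda>_. borel :: real measure)"
  let ?inc = "\<lambda>w. if grid_inside K x h k w then u (x + X (real (Suc k) * h) w) - u (x + X (real k * h) w) else 0"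
  let ?Z = "\<lambda>w. restrict (\<lambda>i. grid_inc h i w) {..<k}"
  define S where "S z i = x + (\<Sum>j<i. z j)" for z :: "nat \<Rightarrow> real" and i
  define I where "I z \<longleftrightarrow> (\<forall>i\<le>k. S z i \<in> K)" for z
  define \<phi> where "\<phi> z d = (if I z then u (S z k + d) - u (S z k) else 0)" for z d
  have Sm: "(\<lambda>z. S z i) \<in> borel_measurable ?P" if "i \<le> k" for i
    unfolding S_def using that
    by (intro borel_measurable_add borel_measurable_sum measurable_component_singleton borel_measurable_const) auto
  have Im [measurable]: "Measurable.pred ?P I"
    unfolding I_def[abs_def] atMost_iff[symmetric] Ball_def[symmetric]
  proof (rule pred_intros_finite)
    fix i assume "i \<in> {..k}"
    then have [measurable]: "(\<lambda>z. S z i) \<in> borel_measurable ?P" by (intro Sm) simp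
    show "Measurable.pred ?P (\<lambda>z. S z i \<in> K)" by measurable
  qed simp
  note [measurable] = Sm[OF order_refl]
  have [measurable]: "(\<lambda>(z, d). \<phi> z d) \<in> borel_measurable (?P \<Otimes>\<^sub>M borel)"
    unfolding \<phi>_def by measurable
  \<comment> \<open>the new increment, as a function on a singleton index set, so that both variables have the same type\<close>
  let ?T = "PiM {k} (\<lambda>_. borel :: real measure)"
  let ?D = "\<lambda>w. restrict (\<lambda>i. grid_inc h i w) {k}"
  have "indep_var ?P ?Z ?T ?D"
    by (rule indep_var_restrict[OF indep_grid_inc[OF h, of "Suc k"]]) auto
  then have Zm [measurable]: "random_variable ?P ?Z" and Dm [measurable]: "random_variable ?T ?D"
    and pr: "distr M ?P ?Z \<Otimes>\<^sub>M distr M ?T ?D = distr M (?P \<Otimes>\<^sub>M ?T) (\<lambda>w. (?Z w, ?D w))"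
    by (auto simp: indep_var_distribution_eq)
  interpret PZ: prob_space "distr M ?P ?Z" by (rule prob_space_distr[OF Zm])
  interpret PD: prob_space "distr M ?T ?D" by (rule prob_space_distr[OF Dm])
  interpret PZD: pair_prob_space "distr M ?P ?Z" "distr M ?T ?D" ..
  have B0: "0 \<le> B" using B[of 0] by linarith
  have \<phi>B: "\<bar>\<phi> z d\<bar> \<le> 2 * B" for z d
    using B[of "S z k + d"] B[of "S z k"] B0 by (auto simp: \<phi>_def)
  have ck [measurable]: "(\<lambda>d. d k) \<in> borel_measurable ?T" by (rule measurable_component_singleton) simp
  have \<phi>m [measurable]: "(\<lambda>(z, d). \<phi> z (d k)) \<in> borel_measurable (?P \<Otimes>\<^sub>M ?T)"
    by measurable
  have sets: "sets (distr M ?P ?Z \<Otimes>\<^sub>M distr M ?T ?D) = sets (?P \<Otimes>\<^sub>M ?T)"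
    by (intro sets_pair_measure_cong) auto
  have int: "integrable (distr M ?P ?Z \<Otimes>\<^sub>M distr M ?T ?D) (\<lambda>(z, d). \<phi> z (d k))"
    by (rule PZD.integrable_const_bound[where B="2 * B"])
      (use \<phi>B \<phi>m in \<open>auto simp: measurable_cong_sets[OF sets refl]\<close>)
  have \<phi>1 [measurable]: "\<phi> z \<in> borel_measurable borel" for z unfolding \<phi>_def[abs_def] by measurable
  have \<phi>2 [measurable]: "(\<lambda>z. \<integral>d. \<phi> z d \<partial>distr M borel (X h)) \<in> borel_measurable ?P"
  proof -
    interpret Ph: prob_space "distr M borel (X h)" by (rule prob_space_distr) (use h in auto)
    show ?thesis by measurable
  qed
  have dk: "(\<integral>d. \<phi> z (d k) \<partial>distr M ?T ?D) = (\<integral>d. \<phi> z d \<partial>distr M borel (X h))" for z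
  proof -
    have "(\<integral>d. \<phi> z (d k) \<partial>distr M ?T ?D) = (\<integral>w. \<phi> z (grid_inc h k w) \<partial>M)"
      by (subst integral_distr[OF Dm]) auto
    also have "\<dots> = (\<integral>d. \<phi> z d \<partial>distr M borel (grid_inc h k))"
      by (subst integral_distr) (use h in auto)
    finally show ?thesis unfolding distr_grid_inc[OF h] .
  qed
  have "(\<integral>w. \<phi> (?Z w) (grid_inc h k w) \<partial>M) = (\<integral>p. (case p of (z, d) \<Rightarrow> \<phi> z (d k)) \<partial>distr M (?P \<Otimes>\<^sub>M ?T) (\<lambda>w. (?Z w, ?D w)))"
    by (subst integral_distr) (use Zm Dm \<phi>m in auto)
  also have "\<dots> = (\<integral>z. (\<integral>d. \<phi> z (d k) \<partial>distr M ?T ?D) \<partial>distr M ?P ?Z)"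
    using PZD.integral_fst'[OF int] unfolding pr by simp
  also have "\<dots> = (\<integral>w. (\<integral>d. \<phi> (?Z w) d \<partial>distr M borel (X h)) \<partial>M)"
    unfolding dk by (subst integral_distr[OF Zm]) auto
  finally have main: "(\<integral>w. \<phi> (?Z w) (grid_inc h k w) \<partial>M) = (\<integral>w. (\<integral>d. \<phi> (?Z w) d \<partial>distr M borel (X h)) \<partial>M)" .
  have Seq: "S (?Z w) i = x + X (real i * h) w" if "i \<le> k" "X 0 w = 0" for w i
  proof -
    have "(\<Sum>j<i. ?Z w j) = (\<Sum>j<i. grid_inc h j w)" using that(1) by (intro sum.cong) auto
    then show ?thesis using that(2) by (simp add: S_def sum_grid_inc)
  qed
  have Ieq: "I (?Z w) \<longleftrightarrow> grid_inside K x h k w" if "X 0 w = 0" for w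
    using Seq[OF _ that] by (auto simp: I_def grid_inside_def)
  have inner: "(\<integral>d. \<phi> z d \<partial>distr M borel (X h)) = (if I z then transition_semigroup M X h u (S z k) - u (S z k) else 0)" for z
  proof (cases "I z")
    case True
    interpret Ph: prob_space "distr M borel (X h)" by (rule prob_space_distr) (use h in auto)
    have "integrable (distr M borel (X h)) (\<lambda>d. u (S z k + d))"
      by (rule Ph.integrable_const_bound[where B=B]) (use B in auto)
    then show ?thesis using True Ph.prob_space by (simp add: \<phi>_def transition_semigroup_distr[OF u h])
  qed (simp add: \<phi>_def)
  have "(\<integral>w. (?inc w) \<partial>M)
    = (\<integral>w. \<phi> (?Z w) (grid_inc h k w) \<partial>M)"
  proof (rule integral_cong_AE)
    show "AE w in M. (?inc w) = \<phi> (?Z w) (grid_inc h k w)"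
    proof -
      have gk: "grid_inc h k w = X (real (Suc k) * h) w - X (real k * h) w" for w by (simp only: grid_inc_def)
      show ?thesis
        using start_zero by eventually_elim (simp add: \<phi>_def Ieq Seq gk del: of_nat_Suc)
    qed
  qed (use h in \<open>auto simp del: of_nat_Suc\<close>)
  also have "\<dots> = (\<integral>w. (if grid_inside K x h k w
        then transition_semigroup M X h u (x + X (real k * h) w) - u (x + X (real k * h) w) else 0) \<partial>M)"
    unfolding main inner
  proof (rule integral_cong_AE)
    note [measurable] = transition_semigroup_measurable[OF u h] grid_inside_measurable[OF K h, of x k]
    have [measurable]: "X (real k * h) \<in> borel_measurable M" using h by simp
    show "(\<lambda>w. if I (?Z w) then transition_semigroup M X h u (S (?Z w) k) - u (S (?Z w) k) else 0) \<in> borel_measurable M"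
    proof (rule measurable_compose[OF Zm])
      show "(\<lambda>z. if I z then transition_semigroup M X h u (S z k) - u (S z k) else 0) \<in> borel_measurable ?P"
        by measurable
    qed
    show "(\<lambda>w. if grid_inside K x h k w then transition_semigroup M X h u (x + X (real k * h) w) - u (x + X (real k * h) w) else 0)
        \<in> borel_measurable M"
      using h by measurable
    show "AE w in M. (if I (?Z w) then transition_semigroup M X h u (S (?Z w) k) - u (S (?Z w) k) else 0) =
      (if grid_inside K x h k w then transition_semigroup M X h u (x + X (real k * h) w) - u (x + X (real k * h) w) else 0)"
      using start_zero by eventually_elim (auto simp: Ieq Seq)
  qed
  finally show ?thesis .
qed

text \<open>
  A discrete Dynkin formula.  Taking expectations in the telescoping identity, each summand becomes
  the expectation of \<open>P h u - u\<close>, which is \<open>h g\<close> up to an error \<open>h e\<close>.  Only the values of \<open>g\<close> on \<open>K\<close> enter,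
  since the summand at time \<open>k\<close> is present only if the process is then in \<open>K\<close>.
\<close>

lemma dynkin_grid:
  assumes h: "0 < h" and K [measurable]: "K \<in> sets borel" and x: "x \<in> K"
    and u [measurable]: "u \<in> borel_measurable borel" and B: "\<And>y. \<bar>u y\<bar> \<le> B"
    and g [measurable]: "g \<in> borel_measurable borel" and G: "\<And>y. y \<in> K \<Longrightarrow> \<bar>g y\<bar> \<le> G"
    and off: "\<And>y. y \<notin> K \<Longrightarrow> \<bar>u y\<bar> \<le> \<kappa>" "0 \<le> \<kappa>"
    and gen: "\<And>y. y \<in> K \<Longrightarrow> \<bar>(transition_semigroup M X h u y - u y) / h - g y\<bar> \<le> e"
  shows "\<bar>(\<integral>w. (if grid_inside K x h n w then u (x + X (real n * h) w) else 0) \<partial>M) - u x -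
     (\<Sum>k<n. h * (\<integral>w. (if grid_inside K x h k w then g (x + X (real k * h) w) else 0) \<partial>M))\<bar> \<le> \<kappa> + real n * h * e"
proof -
  have h0: "0 \<le> h" using h by simp
  note [measurable] = X_measurable
  let ?Y = "\<lambda>k w. x + X (real k * h) w"
  let ?inc = "\<lambda>k w. if grid_inside K x h k w then u (?Y (Suc k) w) - u (?Y k w) else 0"
  let ?ind = "\<lambda>k w. if grid_inside K x h k w then g (?Y k w) else 0"
  let ?A = "\<lambda>k. \<integral>w. ?ind k w \<partial>M"
  let ?last = "\<lambda>w. if grid_inside K x h n w then u (?Y n w) else 0"
  have hk: "0 \<le> real k * h" for k using h0 by simp
  have [measurable]: "X (real k * h) \<in> borel_measurable M" for k using X_measurable[OF hk] .
  have [measurable]: "Measurable.pred M (grid_inside K x h k)" for k using h0 by measurable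
  note [measurable] = transition_semigroup_measurable[OF u h0]
  have iinc: "integrable M (?inc k)" for k
  proof (rule integrable_const_bound[where B="2 * B"])
    have "norm (?inc k w) \<le> 2 * B" for w
      using B[of "?Y (Suc k) w"] B[of "?Y k w"] by (auto simp del: of_nat_Suc)
    then show "AE w in M. norm (?inc k w) \<le> 2 * B" by (rule AE_I2)
  qed measurable
  have step: "\<bar>(\<integral>w. ?inc k w \<partial>M) - h * ?A k\<bar> \<le> h * e" for k
  proof -
    have G0: "0 \<le> G" using G[OF x] by linarith
    have ig: "integrable M (?ind k)"
      by (rule integrable_const_bound[where B=G]) (use G G0 in \<open>auto intro!: AE_I2 simp: grid_inside_def\<close>)
    have PB: "\<bar>transition_semigroup M X h u y\<bar> \<le> B" for y
    proof -
      have "integrable M (\<lambda>w. u (y + X h w))"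
        by (rule integrable_const_bound[where B=B]) (use h0 B in auto)
      then have "\<bar>\<integral>w. u (y + X h w) \<partial>M\<bar> \<le> (\<integral>w. B \<partial>M)"
        by (intro integral_abs_bound[THEN order_trans] integral_mono) (use B in auto)
      then show ?thesis using prob_space by (simp add: transition_semigroup_def)
    qed
    let ?q = "\<lambda>w. if grid_inside K x h k w then transition_semigroup M X h u (?Y k w) - u (?Y k w) else 0"
    have B0: "0 \<le> B" using B[of 0] by linarith
    have iq: "integrable M ?q"
    proof (rule integrable_const_bound[where B="2 * B"])
      show "AE w in M. norm (?q w) \<le> 2 * B"
      proof (rule AE_I2)
        show "norm (?q w) \<le> 2 * B" for w using PB[of "?Y k w"] B[of "?Y k w"] B0 by auto
      qed
    qed measurable
    have eq: "(\<integral>w. ?inc k w \<partial>M) - h * ?A k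
      = (\<integral>w. ?q w - h * (?ind k w) \<partial>M)"
      unfolding markov_grid_step[OF h0 K u B] using iq ig by simp
    have "\<bar>\<integral>w. ?q w - h * (?ind k w) \<partial>M\<bar> \<le> (\<integral>w. h * e \<partial>M)"
    proof (rule integral_abs_bound[THEN order_trans], rule integral_mono)
      show "integrable M (\<lambda>w. \<bar>?q w - h * (?ind k w)\<bar>)"
        using iq ig by simp
      have e: "0 \<le> e" using gen[OF x] by linarith
      show "\<bar>?q w - h * (?ind k w)\<bar> \<le> h * e" for w
      proof (cases "grid_inside K x h k w")
        case True
        then have "?Y k w \<in> K" by (auto simp: grid_inside_def)
        from gen[OF this] have "h * \<bar>(transition_semigroup M X h u (?Y k w) - u (?Y k w)) / h - g (?Y k w)\<bar> \<le> h * e"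
          using h by (intro mult_left_mono) auto
        moreover have "h * \<bar>(transition_semigroup M X h u (?Y k w) - u (?Y k w)) / h - g (?Y k w)\<bar>
          = \<bar>h * ((transition_semigroup M X h u (?Y k w) - u (?Y k w)) / h - g (?Y k w))\<bar>"
          using h by (simp add: abs_mult)
        moreover have "h * ((transition_semigroup M X h u (?Y k w) - u (?Y k w)) / h - g (?Y k w))
          = transition_semigroup M X h u (?Y k w) - u (?Y k w) - h * g (?Y k w)"
          using h by (simp add: field_simps)
        ultimately have "\<bar>transition_semigroup M X h u (?Y k w) - u (?Y k w) - h * g (?Y k w)\<bar> \<le> h * e" by (simp only:)
        then show ?thesis using True by simp
      qed (use h e in auto)
    qed simp
    also have "\<dots> = h * e" using prob_space by simp
    finally show ?thesis unfolding eq .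
  qed
  have iend: "integrable M (\<lambda>w. if grid_inside K x h n w then u (?Y n w) else 0)"
  proof (rule integrable_const_bound[where B=B])
    have B0: "0 \<le> B" using B[of 0] by linarith
    show "AE w in M. norm (?last w) \<le> B" using B B0 by auto
  qed measurable
  have "\<bar>(\<integral>w. (?last w) \<partial>M) - u x - (\<Sum>k<n. \<integral>w. ?inc k w \<partial>M)\<bar>
    = \<bar>\<integral>w. (?last w) - u x - (\<Sum>k<n. ?inc k w) \<partial>M\<bar>"
    using iend iinc prob_space by (simp del: of_nat_Suc)
  also have "\<dots> \<le> (\<integral>w. \<kappa> \<partial>M)"
  proof (rule integral_abs_bound[THEN order_trans], rule integral_mono_AE)
    show "integrable M (\<lambda>w. \<bar>(?last w) - u x - (\<Sum>k<n. ?inc k w)\<bar>)"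
      using iend iinc by (intro integrable_abs Bochner_Integration.integrable_diff Bochner_Integration.integrable_sum) auto
    show "AE w in M. \<bar>(?last w) - u x - (\<Sum>k<n. ?inc k w)\<bar> \<le> \<kappa>"
      using start_zero
    proof eventually_elim
      case (elim w)
      then show ?case
        using exit_telescope[of "\<lambda>i. ?Y i w" K u \<kappa> n] x off by (simp add: grid_inside_def del: of_nat_Suc)
    qed
  qed simp
  also have "\<dots> = \<kappa>" using prob_space by simp
  finally have 1: "\<bar>(\<integral>w. (?last w) \<partial>M) - u x - (\<Sum>k<n. \<integral>w. ?inc k w \<partial>M)\<bar> \<le> \<kappa>" .
  have "\<bar>(\<Sum>k<n. (\<integral>w. ?inc k w \<partial>M)) - (\<Sum>k<n. h * ?A k)\<bar>
    \<le> (\<Sum>k<n. h * e)"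
    unfolding sum_subtractf[symmetric] by (rule order_trans[OF sum_abs sum_mono[OF step]])
  also have "\<dots> = real n * h * e" by simp
  finally show ?thesis using 1 by linarith
qed

end

section \<open>Preliminaries on probability measures\<close>

lemma finite_large_atoms:
  fixes \<mu> :: "real measure"
  assumes "prob_space \<mu>" "sets \<mu> = sets borel" "0 < p"
  shows "finite {z. p \<le> measure \<mu> {z}}"
proof (rule ccontr)
  interpret prob_space \<mu> by fact
  assume inf: "infinite {z. p \<le> measure \<mu> {z}}"
  obtain n where n: "1 < real n * p" using assms(3) reals_Archimedean3 by blast
  obtain F where F: "F \<subseteq> {z. p \<le> measure \<mu> {z}}" "finite F" "card F = n"
    using infinite_arbitrarily_large[OF inf] by blast
  have "real n * p = (\<Sum>z\<in>F. p)" using F by simp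
  also have "\<dots> \<le> (\<Sum>z\<in>F. measure \<mu> {z})" using F(1) by (intro sum_mono) auto
  also have "\<dots> = measure \<mu> (\<Union>z\<in>F. {z})"
    by (intro finite_measure_finite_Union[symmetric]) (auto simp: F(2) assms(2) disjoint_family_on_def)
  also have "\<dots> \<le> 1" by (rule prob_le_1)
  finally show False using n by linarith
qed

text \<open>
  The distribution function is continuous with limits at both ends, hence uniformly continuous.
\<close>

lemma concentration_of_atomless:
  fixes \<mu> :: "real measure"
  assumes "prob_space \<mu>" "sets \<mu> = sets borel" "\<And>z. measure \<mu> {z} = 0" "0 < e"
  obtains \<delta> where "0 < \<delta>" "\<And>z. measure \<mu> {z - \<delta><..<z + \<delta>} \<le> e"
proof -
  interpret prob_space \<mu> by fact
  interpret real_distribution \<mu>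
    by unfold_locales (use assms(2) sets_eq_imp_space_eq[OF assms(2)] in auto)
  have "\<forall>\<^sub>F x in at_top. dist (cdf \<mu> x) 1 < e" using cdf_lim_at_top_prob assms(4) by (rule tendstoD)
  then obtain A1 where A1: "\<And>x. A1 \<le> x \<Longrightarrow> \<bar>cdf \<mu> x - 1\<bar> < e"
    by (auto simp: eventually_at_top_linorder dist_real_def)
  have "\<forall>\<^sub>F x in at_bot. dist (cdf \<mu> x) 0 < e" using cdf_lim_at_bot assms(4) by (rule tendstoD)
  then obtain A2 where A2: "\<And>x. x \<le> A2 \<Longrightarrow> \<bar>cdf \<mu> x\<bar> < e"
    by (auto simp: eventually_at_bot_linorder dist_real_def)
  have "continuous_on {A2 - 1..A1 + 1} (cdf \<mu>)"
    using assms(3) isCont_cdf by (intro continuous_at_imp_continuous_on) auto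
  then have "uniformly_continuous_on {A2 - 1..A1 + 1} (cdf \<mu>)"
    by (rule compact_uniformly_continuous) simp
  then obtain d where d: "0 < d" "\<And>x y. x \<in> {A2 - 1..A1 + 1} \<Longrightarrow> y \<in> {A2 - 1..A1 + 1} \<Longrightarrow> dist y x < d \<Longrightarrow> dist (cdf \<mu> y) (cdf \<mu> x) < e"
    using assms(4) unfolding uniformly_continuous_on_def by metis
  define \<delta> where "\<delta> = min (1/2) (d / 4)"
  have \<delta>: "0 < \<delta>" "2 * \<delta> \<le> 1" "2 * \<delta> < d" using d(1) by (auto simp: \<delta>_def min_def)
  have "measure \<mu> {z - \<delta><..<z + \<delta>} \<le> e" for z
  proof -
    have "measure \<mu> {z - \<delta><..<z + \<delta>} \<le> measure \<mu> {z - \<delta><..z + \<delta>}"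
      by (rule finite_measure_mono) (auto simp: assms(2))
    also have "\<dots> = cdf \<mu> (z + \<delta>) - cdf \<mu> (z - \<delta>)" using cdf_diff_eq[of "z - \<delta>" "z + \<delta>"] \<delta>(1) by simp
    also have "\<dots> \<le> e"
    proof -
      consider "z + \<delta> \<le> A2" | "A1 \<le> z - \<delta>" | "A2 < z + \<delta>" "z - \<delta> < A1" by linarith
      then show ?thesis
      proof cases
        case 1 then show ?thesis using A2[of "z + \<delta>"] cdf_nonneg[of "z - \<delta>"] by linarith
      next
        case 2 then show ?thesis using A1[of "z - \<delta>"] cdf_bounded_prob[of "z + \<delta>"] by linarith
      next
        case 3
        then have "dist (cdf \<mu> (z + \<delta>)) (cdf \<mu> (z - \<delta>)) < e"
          using \<delta> by (intro d(2)) (auto simp: dist_real_def)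
        then show ?thesis by (simp add: dist_real_def)
      qed
    qed
    finally show ?thesis .
  qed
  with \<delta>(1) show ?thesis by (rule that)
qed

lemma (in prob_space) AE_not_in_small_cover:
  assumes "\<And>e. 0 < e \<Longrightarrow> \<exists>A\<in>sets M. E \<subseteq> A \<and> prob A \<le> e"
  shows "AE w in M. w \<notin> E"
proof -
  have "\<exists>A\<in>sets M. E \<subseteq> A \<and> prob A \<le> 1 / real (Suc n)" for n by (rule assms) simp
  then obtain A where A: "\<And>n. A n \<in> sets M" "\<And>n. E \<subseteq> A n" "\<And>n. prob (A n) \<le> 1 / real (Suc n)"
    by metis
  have "prob (\<Inter>n. A n) \<le> 0"
  proof (rule LIMSEQ_le_const)
    show "(\<lambda>n. 1 / real (Suc n)) \<longlonglongrightarrow> 0" using LIMSEQ_inverse_real_of_nat by (simp add: inverse_eq_divide)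
    show "\<exists>N. \<forall>n\<ge>N. prob (\<Inter>n. A n) \<le> 1 / real (Suc n)"
      using A by (intro exI allI impI order_trans[OF finite_measure_mono A(3)]) auto
  qed
  then have "prob (\<Inter>n. A n) = 0" using measure_nonneg by (intro antisym) auto
  then have "AE w in M. w \<notin> (\<Inter>n. A n)" using A by (intro prob_eq_0[THEN iffD1]) auto
  then show ?thesis by eventually_elim (use A(2) in blast)
qed

context levy_process
begin

section \<open>Small times\<close>

text \<open>
  Unlike the Markov property on a grid, this one has a first step and a second step of unrelated lengths,
  and the function may depend on both the position and the increment.
\<close>

lemma markov_step:
  assumes s: "0 \<le> s" and h: "0 \<le> h"
    and \<phi> [measurable]: "(\<lambda>(x, d). \<phi> x d) \<in> borel_measurable (borel \<Otimes>\<^sub>M (borel :: real measure))"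
    and B: "\<And>x d. \<bar>\<phi> x d\<bar> \<le> (B :: real)"
  shows "(\<integral>w. \<phi> (X s w) (X (s + h) w - X s w) \<partial>M) = (\<integral>w. (\<integral>d. \<phi> (X s w) d \<partial>distr M borel (X h)) \<partial>M)"
proof -
  define ts where "ts i = (if i = 0 then 0 else if i = 1 then s else s + h)" for i :: nat
  let ?I = "\<lambda>i w. X (ts (Suc i)) w - X (ts i) w"
  have "indep_vars (\<lambda>_. borel) ?I {..<2}"
    by (rule indep_increments) (use s h in \<open>auto simp: ts_def\<close>)
  then have "indep_var (PiM {0} (\<lambda>_. borel)) (\<lambda>w. restrict (\<lambda>i. ?I i w) {0}) (PiM {1} (\<lambda>_. borel)) (\<lambda>w. restrict (\<lambda>i. ?I i w) {1})"
    by (rule indep_var_restrict) auto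
  then have "indep_var borel ((\<lambda>z. z 0) \<circ> (\<lambda>w. restrict (\<lambda>i. ?I i w) {0})) borel ((\<lambda>z. z 1) \<circ> (\<lambda>w. restrict (\<lambda>i. ?I i w) {1}))"
    by (rule indep_var_compose) auto
  then have ind: "indep_var borel (\<lambda>w. X s w - X 0 w) borel (\<lambda>w. X (s + h) w - X s w)"
    by (simp add: o_def ts_def)
  let ?A = "\<lambda>w. X s w - X 0 w" and ?D = "\<lambda>w. X (s + h) w - X s w"
  have m [measurable]: "X s \<in> borel_measurable M" "X (s + h) \<in> borel_measurable M" "X 0 \<in> borel_measurable M" "X h \<in> borel_measurable M"
    using s h by auto
  have pr: "distr M borel ?A \<Otimes>\<^sub>M distr M borel ?D = distr M (borel \<Otimes>\<^sub>M borel) (\<lambda>w. (?A w, ?D w))"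
    using ind by (auto simp: indep_var_distribution_eq)
  interpret PA: prob_space "distr M borel ?A" by (rule prob_space_distr) measurable
  interpret PD: prob_space "distr M borel ?D" by (rule prob_space_distr) measurable
  interpret PAD: pair_prob_space "distr M borel ?A" "distr M borel ?D" ..
  interpret Ph: prob_space "distr M borel (X h)" by (rule prob_space_distr) measurable
  have sets: "sets (distr M borel ?A \<Otimes>\<^sub>M distr M borel ?D) = sets (borel \<Otimes>\<^sub>M borel)"
    by (intro sets_pair_measure_cong) auto
  have int: "integrable (distr M borel ?A \<Otimes>\<^sub>M distr M borel ?D) (\<lambda>(x, d). \<phi> x d)"
    by (rule PAD.P.integrable_const_bound[where B=B])
      (use B \<phi> in \<open>auto simp: measurable_cong_sets[OF sets refl]\<close>)
  have dD: "distr M borel ?D = distr M borel (X h)" using stationary_increments[OF s h] .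
  have "(\<integral>w. \<phi> (X s w) (X (s + h) w - X s w) \<partial>M) = (\<integral>w. \<phi> (?A w) (?D w) \<partial>M)"
  proof (rule integral_cong_AE)
    show "AE w in M. \<phi> (X s w) (X (s + h) w - X s w) = \<phi> (?A w) (?D w)"
      using start_zero by eventually_elim simp
  qed measurable
  also have "\<dots> = (\<integral>p. (case p of (x, d) \<Rightarrow> \<phi> x d) \<partial>distr M (borel \<Otimes>\<^sub>M borel) (\<lambda>w. (?A w, ?D w)))"
    by (subst integral_distr) auto
  also have "\<dots> = (\<integral>x. (\<integral>d. \<phi> x d \<partial>distr M borel (X h)) \<partial>distr M borel ?A)"
    using PAD.integral_fst'[OF int, unfolded pr] unfolding dD by simp
  also have "\<dots> = (\<integral>w. (\<integral>d. \<phi> (?A w) d \<partial>distr M borel (X h)) \<partial>M)"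
    by (subst integral_distr) auto
  also have "\<dots> = (\<integral>w. (\<integral>d. \<phi> (X s w) d \<partial>distr M borel (X h)) \<partial>M)"
  proof (rule integral_cong_AE)
    show "AE w in M. (\<integral>d. \<phi> (?A w) d \<partial>distr M borel (X h)) = (\<integral>d. \<phi> (X s w) d \<partial>distr M borel (X h))"
      using start_zero by eventually_elim simp
  qed measurable
  finally show ?thesis .
qed

end

text \<open>
  The hypotheses on the process, collected so that the path properties below can be stated once.
\<close>

locale stable_process_with_generator = stable_levy_process M X \<alpha>
  for M :: "'w measure" and X :: "real \<Rightarrow> 'w \<Rightarrow> real" and \<alpha> +
  fixes a b c :: real
  assumes alpha: "1 < \<alpha>" "\<alpha> < 2"
    and bc: "0 \<le> b" "0 \<le> c" "\<not> (b = 0 \<and> c = 0)"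
    and generator: "\<And>f. f \<in> C02_line \<Longrightarrow>
      (f, stable_op \<alpha> a b c f) \<in> feller_generator UNIV (transition_semigroup M X)"
begin

lemma stable_op_C0: "f \<in> C02_line \<Longrightarrow> stable_op \<alpha> a b c f \<in> C0 UNIV"
  using generator by (auto simp: feller_generator_def)

text \<open>
  A maximal inequality, uniform in the mesh: apply the discrete Dynkin formula to a bump function that
  is \<open>1\<close> at \<open>0\<close> and vanishes off the neighbourhood.  Its expectation falls below \<open>1\<close> by at least the
  exit probability, and by at most a multiple of the elapsed time because the generator maps the bump to
  a bounded function.
\<close>

lemma grid_exit_bound:
  assumes d: "0 < d"
  obtains C t0 where "0 \<le> C" "0 < t0"
    "\<And>h n. 0 < h \<Longrightarrow> h < t0 \<Longrightarrow> prob {w \<in> space M. \<not> grid_inside {-d<..<d} 0 h n w} \<le> C * (real n * h)"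
proof -
  obtain u where u: "C2 u" "\<And>x. 0 \<le> u x" "\<And>x. u x \<le> 1" "\<And>x. x \<in> {-d/4..d/4} \<Longrightarrow> u x = 1"
    "\<And>x. x \<notin> {-d/2..d/2} \<Longrightarrow> u x = 0"
    using cutoff_exists[of "-d/2" "-d/4" "d/4" "d/2"] d by auto
  have uL: "u \<in> C02_line" using C2_compact_support_in_C02_line[OF u(1,5)] .
  let ?g = "stable_op \<alpha> a b c u"
  have g0: "?g \<in> C0 UNIV" by (rule stable_op_C0[OF uL])
  obtain G where G: "0 \<le> G" "\<And>x. \<bar>?g x\<bar> \<le> G" using C0_line_bounded[OF g0] by blast
  obtain t0 where t0: "0 < t0"
    "\<And>t x. 0 < t \<Longrightarrow> t < t0 \<Longrightarrow> x \<in> UNIV \<Longrightarrow> \<bar>(transition_semigroup M X t u x - u x) / t - ?g x\<bar> < 1"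
    using feller_generatorD[OF generator[OF uL], of 1] by auto
  have um: "u \<in> borel_measurable borel" using C2D(3)[OF u(1)] by (rule borel_measurable_continuous_onI)
  have gm: "?g \<in> borel_measurable borel" using g0 by (auto simp: C0_def intro: borel_measurable_continuous_onI)
  show ?thesis
  proof (rule that[of "G + 1" t0])
    fix h :: real and n :: nat assume h: "0 < h" "h < t0"
    let ?K = "{-d<..<d}"
    let ?I = "\<lambda>n w. grid_inside ?K 0 h n w"
    let ?A = "\<lambda>k. \<integral>w. (if ?I k w then ?g (0 + X (real k * h) w) else 0) \<partial>M"
    let ?E = "\<integral>w. (if ?I n w then u (0 + X (real n * h) w) else 0) \<partial>M"
    have [measurable]: "Measurable.pred M (grid_inside ?K 0 h n)" for n
      by (rule grid_inside_measurable) (use h in auto)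
    have hk: "0 \<le> real k * h" for k using h by simp
    have [measurable]: "X (real k * h) \<in> borel_measurable M" for k using X_measurable[OF hk] .
    have "\<bar>?E - u 0 -
     (\<Sum>k<n. h * ?A k)\<bar> \<le> 0 + real n * h * 1"
    proof (rule dynkin_grid[OF h(1) _ _ um _ gm G(2)])
      show "\<bar>u y\<bar> \<le> 1" for y using u(2,3)[of y] by simp
      show "\<bar>u y\<bar> \<le> 0" if "y \<notin> ?K" for y using u(5)[of y] that d by fastforce
      show "\<bar>(transition_semigroup M X h u y - u y) / h - ?g y\<bar> \<le> 1" for y using t0(2)[OF h, of y] by simp
    qed (use d in auto)
    moreover have "?E \<le> prob {w \<in> space M. ?I n w}"
    proof -
      have "?E \<le> (\<integral>w. indicator {w \<in> space M. ?I n w} w \<partial>M)"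
      proof (rule integral_mono)
        show "integrable M (\<lambda>w. if ?I n w then u (0 + X (real n * h) w) else 0)"
          by (rule integrable_const_bound[where B=1]) (use um u in \<open>auto intro!: AE_I2\<close>)
        show "integrable M (indicat_real {w \<in> space M. ?I n w})"
          by (intro integrable_real_indicator) (auto simp: emeasure_eq_measure)
      qed (use u in \<open>auto simp: indicator_def\<close>)
      then show ?thesis by (simp add: Int_def conj_commute)
    qed
    moreover have "\<bar>\<Sum>k<n. h * ?A k\<bar> \<le> real n * h * G"
    proof -
      have "\<bar>\<integral>w. (if ?I k w then ?g (0 + X (real k * h) w) else 0) \<partial>M\<bar> \<le> (\<integral>w. G \<partial>M)" for k
      proof (rule integral_abs_bound[THEN order_trans], rule integral_mono)
        show "integrable M (\<lambda>w. \<bar>if ?I k w then ?g (0 + X (real k * h) w) else 0\<bar>)"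
          by (intro integrable_abs integrable_const_bound[where B=G]) (use gm G in \<open>auto intro!: AE_I2\<close>)
      qed (use G in auto)
      then have "\<bar>h * ?A k\<bar> \<le> h * G" for k
        using h prob_space by (simp add: abs_mult)
      then have "\<bar>\<Sum>k<n. h * ?A k\<bar> \<le> (\<Sum>k<n. h * G)"
        by (intro order_trans[OF sum_abs sum_mono]) auto
      then show ?thesis by simp
    qed
    moreover have "u 0 = 1" using u(4)[of 0] d by simp
    ultimately have "1 - (real n * h + real n * h * G) \<le> prob {w \<in> space M. ?I n w}" by linarith
    moreover have "prob {w \<in> space M. \<not> ?I n w} = 1 - prob {w \<in> space M. ?I n w}"
      using prob_neg[of "?I n"] by simp
    ultimately show "prob {w \<in> space M. \<not> ?I n w} \<le> (G + 1) * (real n * h)" by (simp add: algebra_simps)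
  qed (use G t0 in auto)
qed

lemma large_increment_bound:
  assumes d: "0 < d"
  obtains C t0 where "0 \<le> C" "0 < t0" "\<And>h. 0 < h \<Longrightarrow> h < t0 \<Longrightarrow> prob {w \<in> space M. d \<le> \<bar>X h w\<bar>} \<le> C * h"
proof -
  obtain C t0 where C: "0 \<le> C" "0 < t0"
    "\<And>h n. 0 < h \<Longrightarrow> h < t0 \<Longrightarrow> prob {w \<in> space M. \<not> grid_inside {-d<..<d} 0 h n w} \<le> C * (real n * h)"
    using grid_exit_bound[OF d] by blast
  have "prob {w \<in> space M. d \<le> \<bar>X h w\<bar>} \<le> C * h" if h: "0 < h" "h < t0" for h
  proof -
    have "prob {w \<in> space M. d \<le> \<bar>X h w\<bar>} \<le> prob {w \<in> space M. \<not> grid_inside {-d<..<d} 0 h 1 w}"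
      by (rule finite_measure_mono) (use h in \<open>auto simp: grid_inside_def\<close>)
    also have "\<dots> \<le> C * (real 1 * h)" by (rule C(3)[OF h])
    finally show ?thesis by simp
  qed
  with C(1,2) show ?thesis by (rule that)
qed

section \<open>Absence of atoms\<close>

lemma scaled_law:
  assumes "0 < r"
  obtains d where "distr M borel (X r) = distr M borel (\<lambda>w. r powr (1 / \<alpha>) * X 1 w + d)"
  using stable[OF assms] by blast

lemma scaled_atom:
  assumes "0 < r"
  obtains d where "\<And>z. measure (distr M borel (X r)) {r powr (1 / \<alpha>) * z + d} = measure (distr M borel (X 1)) {z}"
proof -
  obtain d where d: "distr M borel (X r) = distr M borel (\<lambda>w. r powr (1 / \<alpha>) * X 1 w + d)"
    using scaled_law[OF assms] by blast
  have r: "0 < r powr (1 / \<alpha>)" using assms by simp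
  show ?thesis
  proof (rule that[of d])
    show "measure (distr M borel (X r)) {r powr (1 / \<alpha>) * z + d} = measure (distr M borel (X 1)) {z}" for z
      unfolding d using r by (auto simp: measure_distr intro!: arg_cong[where f=prob])
  qed
qed

text \<open>
  Were the process bounded by \<open>1/2\<close> at all small times, the semigroup would not notice a nonnegative
  test function that vanishes on \<open>[- 1/2, 1/2]\<close>, so the generator would annihilate it at \<open>0\<close>.  But there the
  generator is the integral of the function against the jump measure, which charges \<open>{1..2}\<close> or \<open>{-2..-1}\<close>.
\<close>

lemma not_locally_bounded:
  assumes "0 < t1"
  shows "\<exists>h. 0 < h \<and> h < t1 \<and> \<not> (AE w in M. \<bar>X h w\<bar> \<le> 1 / 2)"
proof (rule ccontr)
  assume "\<not> ?thesis"
  then have bounded: "AE w in M. \<bar>X h w\<bar> \<le> 1 / 2" if "0 < h" "h < t1" for h using that by blast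
  obtain k where k: "C2 k" "\<And>x. 0 \<le> k x" "\<And>x. k x \<le> 1" "\<And>x. x \<in> {1..4} \<Longrightarrow> k x = 1"
    "\<And>x. x \<notin> {1/2..9} \<Longrightarrow> k x = 0"
    using cutoff_exists[of "1/2" 1 4 9] by auto
  \<comment> \<open>an even function, so that it does not matter on which side the jumps are\<close>
  define v where "v x = k (x * x)" for x
  have C2v: "C2 v"
    unfolding v_def[abs_def] using C2_compose[OF k(1) C2_mult[OF C2_affine[of 1 0] C2_affine[of 1 0]]] by simp
  have near: "v x = 0" if "\<bar>x\<bar> \<le> 1/2" for x
  proof -
    have "\<bar>x\<bar> * \<bar>x\<bar> \<le> (1/2) * (1/2)" using that by (intro mult_mono) auto
    then show ?thesis unfolding v_def by (intro k(5)) (simp add: abs_mult_self_eq)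
  qed
  have off: "v x = 0" if "x \<notin> {-3..3}" for x
  proof -
    have "3 < \<bar>x\<bar>" using that by auto
    then have "3 * 3 < \<bar>x\<bar> * \<bar>x\<bar>" by (intro mult_strict_mono) auto
    then show ?thesis unfolding v_def by (intro k(5)) (simp add: abs_mult_self_eq)
  qed
  have one: "v x = 1" if "1 \<le> \<bar>x\<bar>" "\<bar>x\<bar> \<le> 2" for x
  proof -
    have "1 * 1 \<le> \<bar>x\<bar> * \<bar>x\<bar>" "\<bar>x\<bar> * \<bar>x\<bar> \<le> 2 * 2" using that by (intro mult_mono; simp)+
    then show ?thesis unfolding v_def by (intro k(4)) (simp add: abs_mult_self_eq)
  qed
  have [measurable]: "v \<in> borel_measurable borel" using C2D(3)[OF C2v] by (rule borel_measurable_continuous_onI)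
  have vL: "v \<in> C02_line" using C2_compact_support_in_C02_line[OF C2v off] .
  have "\<bar>stable_op \<alpha> a b c v 0\<bar> < e" if e: "0 < e" for e
  proof -
    obtain t0 where t0: "0 < t0"
      "\<And>t x. 0 < t \<Longrightarrow> t < t0 \<Longrightarrow> x \<in> UNIV \<Longrightarrow> \<bar>(transition_semigroup M X t v x - v x) / t - stable_op \<alpha> a b c v x\<bar> < e"
      using feller_generatorD[OF generator[OF vL] e] by blast
    define h where "h = min t0 t1 / 2"
    have h: "0 < h" "h < t0" "h < t1" using t0(1) assms by (auto simp: h_def)
    have "AE w in M. v (0 + X h w) = 0" using bounded[OF h(1,3)] by eventually_elim (simp add: near)
    then have "transition_semigroup M X h v 0 = 0" unfolding transition_semigroup_def by (rule integral_eq_zero_AE)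
    then show ?thesis using t0(2)[OF h(1,2), of 0] near[of 0] by simp
  qed
  then have L0: "stable_op \<alpha> a b c v 0 = 0" by (metis abs_ge_zero zero_less_abs_iff less_irrefl)
  have dv: "deriv v 0 = 0"
  proof (rule DERIV_imp_deriv)
    have "((\<lambda>x. 0) has_real_derivative 0) (at 0)" by simp
    then show "(v has_real_derivative 0) (at 0)"
      by (rule has_field_derivative_transform_within_open[where S="{-1/2<..<1/2}"]) (auto simp: near)
  qed
  have int: "integrable (jump_measure \<alpha> b c) (\<lambda>y. v (- y))"
  proof (rule Bochner_Integration.integrable_bound)
    show "integrable (jump_measure \<alpha> b c) (indicat_real {y. 1/2 \<le> \<bar>y\<bar>})"
      by (rule jump_measure_tail_finite[OF alpha bc(1,2)]) simp
    have "norm (v (- y)) \<le> norm (indicat_real {y. 1/2 \<le> \<bar>y\<bar>} y)" for y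
      using near[of "- y"] k(2)[of "y * y"] k(3)[of "y * y"] by (auto simp: indicator_def v_def)
    then show "AE y in jump_measure \<alpha> b c. norm (v (- y)) \<le> norm (indicat_real {y. 1/2 \<le> \<bar>y\<bar>} y)" by simp
  qed (simp add: jump_measure_eq)
  have "(\<integral>y. v (- y) \<partial>jump_measure \<alpha> b c) = 0"
    using L0 near[of 0] by (simp add: stable_op_def dv jump_integrand_def)
  then have "AE y in jump_measure \<alpha> b c. v (- y) = 0"
    using integral_nonneg_eq_0_iff_AE[OF int] k(2) by (simp add: v_def)
  then have AEz: "AE y in lborel. 0 < jump_density \<alpha> b c y \<longrightarrow> v (- y) = 0"
    unfolding jump_measure_eq by (simp add: AE_density)
  have K: "0 < \<alpha> * (\<alpha> - 1) / Gamma (2 - \<alpha>)" using alpha Gamma_pos[of \<alpha>] by simp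
  obtain p where p: "\<And>y. y \<in> {p..p + 1} \<Longrightarrow> 0 < jump_density \<alpha> b c y \<and> v (- y) = 1"
  proof (cases "b = 0")
    case False
    show ?thesis
    proof (rule that[of 1])
      show "0 < jump_density \<alpha> b c y \<and> v (- y) = 1" if "y \<in> {1..1 + 1}" for y
      proof
        show "0 < jump_density \<alpha> b c y" unfolding jump_density_def
          by (rule mult_pos_pos[OF K]) (use that False bc in \<open>auto simp: pos_powr_def\<close>)
        show "v (- y) = 1" using that one[of "- y"] by auto
      qed
    qed
  next
    case True
    show ?thesis
    proof (rule that[of "-2"])
      show "0 < jump_density \<alpha> b c y \<and> v (- y) = 1" if "y \<in> {-2..-2 + 1}" for y
      proof
        show "0 < jump_density \<alpha> b c y" unfolding jump_density_def
          by (rule mult_pos_pos[OF K]) (use that True bc in \<open>auto simp: pos_powr_def\<close>)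
        show "v (- y) = 1" using that one[of "- y"] by auto
      qed
    qed
  qed
  have "AE y in lborel. y \<notin> {p..p + 1}" using AEz by eventually_elim (use p in force)
  then have "emeasure lborel {p..p + 1} = 0" by (subst (asm) AE_iff_null_sets[symmetric]) auto
  then show False by simp
qed

text \<open>
  By stability the largest mass \<open>p\<close> of an atom is the same at all times, and \<open>X 2\<close> is the sum of two
  independent copies of \<open>X 1\<close>.  If \<open>y\<close> is an atom of \<open>X 2\<close> of mass \<open>p\<close>, then \<open>p\<close> is the average of the masses
  that the law of \<open>X 1\<close> gives to \<open>y - X 1\<close>; none of these exceeds \<open>p\<close>, so almost surely all of them equal \<open>p\<close>.
  Only finitely many points carry mass \<open>p > 0\<close>, so \<open>X 1\<close> takes finitely many values and is bounded.
  Scaling makes \<open>X h\<close> uniformly small for small \<open>h\<close>, up to a centring constant which must be small too because \<open>X h\<close>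
  is small with positive probability.  This contradicts the previous lemma.
\<close>

lemma no_atoms:
  assumes r: "0 < r"
  shows "measure (distr M borel (X r)) {z} = 0"
proof (rule ccontr)
  assume nz: "measure (distr M borel (X r)) {z} \<noteq> 0"
  let ?\<mu> = "distr M borel (X 1)"
  have m1 [measurable]: "X 1 \<in> borel_measurable M" "X 2 \<in> borel_measurable M" by auto
  interpret P1: prob_space ?\<mu> by (rule prob_space_distr) measurable
  obtain d where d: "\<And>z. measure (distr M borel (X r)) {r powr (1 / \<alpha>) * z + d} = measure ?\<mu> {z}"
    using scaled_atom[OF r] by blast
  define z0 where "z0 = (z - d) / r powr (1 / \<alpha>)"
  have "r powr (1 / \<alpha>) * z0 + d = z" using r by (simp add: z0_def)
  with d[of z0] nz have z0: "0 < measure ?\<mu> {z0}" using measure_nonneg[of ?\<mu> "{z0}"] by (simp add: less_le)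
  define S where "S = {z. measure ?\<mu> {z0} \<le> measure ?\<mu> {z}}"
  have fin: "finite {z. p \<le> measure ?\<mu> {z}}" if "0 < p" for p
    by (rule finite_large_atoms[OF P1.prob_space_axioms _ that]) simp
  have S: "finite S" "S \<noteq> {}" using fin[OF z0] by (auto simp: S_def)
  define p where "p = Max ((\<lambda>z. measure ?\<mu> {z}) ` S)"
  have "p \<in> (\<lambda>z. measure ?\<mu> {z}) ` S" unfolding p_def using S by (intro Max_in) auto
  then obtain z1 where z1: "z1 \<in> S" "p = measure ?\<mu> {z1}" by auto
  have p0: "0 < p" using z1 z0 by (auto simp: S_def)
  have pmax: "measure ?\<mu> {z} \<le> p" for z
  proof (cases "z \<in> S")
    case True then show ?thesis unfolding p_def using S by (intro Max_ge) auto
  next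
    case False then show ?thesis using z1 by (auto simp: S_def)
  qed
  obtain d2 where d2: "\<And>z. measure (distr M borel (X 2)) {2 powr (1 / \<alpha>) * z + d2} = measure ?\<mu> {z}"
    using scaled_atom[of 2] by auto
  define y where "y = 2 powr (1 / \<alpha>) * z1 + d2"
  have py: "measure (distr M borel (X 2)) {y} = p" using d2 z1 by (simp add: y_def)
  define q where "q z = measure ?\<mu> {y - z}" for z
  have qval: "(\<integral>d. indicat_real {y} (x + d) \<partial>?\<mu>) = q x" for x
  proof -
    have "(\<integral>d. indicat_real {y} (x + d) \<partial>?\<mu>) = (\<integral>d. indicat_real {y - x} d \<partial>?\<mu>)"
      by (intro Bochner_Integration.integral_cong) (auto simp: indicator_def)
    then show ?thesis by (simp add: q_def)
  qed
  have qm [measurable]: "q \<in> borel_measurable borel"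
  proof -
    have "(\<lambda>z. \<integral>d. indicat_real {y} (z + d) \<partial>?\<mu>) \<in> borel_measurable borel" by measurable
    then show ?thesis by (simp only: qval)
  qed
  have "(\<integral>w. indicat_real {y} (X 1 w + (X (1 + 1) w - X 1 w)) \<partial>M) = (\<integral>w. (\<integral>d. indicat_real {y} (X 1 w + d) \<partial>?\<mu>) \<partial>M)"
    by (rule markov_step[where B=1]) (auto simp: indicator_def)
  moreover have "(\<integral>w. indicat_real {y} (X 1 w + (X (1 + 1) w - X 1 w)) \<partial>M) = p"
  proof -
    have "(\<integral>w. indicat_real {y} (X 2 w) \<partial>M) = (\<integral>x. indicat_real {y} x \<partial>distr M borel (X 2))"
      by (subst integral_distr) auto
    then show ?thesis using py by simp
  qed
  ultimately have Eq: "(\<integral>w. q (X 1 w) \<partial>M) = p" by (simp add: qval)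
  have iq: "integrable M (\<lambda>w. q (X 1 w))"
  proof (rule integrable_const_bound[where B=1])
    show "AE w in M. norm (q (X 1 w)) \<le> 1" by (simp add: q_def)
  qed measurable
  have "(\<integral>w. p - q (X 1 w) \<partial>M) = 0" using Eq iq prob_space by simp
  then have "AE w in M. p - q (X 1 w) = 0"
    using integral_nonneg_eq_0_iff_AE[of M "\<lambda>w. p - q (X 1 w)"] iq pmax by (simp add: q_def)
  then have AET: "AE w in M. X 1 w \<in> (\<lambda>z. y - z) ` {z. p \<le> measure ?\<mu> {z}}"
  proof eventually_elim
    case (elim w)
    then have "p \<le> measure ?\<mu> {y - X 1 w}" by (simp add: q_def)
    then show ?case by (intro image_eqI[of _ _ "y - X 1 w"]) auto
  qed
  have "bounded ((\<lambda>z. y - z) ` {z. p \<le> measure ?\<mu> {z}})" using fin[OF p0] by (intro finite_imp_bounded) auto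
  then obtain K where K: "0 < K" "\<And>x. x \<in> (\<lambda>z. y - z) ` {z. p \<le> measure ?\<mu> {z}} \<Longrightarrow> \<bar>x\<bar> \<le> K"
    by (auto simp: bounded_pos)
  have AEK: "AE w in M. \<bar>X 1 w\<bar> \<le> K" using AET by eventually_elim (rule K(2))
  obtain C t0 where C: "0 \<le> C" "0 < t0" "\<And>h. 0 < h \<Longrightarrow> h < t0 \<Longrightarrow> prob {w \<in> space M. 1/8 \<le> \<bar>X h w\<bar>} \<le> C * h"
    using large_increment_bound[of "1/8"] by auto
  \<comment> \<open>the second bound keeps \<open>C h\<close> below \<open>1\<close>, the third keeps the scaled \<open>X 1\<close> below \<open>1/8\<close>\<close>
  define t1 where "t1 = Min {t0, 1 / (C + 1), (1 / (8 * K)) powr \<alpha>}"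
  have t1: "0 < t1" "t1 \<le> t0" "t1 \<le> 1 / (C + 1)" "t1 \<le> (1 / (8 * K)) powr \<alpha>" using C K by (auto simp: t1_def)
  have "AE w in M. \<bar>X h w\<bar> \<le> 1 / 2" if h: "0 < h" "h < t1" for h
  proof -
    have [measurable]: "X h \<in> borel_measurable M" using h by simp
    obtain e where e: "distr M borel (X h) = distr M borel (\<lambda>w. h powr (1 / \<alpha>) * X 1 w + e)"
      using scaled_law[OF h(1)] by blast
    have "h powr (1 / \<alpha>) \<le> ((1 / (8 * K)) powr \<alpha>) powr (1 / \<alpha>)"
      using h t1 alpha by (intro powr_mono2) auto
    also have "\<dots> = 1 / (8 * K)" using alpha K by (simp add: powr_powr)
    finally have hK: "h powr (1 / \<alpha>) * K \<le> 1 / 8" using K by (simp add: field_simps)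
    have "AE w in M. \<bar>(h powr (1 / \<alpha>) * X 1 w + e) - e\<bar> \<le> 1 / 8"
      using AEK
    proof eventually_elim
      case (elim w)
      have "h powr (1 / \<alpha>) * \<bar>X 1 w\<bar> \<le> h powr (1 / \<alpha>) * K" using elim by (intro mult_left_mono) auto
      then show ?case using hK by (simp add: abs_mult)
    qed
    then have "AE x in distr M borel (\<lambda>w. h powr (1 / \<alpha>) * X 1 w + e). \<bar>x - e\<bar> \<le> 1 / 8"
      by (subst AE_distr_iff) auto
    then have AEe: "AE w in M. \<bar>X h w - e\<bar> \<le> 1 / 8"
      unfolding e[symmetric] by (subst (asm) AE_distr_iff) auto
    have "prob {w \<in> space M. 1/8 \<le> \<bar>X h w\<bar>} \<le> C * h" using C(3) h t1 by simp
    also have "\<dots> \<le> C * (1 / (C + 1))" using h t1 C by (intro mult_left_mono) auto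
    also have "\<dots> < 1" using C by (simp add: field_simps)
    finally have "prob {w \<in> space M. 1/8 \<le> \<bar>X h w\<bar>} < 1" .
    have "\<bar>e\<bar> \<le> 1 / 4"
    proof (rule ccontr)
      assume big: "\<not> \<bar>e\<bar> \<le> 1 / 4"
      have "AE w in M. 1/8 \<le> \<bar>X h w\<bar>" using AEe by eventually_elim (use big in linarith)
      then have "prob {w \<in> space M. 1/8 \<le> \<bar>X h w\<bar>} = 1" by (intro prob_Collect_eq_1[THEN iffD2]) auto
      with \<open>prob _ < 1\<close> show False by simp
    qed
    with AEe show ?thesis by (elim AE_mp) (intro AE_I2 impI, linarith)
  qed
  then show False using not_locally_bounded[OF t1(1)] by blast
qed

text \<open>
  Adding an independent increment cannot make a law more concentrated, so the bound at time \<open>\<eta>\<close>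
  persists at all later times.
\<close>

lemma uniform_concentration:
  assumes "0 < \<eta>" "0 < e"
  obtains \<delta> where "0 < \<delta>" "\<And>s z. \<eta> \<le> s \<Longrightarrow> prob {w \<in> space M. \<bar>X s w - z\<bar> < \<delta>} \<le> e"
proof -
  let ?\<mu> = "distr M borel (X \<eta>)"
  have [measurable]: "X \<eta> \<in> borel_measurable M" using assms by simp
  interpret P: prob_space ?\<mu> by (rule prob_space_distr) measurable
  obtain \<delta> where \<delta>: "0 < \<delta>" "\<And>z. measure ?\<mu> {z - \<delta><..<z + \<delta>} \<le> e"
    using concentration_of_atomless[OF P.prob_space_axioms _ no_atoms[OF assms(1)] assms(2)] by auto
  have "prob {w \<in> space M. \<bar>X s w - z\<bar> < \<delta>} \<le> e" if s: "\<eta> \<le> s" for s z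
  proof -
    have [measurable]: "X s \<in> borel_measurable M" "X (s - \<eta>) \<in> borel_measurable M" using assms s by auto
    let ?J = "indicat_real {z - \<delta><..<z + \<delta>}"
    have "(\<integral>w. ?J (X (s - \<eta>) w + (X ((s - \<eta>) + \<eta>) w - X (s - \<eta>) w)) \<partial>M) = (\<integral>w. (\<integral>d. ?J (X (s - \<eta>) w + d) \<partial>?\<mu>) \<partial>M)"
      by (rule markov_step[where B=1]) (use assms s in \<open>auto simp: indicator_def\<close>)
    moreover have "(\<integral>d. ?J (x + d) \<partial>?\<mu>) \<le> e" for x
    proof -
      have "(\<integral>d. ?J (x + d) \<partial>?\<mu>) = (\<integral>d. indicat_real {(z - x) - \<delta><..<(z - x) + \<delta>} d \<partial>?\<mu>)"
        by (intro Bochner_Integration.integral_cong) (auto simp: indicator_def)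
      then show ?thesis using \<delta>(2)[of "z - x"] by simp
    qed
    then have "(\<integral>w. (\<integral>d. ?J (X (s - \<eta>) w + d) \<partial>?\<mu>) \<partial>M) \<le> (\<integral>w. e \<partial>M)"
      by (intro integral_mono_AE' AE_I2) (use assms in auto)
    moreover have "(\<integral>w. ?J (X s w) \<partial>M) = prob {w \<in> space M. \<bar>X s w - z\<bar> < \<delta>}"
    proof -
      have "(\<integral>w. ?J (X s w) \<partial>M) = (\<integral>w. indicator {w \<in> space M. \<bar>X s w - z\<bar> < \<delta>} w \<partial>M)"
        by (intro Bochner_Integration.integral_cong) (auto simp: indicator_def)
      then show ?thesis by (simp add: Int_def conj_commute)
    qed
    ultimately show ?thesis using prob_space by simp
  qed
  with \<delta>(1) show ?thesis by (rule that)
qed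

section \<open>No jump starts from a given level\<close>

text \<open>
  This takes the place of quasi-left-continuity.  A jump at time \<open>s\<close> starting from the level \<open>z\<close> is seen on
  every fine grid: at the last grid point before \<open>s\<close> the process is near \<open>z\<close>, and the next
  increment is large.  For a grid of mesh \<open>h\<close> each of the order of \<open>1 / h\<close> steps has this property with
  probability at most \<open>e' C h\<close>, by independence: \<open>C h\<close> bounds the probability of a large increment and \<open>e'\<close>, as small as desired,
  bounds that of being within \<open>\<delta>\<close> of \<open>z\<close>, since there are no atoms.  So the total is small uniformly in the mesh.
\<close>

lemma no_jump_from_level_window:
  fixes T :: nat and z \<eta> \<epsilon> :: real
  assumes \<eta>: "0 < \<eta>" and \<epsilon>: "0 < \<epsilon>"
  defines "E \<equiv> {w \<in> space M. \<exists>s. \<eta> < s \<and> s \<le> real T \<and> continuous (at_right s) (\<lambda>s. X s w) \<and>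
    ((\<lambda>s. X s w) \<longlongrightarrow> z) (at_left s) \<and> 2 * \<epsilon> < \<bar>X s w - z\<bar>}"
  shows "AE w in M. w \<notin> E"
proof (rule AE_not_in_small_cover)
  fix e :: real assume e: "0 < e"
  obtain C t0 where C: "0 \<le> C" "0 < t0" "\<And>h. 0 < h \<Longrightarrow> h < t0 \<Longrightarrow> prob {w \<in> space M. \<epsilon> \<le> \<bar>X h w\<bar>} \<le> C * h"
    using large_increment_bound[OF \<epsilon>] by blast
  define e' where "e' = e / (real T * C + 1)"
  have TC: "0 \<le> real T * C" using C by simp
  have e': "0 < e'" "real T * C * e' \<le> e"
    using e TC by (auto simp: e'_def field_simps)
  obtain \<delta> where \<delta>: "0 < \<delta>" "\<And>s z. \<eta> \<le> s \<Longrightarrow> prob {w \<in> space M. \<bar>X s w - z\<bar> < \<delta>} \<le> e'"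
    using uniform_concentration[OF \<eta> e'(1)] by blast
  define h where "h n = 1 / real (Suc n)" for n
  define I where "I n = {k. \<eta> \<le> real k * h n \<and> k < T * Suc n}" for n
  define A where "A n k = {w \<in> space M. \<bar>X (real k * h n) w - z\<bar> < \<delta> \<and> \<epsilon> < \<bar>X (real k * h n + h n) w - X (real k * h n) w\<bar>}" for n k
  define B where "B n = (\<Union>k\<in>I n. A n k)" for n
  define D where "D N = (\<Inter>n\<in>{N..}. B n)" for N
  have hp: "0 < h n" for n by (simp add: h_def)
  have Xm [measurable]: "X (real k * h n) \<in> borel_measurable M" "X (real k * h n + h n) \<in> borel_measurable M" for k n
    using hp[of n] by (auto intro!: random_variable_X add_nonneg_nonneg)
  have finI: "finite (I n)" "card (I n) \<le> T * Suc n" for n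
  proof -
    have "I n \<subseteq> {..<T * Suc n}" by (auto simp: I_def)
    then show "finite (I n)" "card (I n) \<le> T * Suc n"
      by (auto dest: finite_subset card_mono[rotated])
  qed
  have Am [measurable]: "A n k \<in> sets M" for n k unfolding A_def by measurable
  have Bm [measurable]: "B n \<in> sets M" for n unfolding B_def using finI by auto
  have Dm: "D N \<in> sets M" for N unfolding D_def by (intro sets.countable_INT') auto
  have pA: "prob (A n k) \<le> e' * (C * h n)" if k: "k \<in> I n" and n: "h n < t0" for n k
  proof -
    let ?s = "real k * h n"
    let ?f = "\<lambda>x d. indicat_real {x. \<bar>x - z\<bar> < \<delta>} x * indicat_real {d. \<epsilon> < \<bar>d\<bar>} d"
    have [measurable]: "X (h n) \<in> borel_measurable M" using hp[of n] by simp
    have "(\<integral>w. ?f (X ?s w) (X (?s + h n) w - X ?s w) \<partial>M) = (\<integral>w. (\<integral>d. ?f (X ?s w) d \<partial>distr M borel (X (h n))) \<partial>M)"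
      by (rule markov_step[where B=1]) (use hp[of n] in \<open>auto simp: indicator_def\<close>)
    also have "\<dots> = (\<integral>w. indicat_real {x. \<bar>x - z\<bar> < \<delta>} (X ?s w) \<partial>M) * measure (distr M borel (X (h n))) {d. \<epsilon> < \<bar>d\<bar>}"
      by simp
    also have "(\<integral>w. indicat_real {x. \<bar>x - z\<bar> < \<delta>} (X ?s w) \<partial>M) = prob {w \<in> space M. \<bar>X ?s w - z\<bar> < \<delta>}"
    proof -
      have "(\<integral>w. indicat_real {x. \<bar>x - z\<bar> < \<delta>} (X ?s w) \<partial>M) = (\<integral>w. indicator {w \<in> space M. \<bar>X ?s w - z\<bar> < \<delta>} w \<partial>M)"
        by (intro Bochner_Integration.integral_cong) (auto simp: indicator_def)
      then show ?thesis by (simp add: Int_def conj_commute)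
    qed
    also have "measure (distr M borel (X (h n))) {d. \<epsilon> < \<bar>d\<bar>} = prob {w \<in> space M. \<epsilon> < \<bar>X (h n) w\<bar>}"
      by (subst measure_distr) (auto intro!: arg_cong[where f=prob])
    also have "prob {w \<in> space M. \<bar>X ?s w - z\<bar> < \<delta>} * prob {w \<in> space M. \<epsilon> < \<bar>X (h n) w\<bar>} \<le> e' * (C * h n)"
    proof (rule mult_mono)
      show "prob {w \<in> space M. \<bar>X ?s w - z\<bar> < \<delta>} \<le> e'" using k by (intro \<delta>(2)) (simp add: I_def)
      have "prob {w \<in> space M. \<epsilon> < \<bar>X (h n) w\<bar>} \<le> prob {w \<in> space M. \<epsilon> \<le> \<bar>X (h n) w\<bar>}"
        by (rule finite_measure_mono) auto
      also have "\<dots> \<le> C * h n" by (rule C(3)[OF hp n])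
      finally show "prob {w \<in> space M. \<epsilon> < \<bar>X (h n) w\<bar>} \<le> C * h n" .
    qed (use e' in auto)
    also have "(\<integral>w. ?f (X ?s w) (X (?s + h n) w - X ?s w) \<partial>M) = prob (A n k)"
    proof -
      have "(\<integral>w. ?f (X ?s w) (X (?s + h n) w - X ?s w) \<partial>M) = (\<integral>w. indicator (A n k) w \<partial>M)"
        by (intro Bochner_Integration.integral_cong) (auto simp: indicator_def A_def)
      then show ?thesis using sets.sets_into_space[OF Am] by (simp add: Int_absorb2)
    qed
    finally show ?thesis .
  qed
  have pB: "prob (B n) \<le> e" if n: "h n < t0" for n
  proof -
    have "prob (B n) \<le> (\<Sum>k\<in>I n. prob (A n k))"
      unfolding B_def by (rule finite_measure_subadditive_finite) (use finI in auto)
    also have "\<dots> \<le> (\<Sum>k\<in>I n. e' * (C * h n))" by (intro sum_mono pA n)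
    also have "\<dots> = real (card (I n)) * (e' * (C * h n))" by simp
    also have "\<dots> \<le> real (T * Suc n) * (e' * (C * h n))"
      using finI(2)[of n] e' C hp[of n] by (intro mult_right_mono of_nat_mono) auto
    also have "\<dots> = real T * C * e' * (real (Suc n) * h n)" by (simp add: mult_ac del: of_nat_Suc mult_Suc_right)
    also have "real (Suc n) * h n = 1" by (simp add: h_def del: of_nat_Suc)
    finally show ?thesis using e' by simp
  qed
  obtain N0 where N0: "1 / real (Suc N0) < t0" using C(2) reals_Archimedean by (metis inverse_eq_divide)
  have hN: "h n < t0" if "N0 \<le> n" for n
  proof -
    have "h n \<le> 1 / real (Suc N0)" unfolding h_def using that by (intro divide_left_mono) auto
    then show ?thesis using N0 by simp
  qed
  have pD: "prob (D N) \<le> e" for N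
  proof -
    have "prob (D N) \<le> prob (B (max N N0))" by (rule finite_measure_mono) (auto simp: D_def)
    also have "\<dots> \<le> e" by (rule pB[OF hN]) simp
    finally show ?thesis .
  qed
  show "\<exists>A\<in>sets M. E \<subseteq> A \<and> prob A \<le> e"
  proof (intro bexI conjI)
    show U: "(\<Union>N. D N) \<in> sets M" using Dm by auto
    have "incseq D" by (rule incseq_SucI) (auto simp: D_def)
    then have "(\<lambda>N. prob (D N)) \<longlonglongrightarrow> prob (\<Union>N. D N)" using Dm by (intro finite_Lim_measure_incseq) auto
    then show "prob (\<Union>N. D N) \<le> e" by (rule LIMSEQ_le_const2) (use pD in auto)
    show "E \<subseteq> (\<Union>N. D N)"
    proof
      fix w assume "w \<in> E"
      then obtain s where w: "w \<in> space M" and s: "\<eta> < s" "s \<le> real T" and r: "continuous (at_right s) (\<lambda>s. X s w)"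
        and lft: "((\<lambda>s. X s w) \<longlongrightarrow> z) (at_left s)" and big: "2 * \<epsilon> < \<bar>X s w - z\<bar>" by (auto simp: E_def)
      have "\<forall>\<^sub>F u in at_left s. dist (X u w) z < min \<delta> (\<epsilon> / 2)" using lft by (rule tendstoD) (use \<delta> \<epsilon> in auto)
      then obtain l1 where l1: "l1 < s" "\<And>u. l1 < u \<Longrightarrow> u < s \<Longrightarrow> \<bar>X u w - z\<bar> < min \<delta> (\<epsilon> / 2)"
        unfolding eventually_at_left_field dist_real_def by blast
      have "((\<lambda>s. X s w) \<longlongrightarrow> X s w) (at_right s)" using r by (simp add: continuous_within)
      then have "\<forall>\<^sub>F u in at_right s. dist (X u w) (X s w) < \<epsilon> / 2" by (rule tendstoD) (use \<epsilon> in auto)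
      then obtain r1 where r1: "s < r1" "\<And>u. s < u \<Longrightarrow> u < r1 \<Longrightarrow> \<bar>X u w - X s w\<bar> < \<epsilon> / 2"
        unfolding eventually_at_right_field dist_real_def by blast
      define \<rho> where "\<rho> = min (min (s - l1) (r1 - s)) (s - \<eta>)"
      have "0 < \<rho>" using l1 r1 s by (simp add: \<rho>_def)
      then obtain N where N: "1 / real (Suc N) < \<rho>" using reals_Archimedean by (metis inverse_eq_divide)
      have "w \<in> B n" if n: "N \<le> n" for n
      proof -
        have "h n \<le> 1 / real (Suc N)" unfolding h_def using n by (intro divide_left_mono) auto
        then have hn: "h n < s - l1" "h n < r1 - s" "h n < s - \<eta>" using N by (auto simp: \<rho>_def)
        \<comment> \<open>the last grid point strictly before \<open>s\<close>\<close>
        define k where "k = nat (\<lceil>s * real (Suc n)\<rceil> - 1)"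
        have s0: "0 < s" using s \<eta> by linarith
        have "0 < s * real (Suc n)" using s0 by simp
        then have "1 \<le> \<lceil>s * real (Suc n)\<rceil>" by linarith
        then have kr: "real k = real_of_int \<lceil>s * real (Suc n)\<rceil> - 1" by (simp add: k_def)
        have "real k < s * real (Suc n)" "s * real (Suc n) \<le> real k + 1" unfolding kr by linarith+
        then have kh: "real k * h n < s" "s \<le> real k * h n + h n"
          by (auto simp: h_def field_simps)
        have "real k * h n < real T" using kh s by simp
        then have "real k < real (T * Suc n)" by (simp add: h_def field_simps)
        then have "k < T * Suc n" by (simp only: of_nat_less_iff)
        then have kI: "k \<in> I n" using kh hn by (simp add: I_def)
        have 1: "\<bar>X (real k * h n) w - z\<bar> < min \<delta> (\<epsilon> / 2)" using kh hn by (intro l1(2)) auto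
        have 2: "\<bar>X (real k * h n + h n) w - X s w\<bar> < \<epsilon> / 2"
        proof (cases "s = real k * h n + h n")
          case False then show ?thesis using kh hn by (intro r1(2)) auto
        qed (use \<epsilon> in simp)
        have "\<epsilon> < \<bar>X (real k * h n + h n) w - X (real k * h n) w\<bar>" using 1 2 big by linarith
        then have "w \<in> A n k" using 1 w by (simp add: A_def)
        then show ?thesis using kI by (auto simp: B_def)
      qed
      then show "w \<in> (\<Union>N. D N)" by (auto simp: D_def)
    qed
  qed
qed

lemma no_jump_from_level:
  "AE w in M. \<forall>s>0. ((\<lambda>s. X s w) \<longlongrightarrow> z) (at_left s) \<longrightarrow> X s w = z"
proof -
  have "AE w in M. \<forall>j. w \<notin> {w \<in> space M. \<exists>s. 1 / real (Suc j) < s \<and> s \<le> real (Suc j) \<and> continuous (at_right s) (\<lambda>s. X s w) \<and>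
    ((\<lambda>s. X s w) \<longlongrightarrow> z) (at_left s) \<and> 2 * (1 / real (Suc j)) < \<bar>X s w - z\<bar>}"
    unfolding AE_all_countable by (intro allI no_jump_from_level_window) auto
  with cadlag_paths AE_space show ?thesis
  proof eventually_elim
    case (elim w)
    show ?case
    proof (intro allI impI, rule ccontr)
      fix s assume s: "0 < s" "((\<lambda>s. X s w) \<longlongrightarrow> z) (at_left s)" "X s w \<noteq> z"
      define m where "m = min s (\<bar>X s w - z\<bar> / 2)"
      have "0 < m" using s by (simp add: m_def)
      obtain j1 where j1: "1 / real (Suc j1) < m" using \<open>0 < m\<close> reals_Archimedean by (metis inverse_eq_divide)
      obtain j2 where j2: "s < real j2" using reals_Archimedean2 by blast
      define j where "j = max j1 j2"
      have "1 / real (Suc j) \<le> 1 / real (Suc j1)" by (intro divide_left_mono) (auto simp: j_def)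
      then have "1 / real (Suc j) < s" "2 * (1 / real (Suc j)) < \<bar>X s w - z\<bar>" using j1 by (auto simp: m_def)
      moreover have "s \<le> real (Suc j)" using j2 by (simp add: j_def max_def)
      moreover have "continuous (at_right s) (\<lambda>s. X s w)" using elim s by auto
      ultimately show False using elim s by blast
    qed
  qed
qed

end

section \<open>Cutting off near the boundary\<close>

definition inner_interval :: "real \<Rightarrow> real \<Rightarrow> nat \<Rightarrow> real set" where
  "inner_interval l R m = {l + 1 / real (Suc m)..R - 1 / real (Suc m)}"

lemma inner_interval_sets [measurable]: "inner_interval l R m \<in> sets borel"
  by (simp add: inner_interval_def)

lemma inner_interval_mono: "m \<le> n \<Longrightarrow> inner_interval l R m \<subseteq> inner_interval l R n"
proof -
  assume "m \<le> n"
  then have "1 / real (Suc n) \<le> 1 / real (Suc m)" by (intro divide_left_mono) auto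
  then show ?thesis by (auto simp: inner_interval_def)
qed

lemma inner_interval_subset: "inner_interval l R m \<subseteq> {l<..<R}"
proof
  fix y assume "y \<in> inner_interval l R m"
  then have "l + 1 / real (Suc m) \<le> y" "y \<le> R - 1 / real (Suc m)" by (simp_all add: inner_interval_def)
  moreover have "0 < 1 / real (Suc m)" by simp
  ultimately have "l < y" "y < R" by linarith+
  then show "y \<in> {l<..<R}" by simp
qed

lemma eventually_inside_inner:
  assumes "l < y" "y < R"
  obtains m where "y \<in> {l + 1 / real (Suc m)<..<R - 1 / real (Suc m)}"
proof -
  have "0 < min (y - l) (R - y)" using assms by simp
  then obtain m where "1 / real (Suc m) < min (y - l) (R - y)" using reals_Archimedean by (metis inverse_eq_divide)
  then have "y \<in> {l + 1 / real (Suc m)<..<R - 1 / real (Suc m)}" by auto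
  then show ?thesis by (rule that)
qed

lemma small_off_inner:
  assumes "l < R" "f \<in> C0 {l<..<R}" "0 < e"
  obtains m0 where "\<And>m y. m0 \<le> m \<Longrightarrow> y \<notin> inner_interval l R m \<Longrightarrow> \<bar>zero_ext {l<..<R} f y\<bar> \<le> e"
proof -
  let ?F = "zero_ext {l<..<R} f"
  have c: "continuous_on {l..R} ?F" using continuous_zero_ext[OF assms(1,2)] continuous_on_subset by blast
  have "uniformly_continuous_on {l..R} ?F" using c by (rule compact_uniformly_continuous) simp
  then obtain d where d: "0 < d" "\<And>x y. x \<in> {l..R} \<Longrightarrow> y \<in> {l..R} \<Longrightarrow> dist y x < d \<Longrightarrow> dist (?F y) (?F x) < e"
    using assms(3) unfolding uniformly_continuous_on_def by metis
  obtain m0 where m0: "1 / real (Suc m0) < d" using d(1) reals_Archimedean by (metis inverse_eq_divide)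
  show ?thesis
  proof (rule that[of m0])
    fix m y assume m: "m0 \<le> m" and y: "y \<notin> inner_interval l R m"
    have md: "1 / real (Suc m) < d"
    proof -
      have "1 / real (Suc m) \<le> 1 / real (Suc m0)" using m by (intro divide_left_mono) auto
      then show ?thesis using m0 by linarith
    qed
    show "\<bar>?F y\<bar> \<le> e"
    proof (cases "y \<in> {l<..<R}")
      case True
      then consider "y < l + 1 / real (Suc m)" | "R - 1 / real (Suc m) < y"
        using y by (fastforce simp: inner_interval_def)
      then show ?thesis
      proof cases
        case 1
        then have "dist (?F y) (?F l) < e" using True md assms(1) by (intro d(2)) (auto simp: dist_real_def)
        then show ?thesis by (simp add: dist_real_def zero_ext_def)
      next
        case 2
        then have "dist (?F y) (?F R) < e" using True md assms(1) by (intro d(2)) (auto simp: dist_real_def)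
        then show ?thesis by (simp add: dist_real_def zero_ext_def)
      qed
    next
      case False then show ?thesis using assms(3) by (simp add: zero_ext_def del: greaterThanLessThan_iff)
    qed
  qed
qed

text \<open>
  Near the points of the inner interval the cutoff function \<open>u\<close> coincides with \<open>f\<close>, so the local terms of the
  operators agree there.  The jump integrals differ only through jumps longer than \<open>d\<close> that land where the
  cutoff acts, hence by at most \<open>\<kappa>\<close> times the finite mass of these jumps; and \<open>\<kappa>\<close> can be chosen after \<open>d\<close>, since \<open>f\<close> is small near the
  boundary.
\<close>

lemma cutoff_approximation:
  assumes p: "1 < \<alpha>" "\<alpha> < 2" "0 \<le> b" "0 \<le> c"
    and lR: "l < R" and f: "f \<in> C02 {l<..<R}" and e: "0 < e"
  obtains u where "u \<in> C02_line" "continuous_on UNIV u" "\<And>x. x \<in> inner_interval l R m \<Longrightarrow> u x = f x"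
    "\<And>x. \<bar>u x\<bar> \<le> \<bar>zero_ext {l<..<R} f x\<bar>"
    "\<And>x. x \<in> inner_interval l R m \<Longrightarrow> \<bar>stable_op \<alpha> a b c u x - stable_op_on {l<..<R} \<alpha> a b c f x\<bar> \<le> e"
proof -
  let ?\<Omega> = "{l<..<R}" let ?F = "zero_ext ?\<Omega> f" let ?J = "jump_measure \<alpha> b c"
  have f0: "f \<in> C0 ?\<Omega>" using f by (simp add: C02_def)
  define d where "d = 1 / real (Suc m) - 1 / real (Suc (Suc m))"
  have d: "0 < d" by (simp add: d_def frac_less2)
  define I where "I = (\<integral>y. indicat_real {y. d \<le> \<bar>y\<bar>} y \<partial>?J)"
  have iI: "integrable ?J (indicat_real {y. d \<le> \<bar>y\<bar>})" by (rule jump_measure_tail_finite[OF p d])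
  have I0: "0 \<le> I" unfolding I_def by simp
  define \<kappa> where "\<kappa> = e / (I + 1)"
  have \<kappa>: "0 < \<kappa>" "\<kappa> * I \<le> e" using e I0 by (auto simp: \<kappa>_def field_simps)
  obtain m0 where m0: "\<And>m y. m0 \<le> m \<Longrightarrow> y \<notin> inner_interval l R m \<Longrightarrow> \<bar>?F y\<bar> \<le> \<kappa>"
    using small_off_inner[OF lR f0 \<kappa>(1)] by blast
  define n where "n = max m0 (Suc m)"
  have n: "1 / real (Suc n) \<le> 1 / real (Suc (Suc m))" by (intro divide_left_mono) (auto simp: n_def)
  obtain \<psi> where \<psi>: "C2 \<psi>" "\<And>x. 0 \<le> \<psi> x" "\<And>x. \<psi> x \<le> 1" "\<And>x. x \<in> inner_interval l R n \<Longrightarrow> \<psi> x = 1"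
    "\<And>x. x \<notin> {l + 1 / (2 * real (Suc n))..R - 1 / (2 * real (Suc n))} \<Longrightarrow> \<psi> x = 0"
  proof (rule cutoff_exists[of "l + 1 / (2 * real (Suc n))" "l + 1 / real (Suc n)" "R - 1 / real (Suc n)" "R - 1 / (2 * real (Suc n))"])
  qed (auto simp: inner_interval_def divide_strict_left_mono)
  define u where "u x = \<psi> x * ?F x" for x
  have C2u: "C2 u" unfolding u_def[abs_def] by (rule C2_cutoff_mult[OF f \<psi>(1) \<psi>(5)]) auto
  have ueq: "u x = ?F x" if "x \<in> inner_interval l R n" for x using \<psi>(4)[OF that] by (simp add: u_def)
  have ule: "\<bar>u x\<bar> \<le> \<bar>?F x\<bar>" for x
    using \<psi>(2,3)[of x] by (simp add: u_def abs_mult mult_left_le_one_le)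
  have diff: "\<bar>u x - ?F x\<bar> \<le> \<kappa>" for x
  proof (cases "x \<in> inner_interval l R n")
    case False
    have "u x - ?F x = - ((1 - \<psi> x) * ?F x)" by (simp add: u_def algebra_simps)
    then have "\<bar>u x - ?F x\<bar> = (1 - \<psi> x) * \<bar>?F x\<bar>" using \<psi>(3)[of x] by (simp add: abs_mult)
    also have "\<dots> \<le> 1 * \<bar>?F x\<bar>" using \<psi>(2,3)[of x] by (intro mult_right_mono) auto
    finally show ?thesis using m0[OF _ False] by (simp add: n_def)
  qed (use ueq \<kappa> in simp)
  have mm: "inner_interval l R m \<subseteq> inner_interval l R n" by (rule inner_interval_mono) (simp add: n_def)
  show ?thesis
  proof (rule that[of u])
    show "u \<in> C02_line" by (rule C2_compact_support_in_C02_line[OF C2u, of "l + 1 / (2 * real (Suc n))" "R - 1 / (2 * real (Suc n))"])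
      (use \<psi>(5) in \<open>simp add: u_def\<close>)
    show "continuous_on UNIV u" by (rule C2D(3)[OF C2u])
    show "u x = f x" if "x \<in> inner_interval l R m" for x
      using ueq[OF subsetD[OF mm that]] subsetD[OF inner_interval_subset that] by (simp add: zero_ext_def)
    show "\<bar>u x\<bar> \<le> \<bar>?F x\<bar>" for x by (rule ule)
    show "\<bar>stable_op \<alpha> a b c u x - stable_op_on ?\<Omega> \<alpha> a b c f x\<bar> \<le> e" if x: "x \<in> inner_interval l R m" for x
    proof -
      have x\<Omega>: "x \<in> ?\<Omega>" using x inner_interval_subset by blast
      have near: "x - y \<in> inner_interval l R n" if "\<bar>y\<bar> < d" for y
        using x that n by (auto simp: inner_interval_def d_def abs_less_iff)
      have du: "deriv u x = deriv ?F x"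
      proof (rule DERIV_imp_deriv)
        have "(?F has_real_derivative deriv ?F x) (at x)"
          using C02_zero_extD(1,3)[OF f x\<Omega>] by simp
        then show "(u has_real_derivative deriv ?F x) (at x)"
        proof (rule has_field_derivative_transform_within_open[where S="{x - d<..<x + d}"])
          show "?F z = u z" if "z \<in> {x - d<..<x + d}" for z using near[of "x - z"] ueq[of z] that by auto
        qed (use d in auto)
      qed
      have ux: "u x = ?F x" using near[of 0] ueq d by simp
      define D where "D y = u (x - y) - ?F (x - y)" for y
      have J: "jump_integrand u x y = jump_integrand ?F x y + D y" for y
        by (simp add: jump_integrand_def du ux D_def)
      have cF: "continuous_on UNIV ?F" by (rule continuous_zero_ext[OF lR f0])
      have [measurable]: "?F \<in> borel_measurable borel" "u \<in> borel_measurable borel"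
        using cF C2D(3)[OF C2u] by (auto intro: borel_measurable_continuous_onI)
      have Db: "\<bar>D y\<bar> \<le> \<kappa> * indicator {y. d \<le> \<bar>y\<bar>} y" for y
        using near[of y] ueq[of "x - y"] diff[of "x - y"] \<kappa> by (auto simp: indicator_def D_def)
      have iD: "integrable ?J D"
      proof (rule Bochner_Integration.integrable_bound)
        show "integrable ?J (\<lambda>y. \<kappa> * indicat_real {y. d \<le> \<bar>y\<bar>} y)" using iI by simp
        show "D \<in> borel_measurable ?J" unfolding D_def[abs_def] jump_measure_eq by simp
        show "AE y in ?J. norm (D y) \<le> norm (\<kappa> * indicat_real {y. d \<le> \<bar>y\<bar>} y)"
          unfolding real_norm_def by (intro AE_I2 order_trans[OF Db abs_ge_self])
      qed
      have "stable_op \<alpha> a b c u x - stable_op_on ?\<Omega> \<alpha> a b c f x = (\<integral>y. D y \<partial>?J)"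
        using stable_op_on_fractional(1)[OF p lR f x\<Omega>] iD
        by (simp add: stable_op_on_def stable_op_def J du)
      also have "\<bar>\<integral>y. D y \<partial>?J\<bar> \<le> (\<integral>y. \<kappa> * indicat_real {y. d \<le> \<bar>y\<bar>} y \<partial>?J)"
        by (rule integral_abs_bound[THEN order_trans], rule integral_mono) (use iD iI Db in auto)
      also have "\<dots> = \<kappa> * I" by (simp add: I_def)
      finally show ?thesis using \<kappa>(2) by linarith
    qed
  qed
qed

context stable_process_with_generator
begin

section \<open>Survival is decided on dyadic grids\<close>

text \<open>
  A path in the open interval on a compact time interval keeps a positive distance from the boundary,
  provided that its left limits are not boundary points.  A left limit that is a boundary
  point would, by the absence of jumps from there, be the value of the path itself.
\<close>

lemma paths_stay_in_inner:
  assumes x: "l < x" "x < R" and t: "0 < t"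
    and X0: "X 0 w = 0"
    and right: "\<And>s. 0 \<le> s \<Longrightarrow> continuous (at_right s) (\<lambda>s. X s w)"
    and left: "\<And>s. 0 < s \<Longrightarrow> \<exists>y. ((\<lambda>s. X s w) \<longlongrightarrow> y) (at_left s)"
    and noj: "\<And>s z. 0 < s \<Longrightarrow> z \<in> {l - x, R - x} \<Longrightarrow> ((\<lambda>s. X s w) \<longlongrightarrow> z) (at_left s) \<Longrightarrow> X s w = z"
    and inside: "\<And>s. 0 < s \<Longrightarrow> s \<le> t \<Longrightarrow> x + X s w \<in> {l<..<R}"
  obtains m where "\<And>s. 0 \<le> s \<Longrightarrow> s \<le> t \<Longrightarrow> x + X s w \<in> inner_interval l R m"
proof -
  have ins: "x + X s w \<in> {l<..<R}" if "0 \<le> s" "s \<le> t" for s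
    using inside[of s] that x X0 by (cases "s = 0") auto
  have loc: "\<exists>U m. open U \<and> s \<in> U \<and> (\<forall>v\<in>U \<inter> {0..t}. x + X v w \<in> inner_interval l R m)" if s: "s \<in> {0..t}" for s
  proof -
    obtain m1 where m1: "x + X s w \<in> {l + 1 / real (Suc m1)<..<R - 1 / real (Suc m1)}"
      using eventually_inside_inner ins[of s] s by (metis atLeastAtMost_iff greaterThanLessThan_iff)
    have "((\<lambda>s. X s w) \<longlongrightarrow> X s w) (at_right s)" using right[of s] s by (simp add: continuous_within)
    then have "((\<lambda>s. x + X s w) \<longlongrightarrow> x + X s w) (at_right s)" by (intro tendsto_intros)
    then have "\<forall>\<^sub>F v in at_right s. x + X v w \<in> {l + 1 / real (Suc m1)<..<R - 1 / real (Suc m1)}"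
      using m1 by (intro topological_tendstoD) auto
    then obtain r where r: "s < r" "\<And>v. s < v \<Longrightarrow> v < r \<Longrightarrow> x + X v w \<in> {l + 1 / real (Suc m1)<..<R - 1 / real (Suc m1)}"
      unfolding eventually_at_right_field by blast
    have R1: "x + X v w \<in> inner_interval l R m1" if "s \<le> v" "v < r" for v
      using r(2)[of v] m1 that by (cases "v = s") (auto simp: inner_interval_def)
    show ?thesis
    proof (cases "s = 0")
      case True
      show ?thesis
        by (rule exI[of _ "{..<r}"], rule exI[of _ m1]) (use True r R1 in auto)
    next
      case False
      then have s0: "0 < s" using s by simp
      obtain y where y: "((\<lambda>s. X s w) \<longlongrightarrow> y) (at_left s)" using left[OF s0] by blast
      have ev: "\<forall>\<^sub>F v in at_left s. x + X v w \<in> {l<..<R}"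
        unfolding eventually_at_left_field
        by (rule exI[of _ 0]) (use s s0 ins in auto)
      have ty: "((\<lambda>s. x + X s w) \<longlongrightarrow> x + y) (at_left s)" using y by (intro tendsto_intros)
      have nt: "at_left s \<noteq> bot" by simp
      have "l \<le> x + y" by (rule tendsto_lowerbound[OF ty _ nt]) (use ev in \<open>eventually_elim, auto\<close>)
      moreover have "x + y \<le> R" by (rule tendsto_upperbound[OF ty _ nt]) (use ev in \<open>eventually_elim, auto\<close>)
      moreover have "y \<notin> {l - x, R - x}"
      proof
        assume yb: "y \<in> {l - x, R - x}"
        then have "X s w = y" using noj[OF s0 _ y] by blast
        then show False using yb ins[of s] s by auto
      qed
      ultimately have "l < x + y" "x + y < R" by auto
      then obtain m2 where m2: "x + y \<in> {l + 1 / real (Suc m2)<..<R - 1 / real (Suc m2)}"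
        using eventually_inside_inner by blast
      then have "\<forall>\<^sub>F v in at_left s. x + X v w \<in> {l + 1 / real (Suc m2)<..<R - 1 / real (Suc m2)}"
        using ty by (intro topological_tendstoD) auto
      then obtain l1 where l1: "l1 < s" "\<And>v. l1 < v \<Longrightarrow> v < s \<Longrightarrow> x + X v w \<in> {l + 1 / real (Suc m2)<..<R - 1 / real (Suc m2)}"
        unfolding eventually_at_left_field by blast
      have L1: "x + X v w \<in> inner_interval l R m2" if "l1 < v" "v < s" for v
        using l1(2)[of v] that by (auto simp: inner_interval_def)
      have "x + X v w \<in> inner_interval l R (max m1 m2)" if "l1 < v" "v < r" for v
        using L1[of v] R1[of v] that inner_interval_mono[of m1 "max m1 m2" l R] inner_interval_mono[of m2 "max m1 m2" l R]
        by (cases "v < s") auto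
      then show ?thesis
        by (intro exI[of _ "{l1<..<r}"] exI[of _ "max m1 m2"]) (use l1 r in auto)
    qed
  qed
  then obtain U m where U: "\<And>s. s \<in> {0..t} \<Longrightarrow> open (U s) \<and> s \<in> U s \<and> (\<forall>v\<in>U s \<inter> {0..t}. x + X v w \<in> inner_interval l R (m s))"
    by metis
  obtain C where C: "C \<subseteq> {0..t}" "finite C" "{0..t} \<subseteq> (\<Union>s\<in>C. U s)"
    using compactE_image[of "{0..t}" "{0..t}" U] U by (metis UN_I compact_Icc subsetI)
  show ?thesis
  proof (rule that[of "Max (m ` C)"])
    fix s assume s: "0 \<le> s" "s \<le> t"
    then obtain v where v: "v \<in> C" "s \<in> U v" using C(3) by fastforce
    then have "x + X s w \<in> inner_interval l R (m v)" using U[of v] C(1) s by auto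
    moreover have "m v \<le> Max (m ` C)" using C(2) v by (intro Max_ge) auto
    ultimately show "x + X s w \<in> inner_interval l R (Max (m ` C))" using inner_interval_mono by blast
  qed
qed

lemma dyadic_grid_inside_imp:
  assumes t: "0 < t" and K: "closed K" and right: "\<And>s. 0 \<le> s \<Longrightarrow> continuous (at_right s) (\<lambda>s. X s w)"
    and grid: "\<And>j. grid_inside K x (t / 2 ^ j) (2 ^ j) w" and s: "0 \<le> s" "s \<le> t"
  shows "x + X s w \<in> K"
proof (rule ccontr)
  assume out: "x + X s w \<notin> K"
  have "((\<lambda>s. X s w) \<longlongrightarrow> X s w) (at_right s)" using right[OF s(1)] by (simp add: continuous_within)
  then have "((\<lambda>s. x + X s w) \<longlongrightarrow> x + X s w) (at_right s)" by (intro tendsto_intros)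
  then have "\<forall>\<^sub>F v in at_right s. x + X v w \<in> - K"
    using out K by (intro topological_tendstoD) auto
  then obtain r where r: "s < r" "\<And>v. s < v \<Longrightarrow> v < r \<Longrightarrow> x + X v w \<notin> K"
    unfolding eventually_at_right_field by auto
  obtain j where j: "(1/2) ^ j < (r - s) / t" using real_arch_pow_inv[of "(r - s) / t" "1/2"] r t by auto
  \<comment> \<open>the first point of the \<open>j\<close>-th grid at or after \<open>s\<close>\<close>
  define i where "i = nat \<lceil>s * 2 ^ j / t\<rceil>"
  have "0 \<le> s * 2 ^ j / t" using s t by simp
  then have ir: "real i = real_of_int \<lceil>s * 2 ^ j / t\<rceil>" by (simp add: i_def)
  have b: "s * 2 ^ j / t \<le> real i" "real i < s * 2 ^ j / t + 1" unfolding ir by linarith+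
  have le: "s \<le> real i * (t / 2 ^ j)" using b(1) t by (simp add: field_simps)
  have "real i * (t / 2 ^ j) < (s * 2 ^ j / t + 1) * (t / 2 ^ j)" using b(2) t by (intro mult_strict_right_mono) auto
  also have "\<dots> = s + t * (1/2) ^ j" using t by (simp add: field_simps power_divide)
  also have "\<dots> < r" using j t by (simp add: field_simps)
  finally have less: "real i * (t / 2 ^ j) < r" .
  have "s * 2 ^ j / t \<le> 2 ^ j" using s t by (simp add: field_simps)
  then have "\<lceil>s * 2 ^ j / t\<rceil> \<le> 2 ^ j" by (simp add: ceiling_le_iff)
  then have "i \<le> 2 ^ j" by (simp add: i_def nat_le_iff)
  then have "x + X (real i * (t / 2 ^ j)) w \<in> K" using grid[of j] by (auto simp: grid_inside_def)
  moreover have "x + X (real i * (t / 2 ^ j)) w \<notin> K"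
    using r(2)[of "real i * (t / 2 ^ j)"] le less out by (cases "s = real i * (t / 2 ^ j)") auto
  ultimately show False by contradiction
qed

text \<open>
  The right-hand side is built from countably many measurable events; in particular survival up to a
  given time is measurable up to a null set.
\<close>

lemma survival_iff_grid:
  assumes x: "l < x" "x < R" and t: "0 < t"
  shows "AE w in M. ereal t < exit_time X {l<..<R} x w \<longleftrightarrow>
    (\<exists>m. \<forall>j. grid_inside (inner_interval l R m) x (t / 2 ^ j) (2 ^ j) w)"
  using cadlag_paths start_zero no_jump_from_level[of "l - x"] no_jump_from_level[of "R - x"]
proof eventually_elim
  case (elim w)
  have right: "continuous (at_right s) (\<lambda>s. X s w)" if "0 \<le> s" for s using elim(1) that by blast
  show ?case
  proof
    assume less: "ereal t < exit_time X {l<..<R} x w"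
    have "x + X s w \<in> {l<..<R}" if "0 < s" "s \<le> t" for s
    proof (rule ccontr)
      assume "x + X s w \<notin> {l<..<R}"
      then have "exit_time X {l<..<R} x w \<le> ereal s" unfolding exit_time_def using that by (intro Inf_lower) auto
      then show False using less that by (meson ereal_less_eq(3) leD order_trans)
    qed
    then obtain m where "\<And>s. 0 \<le> s \<Longrightarrow> s \<le> t \<Longrightarrow> x + X s w \<in> inner_interval l R m"
      using paths_stay_in_inner[OF x t, of w] elim by blast
    then have "grid_inside (inner_interval l R m) x (t / 2 ^ j) (2 ^ j) w" for j
      unfolding grid_inside_def
    proof (intro allI impI)
      fix i :: nat assume i: "i \<le> 2 ^ j"
      then have "real i \<le> 2 ^ j" by (metis of_nat_le_iff of_nat_numeral of_nat_power)
      then have "real i * (t / 2 ^ j) \<le> 2 ^ j * (t / 2 ^ j)" using t by (intro mult_right_mono) auto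
      then show "x + X (real i * (t / 2 ^ j)) w \<in> inner_interval l R m"
        using \<open>\<And>s. 0 \<le> s \<Longrightarrow> s \<le> t \<Longrightarrow> x + X s w \<in> inner_interval l R m\<close> t by simp
    qed
    then show "\<exists>m. \<forall>j. grid_inside (inner_interval l R m) x (t / 2 ^ j) (2 ^ j) w" by blast
  next
    assume "\<exists>m. \<forall>j. grid_inside (inner_interval l R m) x (t / 2 ^ j) (2 ^ j) w"
    then obtain m where m: "\<And>j. grid_inside (inner_interval l R m) x (t / 2 ^ j) (2 ^ j) w" by blast
    have ins: "x + X s w \<in> {l<..<R}" if "0 \<le> s" "s \<le> t" for s
      using dyadic_grid_inside_imp[OF t _ right m that] inner_interval_subset[of l R m] by (auto simp: inner_interval_def)
    have "((\<lambda>s. X s w) \<longlongrightarrow> X t w) (at_right t)" using right[of t] t by (simp add: continuous_within)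
    then have "((\<lambda>s. x + X s w) \<longlongrightarrow> x + X t w) (at_right t)" by (intro tendsto_intros)
    then have "\<forall>\<^sub>F v in at_right t. x + X v w \<in> {l<..<R}"
      using ins[of t] t by (intro topological_tendstoD) auto
    then obtain r where r: "t < r" "\<And>v. t < v \<Longrightarrow> v < r \<Longrightarrow> x + X v w \<in> {l<..<R}"
      unfolding eventually_at_right_field by blast
    have "ereal r \<le> exit_time X {l<..<R} x w"
      unfolding exit_time_def
    proof (rule Inf_greatest)
      fix q assume "q \<in> {ereal s |s. 0 < s \<and> x + X s w \<notin> {l<..<R}}"
      then obtain s where s: "q = ereal s" "0 < s" "x + X s w \<notin> {l<..<R}" by blast
      then have "\<not> s < r" using ins[of s] r(2)[of s] by (cases "s \<le> t") auto
      then show "ereal r \<le> q" using s by simp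
    qed
    moreover have "ereal t < ereal r" using r by simp
    ultimately show "ereal t < exit_time X {l<..<R} x w" by (rule less_le_trans[rotated])
  qed
qed

end

section \<open>The generator of the killed process\<close>

lemma measurable_completion_AE_eq:
  fixes g k :: "'a \<Rightarrow> real"
  assumes g: "g \<in> borel_measurable M" and eq: "AE w in M. k w = g w"
  shows "k \<in> borel_measurable (completion M)"
proof (rule borel_measurableI)
  fix A :: "real set" assume "open A"
  have gA: "Measurable.pred (completion M) (\<lambda>w. g w \<in> A)"
    using measurable_completion[OF g] \<open>open A\<close> by (intro pred_sets2[of A borel]) auto
  have n1: "Measurable.pred (completion M) (\<lambda>w. k w \<noteq> g w)"
    by (rule sets_completion_AE) (use eq in auto)
  have n2: "Measurable.pred (completion M) (\<lambda>w. k w \<in> A \<and> k w \<noteq> g w)"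
    by (rule sets_completion_AE) (use eq in \<open>eventually_elim, auto\<close>)
  have "{w \<in> space (completion M). g w \<in> A} - {w \<in> space (completion M). k w \<noteq> g w} \<union>
      {w \<in> space (completion M). k w \<in> A \<and> k w \<noteq> g w} \<in> sets (completion M)"
    by (intro sets.Un sets.Diff predE gA n1 n2)
  moreover have "k -` A \<inter> space (completion M) = {w \<in> space (completion M). g w \<in> A} - {w \<in> space (completion M). k w \<noteq> g w} \<union>
      {w \<in> space (completion M). k w \<in> A \<and> k w \<noteq> g w}" by auto
  ultimately show "k -` A \<inter> space (completion M) \<in> sets (completion M)" by simp
qed

context stable_process_with_generator
begin

lemma killed_semigroup_eq:
  assumes lR: "l < R" and f: "f \<in> C0 {l<..<R}" and x: "x \<in> {l<..<R}" and t: "0 < t"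
  shows "killed_semigroup M X {l<..<R} t f x =
    (\<integral>w. (if \<exists>m. \<forall>j. grid_inside (inner_interval l R m) x (t / 2 ^ j) (2 ^ j) w
       then zero_ext {l<..<R} f (x + X t w) else 0) \<partial>M)"
proof -
  let ?\<Omega> = "{l<..<R}" let ?F = "zero_ext ?\<Omega> f"
  let ?S = "\<lambda>w. \<exists>m. \<forall>j. grid_inside (inner_interval l R m) x (t / 2 ^ j) (2 ^ j) w"
  let ?k = "\<lambda>w. case killed_process X ?\<Omega> x t w of None \<Rightarrow> 0 | Some y \<Rightarrow> f y"
  let ?g = "\<lambda>w. if ?S w then ?F (x + X t w) else 0"
  have [measurable]: "?F \<in> borel_measurable borel"
    using continuous_zero_ext[OF lR f] by (rule borel_measurable_continuous_onI)
  have [measurable]: "Measurable.pred M (grid_inside (inner_interval l R m) x (t / 2 ^ j) n)" for m j n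
    by (rule grid_inside_measurable) (use t in auto)
  have [measurable]: "X t \<in> borel_measurable M" using t by simp
  have gm: "?g \<in> borel_measurable M" by measurable
  have eq: "AE w in M. ?k w = ?g w"
  proof -
    have "AE w in M. ereal t < exit_time X ?\<Omega> x w \<longleftrightarrow> ?S w"
      by (rule survival_iff_grid) (use x t in auto)
    then show ?thesis
    proof (elim AE_mp, intro AE_I2 impI)
      fix w assume iff: "ereal t < exit_time X ?\<Omega> x w \<longleftrightarrow> ?S w"
      show "?k w = ?g w"
      proof (cases "?S w")
        case True
        then obtain m where m: "grid_inside (inner_interval l R m) x (t / 2 ^ 0) (2 ^ 0) w" by blast
        then have "x + X t w \<in> inner_interval l R m" by (auto simp: grid_inside_def)
        then have "x + X t w \<in> ?\<Omega>" using inner_interval_subset by blast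
        then show ?thesis using iff True by (simp add: killed_process_def zero_ext_def)
      next
        case False
        then have "\<not> ereal t < exit_time X ?\<Omega> x w" using iff by blast
        with False show ?thesis by (simp only: killed_process_def if_False option.case)
      qed
    qed
  qed
  have "killed_semigroup M X ?\<Omega> t f x = (\<integral>w. ?g w \<partial>completion M)"
    unfolding killed_semigroup_def
    by (rule integral_cong_AE[OF measurable_completion_AE_eq[OF gm eq] measurable_completion[OF gm] AE_completion[OF eq]])
  also have "\<dots> = (\<integral>w. ?g w \<partial>M)" by (rule integral_completion[OF gm])
  finally show ?thesis .
qed

lemma grid_inside_refine:
  assumes "grid_inside K x (t / 2 ^ Suc j) (2 ^ Suc j) w"
  shows "grid_inside K x (t / 2 ^ j) (2 ^ j) w"
  unfolding grid_inside_def
proof (intro allI impI)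
  fix i :: nat assume "i \<le> 2 ^ j"
  then have "2 * i \<le> 2 ^ Suc j" by simp
  then have "x + X (real (2 * i) * (t / 2 ^ Suc j)) w \<in> K" using assms unfolding grid_inside_def by blast
  moreover have "real (2 * i) * (t / 2 ^ Suc j) = real i * (t / 2 ^ j)" by (simp add: field_simps)
  ultimately show "x + X (real i * (t / 2 ^ j)) w \<in> K" by (simp only:)
qed

text \<open>
  Survival on the dyadic grids decreases as the grids are refined, and increases with the inner interval.
\<close>

lemma tendsto_survival_integral:
  fixes F :: "real \<Rightarrow> real"
  assumes F [measurable]: "F \<in> borel_measurable borel" and B: "\<And>y. \<bar>F y\<bar> \<le> B" and t: "0 < t"
  shows "(\<lambda>j. \<integral>w. (if grid_inside (inner_interval l R m) x (t / 2 ^ j) (2 ^ j) w then F (x + X t w) else 0) \<partial>M)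
      \<longlonglongrightarrow> (\<integral>w. (if \<forall>j. grid_inside (inner_interval l R m) x (t / 2 ^ j) (2 ^ j) w then F (x + X t w) else 0) \<partial>M)"
    and "(\<lambda>m. \<integral>w. (if \<forall>j. grid_inside (inner_interval l R m) x (t / 2 ^ j) (2 ^ j) w then F (x + X t w) else 0) \<partial>M)
      \<longlonglongrightarrow> (\<integral>w. (if \<exists>m. \<forall>j. grid_inside (inner_interval l R m) x (t / 2 ^ j) (2 ^ j) w then F (x + X t w) else 0) \<partial>M)"
proof -
  let ?I = "\<lambda>m j w. grid_inside (inner_interval l R m) x (t / 2 ^ j) (2 ^ j) w"
  have [measurable]: "Measurable.pred M (?I m j)" for m j
    by (rule grid_inside_measurable) (use t in auto)
  have [measurable]: "X t \<in> borel_measurable M" using t by simp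
  have B0: "0 \<le> B" using B[of 0] by linarith
  show "(\<lambda>j. \<integral>w. (if ?I m j w then F (x + X t w) else 0) \<partial>M)
      \<longlonglongrightarrow> (\<integral>w. (if \<forall>j. ?I m j w then F (x + X t w) else 0) \<partial>M)"
  proof (rule integral_dominated_convergence[where w="\<lambda>_. B"])
    show "AE w in M. (\<lambda>j. if ?I m j w then F (x + X t w) else 0) \<longlonglongrightarrow> (if \<forall>j. ?I m j w then F (x + X t w) else 0)"
    proof (rule AE_I2)
      fix w
      show "(\<lambda>j. if ?I m j w then F (x + X t w) else 0) \<longlonglongrightarrow> (if \<forall>j. ?I m j w then F (x + X t w) else 0)"
      proof (cases "\<forall>j. ?I m j w")
        case False
        then obtain j0 where j0: "\<not> ?I m j0 w" by blast
        have "\<not> ?I m j w" if "j0 \<le> j" for j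
          using that
        proof (induction j rule: dec_induct)
          case (step j) then show ?case using grid_inside_refine by blast
        qed (rule j0)
        then have "\<forall>\<^sub>F j in sequentially. (if ?I m j w then F (x + X t w) else 0) = 0"
          unfolding eventually_sequentially by auto
        then have "(\<lambda>j. if ?I m j w then F (x + X t w) else 0) \<longlonglongrightarrow> 0" by (rule tendsto_eventually)
        then show ?thesis using False by simp
      qed simp
    qed
    have "norm (if ?I m j w then F (x + X t w) else 0) \<le> B" for j w using B[of "x + X t w"] B0 by auto
    then show "AE w in M. norm (if ?I m j w then F (x + X t w) else 0) \<le> B" for j by (intro AE_I2)
  qed simp_all
  show "(\<lambda>m. \<integral>w. (if \<forall>j. ?I m j w then F (x + X t w) else 0) \<partial>M)
      \<longlonglongrightarrow> (\<integral>w. (if \<exists>m. \<forall>j. ?I m j w then F (x + X t w) else 0) \<partial>M)"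
  proof (rule integral_dominated_convergence[where w="\<lambda>_. B"])
    show "AE w in M. (\<lambda>m. if \<forall>j. ?I m j w then F (x + X t w) else 0) \<longlonglongrightarrow> (if \<exists>m. \<forall>j. ?I m j w then F (x + X t w) else 0)"
    proof (rule AE_I2)
      fix w
      show "(\<lambda>m. if \<forall>j. ?I m j w then F (x + X t w) else 0) \<longlonglongrightarrow> (if \<exists>m. \<forall>j. ?I m j w then F (x + X t w) else 0)"
      proof (cases "\<exists>m. \<forall>j. ?I m j w")
        case True
        then obtain m0 where m0: "\<And>j. ?I m0 j w" by blast
        have "?I m j w" if "m0 \<le> m" for m j
          using m0[of j] inner_interval_mono[OF that, of l R] by (auto simp: grid_inside_def)
        then have "\<forall>\<^sub>F m in sequentially. (if \<forall>j. ?I m j w then F (x + X t w) else 0) = F (x + X t w)"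
          unfolding eventually_sequentially by auto
        then have "(\<lambda>m. if \<forall>j. ?I m j w then F (x + X t w) else 0) \<longlonglongrightarrow> F (x + X t w)" by (rule tendsto_eventually)
        then show ?thesis using True by simp
      next
        case False
        then have "\<not> (\<forall>j. ?I m j w)" for m by blast
        with False show ?thesis by (simp only: if_False tendsto_const)
      qed
    qed
    have "norm (if \<forall>j. ?I m j w then F (x + X t w) else 0) \<le> B" for m w using B[of "x + X t w"] B0 by auto
    then show "AE w in M. norm (if \<forall>j. ?I m j w then F (x + X t w) else 0) \<le> B" for m by (intro AE_I2)
  qed simp_all
qed

text \<open>
  Strong continuity of the killed semigroup on \<open>C0\<close>, at the level of grids and uniformly in the starting
  point.  If the process has moved less than \<open>\<delta> / 2\<close>, either it has survived and \<open>g\<close> has changed little, or it has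
  come within \<open>\<delta> / 2\<close> of the boundary; in the latter case the starting point is within \<open>\<delta>\<close> of the boundary, where
  \<open>g\<close> is small anyway.  The maximal inequality takes care of larger moves.
\<close>

lemma killed_time_average:
  assumes lR: "l < R" and g: "g \<in> C0 {l<..<R}" and e: "0 < e"
  obtains t0 m0 where "0 < t0"
    "\<And>x m h k. x \<in> {l<..<R} \<Longrightarrow> m0 \<le> m \<Longrightarrow> 0 < h \<Longrightarrow> h < t0 \<Longrightarrow> real k * h < t0 \<Longrightarrow>
      \<bar>(\<integral>w. (if grid_inside (inner_interval l R m) x h k w then zero_ext {l<..<R} g (x + X (real k * h) w) else 0) \<partial>M) - g x\<bar> \<le> e"
proof -
  let ?G = "zero_ext {l<..<R} g"
  have cG: "continuous_on UNIV ?G" by (rule continuous_zero_ext[OF lR g])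
  have [measurable]: "?G \<in> borel_measurable borel" using cG by (rule borel_measurable_continuous_onI)
  have off: "?G y = 0" if "y \<notin> {l..R}" for y using zero_ext_off[OF that] .
  obtain B where B: "0 \<le> B" "\<And>y. \<bar>?G y\<bar> \<le> B" using bounded_of_compact_support[OF cG off] by blast
  have "uniformly_continuous_on {l - 1..R + 1} ?G"
    by (rule compact_uniformly_continuous) (auto intro: continuous_on_subset[OF cG])
  then obtain d where d: "0 < d" "\<And>x y. x \<in> {l - 1..R + 1} \<Longrightarrow> y \<in> {l - 1..R + 1} \<Longrightarrow> dist y x < d \<Longrightarrow> dist (?G y) (?G x) < e / 2"
    using e unfolding uniformly_continuous_on_def by (metis half_gt_zero)
  define \<delta> where "\<delta> = min d 1"
  have \<delta>: "0 < \<delta>" "\<delta> \<le> 1" "\<delta> \<le> d" using d(1) by (auto simp: \<delta>_def)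
  have osc: "\<bar>?G y - ?G x\<bar> < e / 2" if "x \<in> {l<..<R}" "\<bar>y - x\<bar> < \<delta>" for x y
    using d(2)[of x y] that \<delta> by (auto simp: dist_real_def abs_less_iff)
  obtain C t0 where C: "0 \<le> C" "0 < t0"
    "\<And>h n. 0 < h \<Longrightarrow> h < t0 \<Longrightarrow> prob {w \<in> space M. \<not> grid_inside {-(\<delta>/2)<..<\<delta>/2} 0 h n w} \<le> C * (real n * h)"
    using grid_exit_bound[of "\<delta> / 2"] \<delta>(1) by auto
  define t1 where "t1 = min t0 (e / (4 * (B * C + 1)))"
  have BC: "0 \<le> B * C" using B(1) C(1) by simp
  have t1: "0 < t1" "t1 \<le> t0" using C(2) e BC by (auto simp: t1_def)
  have t1': "2 * B * (C * t1) \<le> e / 2"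
  proof -
    have "t1 \<le> e / (4 * (B * C + 1))" by (simp add: t1_def)
    then have "t1 * (4 * (B * C + 1)) \<le> e" using BC by (simp add: pos_le_divide_eq)
    then show ?thesis using t1(1) by (simp add: algebra_simps)
  qed
  obtain m0 where m0: "1 / real (Suc m0) < \<delta> / 2" using reals_Archimedean[of "\<delta> / 2"] \<delta>(1) by (auto simp: inverse_eq_divide)
  show ?thesis
  proof (rule that[of t1 m0])
    fix x h :: real and m k :: nat
    assume x: "x \<in> {l<..<R}" and m: "m0 \<le> m" and h: "0 < h" "h < t1" and kh: "real k * h < t1"
    let ?K = "inner_interval l R m"
    let ?near = "\<lambda>w. grid_inside {-(\<delta>/2)<..<\<delta>/2} 0 h k w"
    let ?v = "\<lambda>w. if grid_inside ?K x h k w then ?G (x + X (real k * h) w) else 0"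
    have [measurable]: "Measurable.pred M (grid_inside ?K x h k)" "Measurable.pred M (grid_inside {-(\<delta>/2)<..<\<delta>/2} 0 h k)"
      by (rule grid_inside_measurable; use h in auto)+
    have [measurable]: "X (real k * h) \<in> borel_measurable M" using h by simp
    have "1 / real (Suc m) \<le> 1 / real (Suc m0)" using m by (intro divide_left_mono) auto
    then have m': "1 / real (Suc m) < \<delta> / 2" using m0 by linarith
    have pw: "\<bar>?v w - g x\<bar> \<le> e / 2 + 2 * B * indicator {w \<in> space M. \<not> ?near w} w" if w: "w \<in> space M" for w
    proof -
      have gx: "g x = ?G x" using x by (simp add: zero_ext_def)
      show ?thesis
      proof (cases "?near w")
        case False
        have "\<bar>?v w\<bar> \<le> B" using B by simp
        then show ?thesis using False B(2)[of x] w e by (simp add: gx)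
      next
        case near: True
        have small: "\<bar>X (real i * h) w\<bar> < \<delta> / 2" if "i \<le> k" for i
          using near that by (auto simp: grid_inside_def abs_less_iff)
        show ?thesis
        proof (cases "grid_inside ?K x h k w")
          case True
          have "\<bar>?G (x + X (real k * h) w) - ?G x\<bar> < e / 2" using small[of k] \<delta>(1) by (intro osc x) auto
          then show ?thesis using True near by (simp add: gx)
        next
          case False
          then obtain i where i: "i \<le> k" "x + X (real i * h) w \<notin> ?K" by (auto simp: grid_inside_def)
          \<comment> \<open>the boundary point next to the exit point\<close>
          define y where "y = (if x + X (real i * h) w < l + 1 / real (Suc m) then l else R)"
          have "\<bar>y - x\<bar> < \<delta>" using small[OF i(1)] i(2) m' x by (auto simp: y_def inner_interval_def abs_less_iff)
          then have "\<bar>?G y - ?G x\<bar> < e / 2" by (rule osc[OF x])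
          moreover have "?G y = 0" by (auto simp: y_def zero_ext_def)
          ultimately show ?thesis using False near by (simp add: gx)
        qed
      qed
    qed
    have iv: "integrable M ?v" by (rule integrable_const_bound[where B=B]) (use B in auto)
    have "\<bar>(\<integral>w. ?v w \<partial>M) - g x\<bar> = \<bar>\<integral>w. ?v w - g x \<partial>M\<bar>" using iv prob_space by simp
    also have "\<dots> \<le> (\<integral>w. e / 2 + 2 * B * indicator {w \<in> space M. \<not> ?near w} w \<partial>M)"
    proof (rule integral_abs_bound[THEN order_trans], rule integral_mono)
      show "integrable M (\<lambda>w. e / 2 + 2 * B * indicator {w \<in> space M. \<not> ?near w} w)"
        by (intro Bochner_Integration.integrable_add integrable_mult_right integrable_real_indicator)
          (auto simp: emeasure_eq_measure)
    qed (use iv pw in auto)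
    also have "\<dots> = e / 2 + 2 * B * prob {w \<in> space M. \<not> ?near w}"
    proof -
      have "integrable M (\<lambda>w. 2 * B * indicat_real {w \<in> space M. \<not> ?near w} w)"
        by (intro integrable_mult_right integrable_real_indicator) (auto simp: emeasure_eq_measure)
      then show ?thesis using prob_space by (simp add: Int_def conj_commute)
    qed
    also have "\<dots> \<le> e / 2 + 2 * B * (C * t1)"
    proof -
      have "prob {w \<in> space M. \<not> ?near w} \<le> C * (real k * h)" using h t1 by (intro C(3)) auto
      also have "\<dots> \<le> C * t1" using kh C(1) by (intro mult_left_mono) auto
      finally show ?thesis using B(1) by (intro add_left_mono mult_left_mono) auto
    qed
    also have "\<dots> \<le> e" using t1' by simp
    finally show "\<bar>(\<integral>w. ?v w \<partial>M) - g x\<bar> \<le> e" .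
  qed (rule t1(1))
qed

text \<open>
  For a fixed inner interval and a fixed grid, the discrete Dynkin formula is applied to the cutoff
  approximation of \<open>f\<close>; the integrand differs little from its initial value by the previous lemma.  Then
  the grid is refined, and finally the inner interval exhausts the whole one.  The term \<open>\<kappa>\<close>, the size of \<open>f\<close>
  where the process may stop, disappears only in this last limit, for fixed \<open>t\<close>, while the error \<open>3 e t\<close>
  is uniform in \<open>x\<close>.
\<close>

lemma killed_increment_estimate:
  assumes lR: "l < R" and f: "f \<in> C02 {l<..<R}"
    and g: "stable_op_on {l<..<R} \<alpha> a b c f \<in> C0 {l<..<R}" and e: "0 < e"
  obtains t0 where "0 < t0" "\<And>x t. x \<in> {l<..<R} \<Longrightarrow> 0 < t \<Longrightarrow> t < t0 \<Longrightarrow>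
    \<bar>killed_semigroup M X {l<..<R} t f x - f x - t * stable_op_on {l<..<R} \<alpha> a b c f x\<bar> \<le> 3 * e * t"
proof -
  let ?\<Omega> = "{l<..<R}" let ?F = "zero_ext ?\<Omega> f"
  define g where "g = stable_op_on ?\<Omega> \<alpha> a b c f"
  let ?G = "zero_ext ?\<Omega> g"
  have gC: "g \<in> C0 ?\<Omega>" using g by (simp add: g_def)
  have fC: "f \<in> C0 ?\<Omega>" using f by (simp add: C02_def)
  have cF: "continuous_on UNIV ?F" and cG: "continuous_on UNIV ?G"
    using continuous_zero_ext[OF lR] fC gC by auto
  have Fm [measurable]: "?F \<in> borel_measurable borel" and Gm [measurable]: "?G \<in> borel_measurable borel"
    using cF cG by (auto intro: borel_measurable_continuous_onI)
  obtain BF where BF: "0 \<le> BF" "\<And>y. \<bar>?F y\<bar> \<le> BF" using bounded_of_compact_support[OF cF zero_ext_off] by blast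
  obtain BG where BG: "0 \<le> BG" "\<And>y. \<bar>?G y\<bar> \<le> BG" using bounded_of_compact_support[OF cG zero_ext_off] by blast
  obtain t0 m0 where t0: "0 < t0" and avg: "\<And>x m h k. x \<in> ?\<Omega> \<Longrightarrow> m0 \<le> m \<Longrightarrow> 0 < h \<Longrightarrow> h < t0 \<Longrightarrow> real k * h < t0 \<Longrightarrow>
      \<bar>(\<integral>w. (if grid_inside (inner_interval l R m) x h k w then ?G (x + X (real k * h) w) else 0) \<partial>M) - g x\<bar> \<le> e"
    using killed_time_average[OF lR gC e] by blast
  show ?thesis
  proof (rule that[OF t0])
    fix x t :: real assume x: "x \<in> ?\<Omega>" and t: "0 < t" "t < t0"
    let ?I = "\<lambda>m j w. grid_inside (inner_interval l R m) x (t / 2 ^ j) (2 ^ j) w"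
    let ?V = "\<lambda>m j. \<integral>w. (if ?I m j w then ?F (x + X t w) else 0) \<partial>M"
    let ?V_all = "\<lambda>m. \<integral>w. (if \<forall>j. ?I m j w then ?F (x + X t w) else 0) \<partial>M"
    have grid: "\<bar>?V m j - f x - t * g x\<bar> \<le> \<kappa> + 3 * e * t"
      if m: "m0 \<le> m" and xm: "x \<in> inner_interval l R m"
        and \<kappa>: "\<And>y. y \<notin> inner_interval l R m \<Longrightarrow> \<bar>?F y\<bar> \<le> \<kappa>" "0 \<le> \<kappa>"
        and u: "u \<in> C02_line" "continuous_on UNIV u" "\<And>x. x \<in> inner_interval l R m \<Longrightarrow> u x = f x"
          "\<And>x. \<bar>u x\<bar> \<le> \<bar>?F x\<bar>"
          "\<And>x. x \<in> inner_interval l R m \<Longrightarrow> \<bar>stable_op \<alpha> a b c u x - g x\<bar> \<le> e"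
        and tu: "\<And>t x. 0 < t \<Longrightarrow> t < tu \<Longrightarrow> \<bar>(transition_semigroup M X t u x - u x) / t - stable_op \<alpha> a b c u x\<bar> < e"
        and j: "t / 2 ^ j < tu"
      for m j \<kappa> u tu
    proof -
      let ?K = "inner_interval l R m"
      define h where "h = t / 2 ^ j"
      let ?A = "\<lambda>k. \<integral>w. (if grid_inside ?K x h k w then ?G (x + X (real k * h) w) else 0) \<partial>M"
      define n :: nat where "n = 2 ^ j"
      have h: "0 < h" "h < tu" "real n * h = t" "h < t0"
      proof -
        show "0 < h" "h < tu" "real n * h = t" using t j by (simp_all add: h_def n_def)
        have "t / 2 ^ j \<le> t / 1" using t by (intro divide_left_mono) auto
        then show "h < t0" using t by (simp add: h_def)
      qed
      have um: "u \<in> borel_measurable borel" using u(2) by (rule borel_measurable_continuous_onI)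
      have K\<Omega>: "?K \<subseteq> ?\<Omega>" by (rule inner_interval_subset)
      have D: "\<bar>(\<integral>w. (if grid_inside ?K x h n w then u (x + X (real n * h) w) else 0) \<partial>M) - u x -
        (\<Sum>k<n. h * ?A k)\<bar> \<le> \<kappa> + real n * h * (2 * e)"
      proof (rule dynkin_grid[OF h(1) _ xm um _ Gm BG(2) _ \<kappa>(2)])
        show "\<bar>u y\<bar> \<le> BF" for y using u(4)[of y] BF(2)[of y] by linarith
        show "\<bar>u y\<bar> \<le> \<kappa>" if "y \<notin> ?K" for y using u(4)[of y] \<kappa>(1)[OF that] by linarith
        show "\<bar>(transition_semigroup M X h u y - u y) / h - ?G y\<bar> \<le> 2 * e" if y: "y \<in> ?K" for y
        proof -
          have "?G y = g y" using y K\<Omega> by (auto simp: zero_ext_def)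
          then show ?thesis using tu[OF h(1,2), of y] u(5)[OF y] by linarith
        qed
      qed simp
      have ux: "u x = f x" by (rule u(3)[OF xm])
      have end_eq: "(\<integral>w. (if grid_inside ?K x h n w then u (x + X (real n * h) w) else 0) \<partial>M) =
        ?V m j"
      proof (rule Bochner_Integration.integral_cong)
        fix w
        have "u (x + X t w) = ?F (x + X t w)" if "?I m j w"
        proof -
          have "x + X (real n * h) w \<in> ?K" using that by (auto simp: grid_inside_def h_def n_def)
          then have "x + X t w \<in> ?K" using h(3) by simp
          then show ?thesis using u(3) K\<Omega> by (auto simp: zero_ext_def)
        qed
        then show "(if grid_inside ?K x h n w then u (x + X (real n * h) w) else 0) = (if ?I m j w then ?F (x + X t w) else 0)"
          using h(3) by (auto simp: h_def n_def)
      qed simp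
      have S: "\<bar>(\<Sum>k<n. h * ?A k) - (\<Sum>k<n. h * g x)\<bar>
        \<le> (\<Sum>k<n. h * e)"
        unfolding sum_subtractf[symmetric]
      proof (rule order_trans[OF sum_abs sum_mono])
        fix k assume k: "k \<in> {..<n}"
        then have "real k * h \<le> real n * h" using h by (intro mult_right_mono) auto
        then have "real k * h < t0" using h(3) t by simp
        from avg[OF x m h(1,4) this]
        show "\<bar>h * ?A k - h * g x\<bar> \<le> h * e"
          using h(1) by (simp add: right_diff_distrib[symmetric] abs_mult)
      qed
      have c: "(\<Sum>k<n. h * g x) = t * g x" "(\<Sum>k<n. h * e) = e * t" "real n * h * (2 * e) = 2 * e * t"
        using h(3) by (simp_all add: mult.commute)
      have tri: "\<bar>A - y - z\<bar> \<le> \<kappa> + 3 * e * t"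
        if "\<bar>A - y - S\<bar> \<le> \<kappa> + 2 * e * t" "\<bar>S - z\<bar> \<le> e * t" for A S y z
        using that by linarith
      show ?thesis by (rule tri[OF D[unfolded end_eq ux c] S[unfolded c]])
    qed
    have lim_j: "\<bar>?V_all m - f x - t * g x\<bar> \<le> \<kappa> + 3 * e * t"
      if m: "m0 \<le> m" and xm: "x \<in> inner_interval l R m"
        and \<kappa>: "\<And>y. y \<notin> inner_interval l R m \<Longrightarrow> \<bar>?F y\<bar> \<le> \<kappa>" "0 \<le> \<kappa>" for m \<kappa>
    proof -
      obtain u where u: "u \<in> C02_line" "continuous_on UNIV u" "\<And>x. x \<in> inner_interval l R m \<Longrightarrow> u x = f x"
        "\<And>x. \<bar>u x\<bar> \<le> \<bar>?F x\<bar>"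
        "\<And>x. x \<in> inner_interval l R m \<Longrightarrow> \<bar>stable_op \<alpha> a b c u x - g x\<bar> \<le> e"
        using cutoff_approximation[OF alpha bc(1,2) lR f e, of m a] unfolding g_def by blast
      obtain tu where tu: "0 < tu" "\<And>t x. 0 < t \<Longrightarrow> t < tu \<Longrightarrow> \<bar>(transition_semigroup M X t u x - u x) / t - stable_op \<alpha> a b c u x\<bar> < e"
        using feller_generatorD[OF generator[OF u(1)] e] by (metis UNIV_I)
      have "(\<lambda>j. t * (1 / 2) ^ j) \<longlonglongrightarrow> t * 0" by (intro tendsto_intros LIMSEQ_realpow_zero) auto
      then have "(\<lambda>j. t / 2 ^ j) \<longlonglongrightarrow> 0" by (simp add: power_divide)
      then have ev: "\<forall>\<^sub>F j in sequentially. t / 2 ^ j < tu" using tu(1) by (rule order_tendstoD)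
      have lim: "(\<lambda>j. \<bar>?V m j - f x - t * g x\<bar>) \<longlonglongrightarrow>
        \<bar>?V_all m - f x - t * g x\<bar>"
        by (intro tendsto_intros tendsto_survival_integral(1)[OF Fm BF(2) t(1)])
      show ?thesis
      proof (rule tendsto_upperbound[OF lim])
        show "\<forall>\<^sub>F j in sequentially. \<bar>?V m j - f x - t * g x\<bar> \<le> \<kappa> + 3 * e * t"
          using ev by eventually_elim (rule grid[OF m xm \<kappa> u tu(2)])
      qed simp
    qed
    let ?L = "\<integral>w. (if \<exists>m. \<forall>j. ?I m j w then ?F (x + X t w) else 0) \<partial>M"
    have "\<bar>?L - f x - t * g x\<bar> \<le> \<kappa> + 3 * e * t" if \<kappa>: "0 < \<kappa>" for \<kappa>
    proof -
      obtain m1 where m1: "\<And>m y. m1 \<le> m \<Longrightarrow> y \<notin> inner_interval l R m \<Longrightarrow> \<bar>?F y\<bar> \<le> \<kappa>"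
        using small_off_inner[OF lR fC \<kappa>] by blast
      obtain m2 where m2: "x \<in> inner_interval l R m2"
        using eventually_inside_inner[of l x R] x unfolding inner_interval_def
        by (metis atLeastAtMost_iff greaterThanLessThan_iff less_imp_le)
      have ev: "\<forall>\<^sub>F m in sequentially. m0 \<le> m \<and> m1 \<le> m \<and> m2 \<le> m"
        by (intro eventually_conj eventually_ge_at_top)
      have lim: "(\<lambda>m. \<bar>?V_all m - f x - t * g x\<bar>) \<longlonglongrightarrow> \<bar>?L - f x - t * g x\<bar>"
        by (intro tendsto_intros tendsto_survival_integral(2)[OF Fm BF(2) t(1)])
      show ?thesis
      proof (rule tendsto_upperbound[OF lim])
        show "\<forall>\<^sub>F m in sequentially. \<bar>?V_all m - f x - t * g x\<bar> \<le> \<kappa> + 3 * e * t"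
          using ev
        proof eventually_elim
          case (elim m)
          show ?case
          proof (rule lim_j)
            show "m0 \<le> m" using elim by simp
            show "x \<in> inner_interval l R m" using m2 elim inner_interval_mono by blast
            show "\<bar>?F y\<bar> \<le> \<kappa>" if "y \<notin> inner_interval l R m" for y using m1 elim that by blast
          qed (use \<kappa> in simp)
        qed
      qed simp
    qed
    then have "\<bar>?L - f x - t * g x\<bar> \<le> 3 * e * t"
      using field_le_epsilon[of "\<bar>?L - f x - t * g x\<bar>" "3 * e * t"] by (simp add: add.commute)
    then show "\<bar>killed_semigroup M X ?\<Omega> t f x - f x - t * stable_op_on ?\<Omega> \<alpha> a b c f x\<bar> \<le> 3 * e * t"
      unfolding killed_semigroup_eq[OF lR fC x t(1)] g_def by simp
  qed
qed

lemma killed_generator: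
  assumes lR: "l < R" and f: "f \<in> C02 {l<..<R}"
    and g: "stable_op_on {l<..<R} \<alpha> a b c f \<in> C0 {l<..<R}"
  shows "(f, stable_op_on {l<..<R} \<alpha> a b c f) \<in> feller_generator {l<..<R} (killed_semigroup M X {l<..<R})"
proof -
  let ?g = "stable_op_on {l<..<R} \<alpha> a b c f" let ?P = "killed_semigroup M X {l<..<R}"
  have "\<forall>\<^sub>F t in at_right 0. \<forall>x\<in>{l<..<R}. dist ((?P t f x - f x) / t) (?g x) < e" if e: "0 < e" for e
  proof -
    have "0 < e / 4" using e by simp
    then obtain t0 where t0: "0 < t0" "\<And>x t. x \<in> {l<..<R} \<Longrightarrow> 0 < t \<Longrightarrow> t < t0 \<Longrightarrow>
      \<bar>?P t f x - f x - t * ?g x\<bar> \<le> 3 * (e / 4) * t"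
      using killed_increment_estimate[OF lR f g] by blast
    have "dist ((?P t f x - f x) / t) (?g x) < e" if x: "x \<in> {l<..<R}" and t: "0 < t" "t < t0" for x t
    proof -
      have "(?P t f x - f x) / t - ?g x = (?P t f x - f x - t * ?g x) / t" using t by (simp add: field_simps)
      then have "dist ((?P t f x - f x) / t) (?g x) = \<bar>?P t f x - f x - t * ?g x\<bar> / t"
        using t by (simp add: dist_real_def)
      also have "\<dots> \<le> 3 * (e / 4) * t / t" using t0(2)[OF x t] t by (intro divide_right_mono) auto
      also have "\<dots> < e" using e t by simp
      finally show ?thesis .
    qed
    then show ?thesis unfolding eventually_at_right_field using t0(1) by blast
  qed
  then show ?thesis using f g by (auto simp: feller_generator_def uniform_limit_iff C02_def)
qed

end

theorem theorem4p3:
  fixes M :: "'w measure" and X :: "real \<Rightarrow> 'w \<Rightarrow> real"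
    and \<alpha> a b c l R :: real
  assumes alpha: "1 < \<alpha>" "\<alpha> < 2"
    and bc: "0 \<le> b" "0 \<le> c" "\<not> (b = 0 \<and> c = 0)"
    and process: "stable_levy_process M X \<alpha>"
    and generator: "\<And>f. f \<in> C02_line \<Longrightarrow>
      (f, stable_op \<alpha> a b c f) \<in> feller_generator UNIV (transition_semigroup M X)"
    and interval: "l < R"
  shows "(\<forall>f \<in> C02 {l<..<R}. \<forall>x \<in> {l<..<R}.
            integrable (jump_measure \<alpha> b c) (jump_integrand (zero_ext {l<..<R} f) x) \<and>
            rl_deriv_left_exists \<alpha> l f x \<and> rl_deriv_right_exists \<alpha> R f x \<and>
            stable_op_on {l<..<R} \<alpha> a b c f x =
              - a * deriv f x + b * rl_deriv_left \<alpha> l f x + c * rl_deriv_right \<alpha> R f x) \<and>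
         (\<forall>f \<in> C02 {l<..<R}. stable_op_on {l<..<R} \<alpha> a b c f \<in> C0 {l<..<R} \<longrightarrow>
            (f, stable_op_on {l<..<R} \<alpha> a b c f) \<in>
              feller_generator {l<..<R} (killed_semigroup M X {l<..<R}))"
proof -
  interpret stable_process_with_generator M X \<alpha> a b c
    by (intro stable_process_with_generator.intro process stable_process_with_generator_axioms.intro alpha bc generator)
  show ?thesis
    using stable_op_on_fractional[OF alpha bc(1,2) interval] killed_generator[OF interval] by blast
qed

end
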